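(* Let $A$ be a $C^*$-algebra. A tracial linear functional $\tau\colon \mathrm{Ped}(A) \to \mathbb C$ is continuous if and only if it is a (complex) linear combination of positive traces on $\mathrm{Ped}(A)$.
   Context: $\mathrm{Ped}(A)$ denotes the Pedersen ideal of $A$ (the unique minimal norm-dense two-sided ideal of $A$). It is the directed union of the $C^*$-subalgebras $D$ of $A$ with $D\subseteq\mathrm{Ped}(A)$ and is equipped with the corresponding locally convex direct limit topology; thus a linear functional on $\mathrm{Ped}(A)$ is continuous iff its restriction to every such $D$ is bounded. A functional $\tau$ is tracial (a trace) if $\tau(xy)=\tau(yx)$ for all $x,y\in\mathrm{Ped}(A)$, and positive if $\tau(a)\ge0$ for all $a\in\mathrm{Ped}(A)\cap A_+$. *)

theory Defs
  imports "HOL-Analysis.Analysis"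
begin

section \<open>C*-algebras (not necessarily unital)\<close>

text \<open>Submultiplicativity of the norm comes from \<^class>\<open>real_normed_algebra\<close>, which does not assume
  a unit and admits the zero algebra.\<close>

class c_star_algebra = real_normed_algebra + banach +
  fixes scaleC :: "complex \<Rightarrow> 'a \<Rightarrow> 'a" (infixr "*\<^sub>C" 75)
    and cstar :: "'a \<Rightarrow> 'a"
  assumes scaleC_add_right: "c *\<^sub>C (x + y) = c *\<^sub>C x + c *\<^sub>C y"
    and scaleC_add_left: "(c + d) *\<^sub>C x = c *\<^sub>C x + d *\<^sub>C x"
    and scaleC_scaleC: "c *\<^sub>C (d *\<^sub>C x) = (c * d) *\<^sub>C x"
    and scaleR_scaleC: "r *\<^sub>R x = complex_of_real r *\<^sub>C x"
    and norm_scaleC: "norm (c *\<^sub>C x) = cmod c * norm x"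
    and mult_scaleC_left: "(c *\<^sub>C x) * y = c *\<^sub>C (x * y)"
    and mult_scaleC_right: "x * (c *\<^sub>C y) = c *\<^sub>C (x * y)"
    and cstar_cstar: "cstar (cstar x) = x"
    and cstar_add: "cstar (x + y) = cstar x + cstar y"
    and cstar_scaleC: "cstar (c *\<^sub>C x) = cnj c *\<^sub>C cstar x"
    and cstar_mult: "cstar (x * y) = cstar y * cstar x"
    and norm_cstar_mult_self: "norm (cstar x * x) = (norm x)\<^sup>2"

definition csubspace :: "'a::c_star_algebra set \<Rightarrow> bool" where
  "csubspace S \<longleftrightarrow> 0 \<in> S \<and> (\<forall>x\<in>S. \<forall>y\<in>S. x + y \<in> S) \<and> (\<forall>c. \<forall>x\<in>S. c *\<^sub>C x \<in> S)"

definition c_star_subalgebra :: "'a::c_star_algebra set \<Rightarrow> bool" where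
  "c_star_subalgebra D \<longleftrightarrow> csubspace D \<and> closed D \<and>
     (\<forall>x\<in>D. \<forall>y\<in>D. x * y \<in> D) \<and> (\<forall>x\<in>D. cstar x \<in> D)"

definition positive_cone :: "'a::c_star_algebra set" where
  "positive_cone = {cstar b * b | b. True}"


section \<open>The Pedersen ideal\<close>

definition two_sided_ideal :: "'a::c_star_algebra set \<Rightarrow> bool" where
  "two_sided_ideal I \<longleftrightarrow> csubspace I \<and> (\<forall>a. \<forall>x\<in>I. a * x \<in> I \<and> x * a \<in> I)"

definition dense_ideal :: "'a::c_star_algebra set \<Rightarrow> bool" where
  "dense_ideal I \<longleftrightarrow> two_sided_ideal I \<and> closure I = UNIV"

text \<open>By a theorem of Pedersen, every C*-algebra has exactly one minimal dense ideal, so the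
  description is proper.\<close>

definition Ped :: "'a::c_star_algebra set" where
  "Ped = (THE I. dense_ideal I \<and> (\<forall>J. dense_ideal J \<and> J \<subseteq> I \<longrightarrow> J = I))"


section \<open>The locally convex direct limit topology\<close>

text \<open>For a directed family \<open>\<D>\<close> of subspaces with union \<open>V\<close>, each with its norm topology:
  the sets \<open>N\<close> below form a base of neighbourhoods of \<open>0\<close> for the finest locally convex topology
  on \<open>V\<close> that makes all inclusions \<open>D \<subseteq> V\<close> continuous. Since the members of \<open>\<D>\<close> are meant to
  cover \<open>V\<close>, such sets are automatically absorbing. The condition \<open>0 \<in> N\<close> only excludes the
  empty set.\<close>

definition direct_limit_nhd ::
    "'a::c_star_algebra set \<Rightarrow> 'a set set \<Rightarrow> 'a set \<Rightarrow> bool" where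
  "direct_limit_nhd V \<D> N \<longleftrightarrow> N \<subseteq> V \<and> 0 \<in> N \<and> convex N \<and>
     (\<forall>c. \<forall>x\<in>N. cmod c \<le> 1 \<longrightarrow> c *\<^sub>C x \<in> N) \<and>
     (\<forall>D\<in>\<D>. openin (top_of_set D) (N \<inter> D))"

definition direct_limit_topology ::
    "'a::c_star_algebra set \<Rightarrow> 'a set set \<Rightarrow> 'a topology" where
  "direct_limit_topology V \<D> = topology (\<lambda>U. U \<subseteq> V \<and>
     (\<forall>x\<in>U. \<exists>N. direct_limit_nhd V \<D> N \<and> (+) x ` N \<subseteq> U))"

lemma direct_limit_nhd_Int:
  assumes "direct_limit_nhd V \<D> M" "direct_limit_nhd V \<D> N"
  shows "direct_limit_nhd V \<D> (M \<inter> N)"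
proof -
  have "openin (top_of_set D) (M \<inter> N \<inter> D)" if "D \<in> \<D>" for D
  proof -
    have "openin (top_of_set D) ((M \<inter> D) \<inter> (N \<inter> D))"
      using assms that unfolding direct_limit_nhd_def by (meson openin_Int)
    moreover have "(M \<inter> D) \<inter> (N \<inter> D) = M \<inter> N \<inter> D" by blast
    ultimately show ?thesis by simp
  qed
  then show ?thesis
    using assms unfolding direct_limit_nhd_def by (auto intro: convex_Int)
qed

lemma openin_direct_limit_topology:
  "openin (direct_limit_topology V \<D>) U \<longleftrightarrow>
     U \<subseteq> V \<and> (\<forall>x\<in>U. \<exists>N. direct_limit_nhd V \<D> N \<and> (+) x ` N \<subseteq> U)"
proof -
  let ?P = "\<lambda>U. U \<subseteq> V \<and> (\<forall>x\<in>U. \<exists>N. direct_limit_nhd V \<D> N \<and> (+) x ` N \<subseteq> U)"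
  have "?P (S \<inter> T)" if S: "?P S" and T: "?P T" for S T
  proof (intro conjI ballI)
    show "S \<inter> T \<subseteq> V" using S by blast
    fix x assume "x \<in> S \<inter> T"
    then obtain M N where "direct_limit_nhd V \<D> M" "(+) x ` M \<subseteq> S"
      and "direct_limit_nhd V \<D> N" "(+) x ` N \<subseteq> T"
      using S T by blast
    then show "\<exists>N. direct_limit_nhd V \<D> N \<and> (+) x ` N \<subseteq> S \<inter> T"
      by (intro exI[of _ "M \<inter> N"]) (auto intro: direct_limit_nhd_Int)
  qed
  moreover have "?P (\<Union>K)" if K: "\<forall>S\<in>K. ?P S" for K
  proof (intro conjI ballI)
    show "\<Union>K \<subseteq> V" using K by blast
    fix x assume "x \<in> \<Union>K"
    then obtain S where "S \<in> K" "x \<in> S" by blast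
    with K obtain N where "direct_limit_nhd V \<D> N" "(+) x ` N \<subseteq> S" by blast
    with \<open>S \<in> K\<close> show "\<exists>N. direct_limit_nhd V \<D> N \<and> (+) x ` N \<subseteq> \<Union>K" by blast
  qed
  ultimately have "istopology ?P"
    unfolding istopology_def by blast
  then show ?thesis
    by (simp add: direct_limit_topology_def)
qed

definition Ped_topology :: "'a::c_star_algebra topology" where
  "Ped_topology = direct_limit_topology Ped {D. c_star_subalgebra D \<and> D \<subseteq> Ped}"


section \<open>Traces on the Pedersen ideal\<close>

text \<open>A functional on \<^const>\<open>Ped\<close> is a function on the whole type, of which only the values on
  \<^const>\<open>Ped\<close> matter.\<close>

definition linear_functional_on_Ped :: "('a::c_star_algebra \<Rightarrow> complex) \<Rightarrow> bool" where
  "linear_functional_on_Ped \<tau> \<longleftrightarrow>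
     (\<forall>x\<in>Ped. \<forall>y\<in>Ped. \<tau> (x + y) = \<tau> x + \<tau> y) \<and>
     (\<forall>c. \<forall>x\<in>Ped. \<tau> (c *\<^sub>C x) = c * \<tau> x)"

definition tracial_on_Ped :: "('a::c_star_algebra \<Rightarrow> complex) \<Rightarrow> bool" where
  "tracial_on_Ped \<tau> \<longleftrightarrow> (\<forall>x\<in>Ped. \<forall>y\<in>Ped. \<tau> (x * y) = \<tau> (y * x))"

definition positive_on_Ped :: "('a::c_star_algebra \<Rightarrow> complex) \<Rightarrow> bool" where
  "positive_on_Ped \<tau> \<longleftrightarrow> (\<forall>a\<in>Ped \<inter> positive_cone. \<tau> a \<in> \<real>\<^sub>\<ge>\<^sub>0)"

definition positive_trace_on_Ped :: "('a::c_star_algebra \<Rightarrow> complex) \<Rightarrow> bool" where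
  "positive_trace_on_Ped \<tau> \<longleftrightarrow>
     linear_functional_on_Ped \<tau> \<and> tracial_on_Ped \<tau> \<and> positive_on_Ped \<tau>"

end

theory Submission
  imports Defs
begin

text \<open>The Pedersen ideal of \<open>A\<close> is spanned by the products \<open>c h\<close> for which \<open>h\<close> has a left unit in
  \<open>A\<close>: such an \<open>h\<close> lies in every dense ideal. Every element of \<open>Ped(A)\<close> lies in a hereditary
  C*-subalgebra contained in \<open>Ped(A)\<close>, on which a continuous trace is bounded. For a hermitian
  continuous trace \<open>\<tau>\<close>, the function \<open>a \<mapsto> sup {\<tau> y | 0 \<le> y \<le> a}\<close> is additive on the positive cone,
  because \<open>y \<le> a + b\<close> is close to a sum of two elements that are equivalent, via
  \<open>z\<^sup>* z \<sim> z z\<^sup>*\<close>, to positive elements below \<open>a\<close> and \<open>b\<close>. Its linear extension \<open>\<sigma>\<close> and \<open>\<sigma> - \<tau>\<close>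
  are positive traces. Conversely, a positive functional is bounded on every C*-subalgebra by a
  gliding hump argument. Positivity is handled through square roots obtained by iteration,
  without spectra or functional calculus.\<close>

section \<open>Elementary C*-algebra identities\<close>

text \<open>The supremum is the Riesz-Kantorovich formula. Its additivity normally rests on the
  Riesz decomposition property: every y with 0 \<le> y \<le> a + b splits into parts below a and
  below b. Noncommutative positive cones lack this property. A trace does not distinguish
  \<open>cstar z * z\<close> from \<open>z * cstar z\<close>, so a splitting up to this equivalence
  suffices. The splitting is only approximate; boundedness of \<tau> on a hereditary subalgebra
  containing all y \<le> a makes the supremum finite and the error small. This is why each element
  of the Pedersen ideal must be placed in a hereditary subalgebra inside the ideal. The algebra may
  lack a unit, while inverses of a + \<epsilon> and the criterion that R - a has norm at most R
  require one. The work is therefore done for a closed ideal \<open>J\<close> of a unital algebra,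
  and A becomes such an ideal of its unitization. The Pedersen ideal is formed relative to
  \<open>J\<close>, since a unital algebra is its own Pedersen ideal. General traces are split into
  hermitian ones because the supremum compares real values.\<close>

lemma norm_cstar [simp]: "norm (cstar x) = norm (x::'a::c_star_algebra)"
proof -
  have le: "norm y \<le> norm (cstar y)" for y :: 'a
  proof (cases "y = 0")
    case False
    have "norm y * norm y \<le> norm (cstar y) * norm y"
      using norm_mult_ineq[of "cstar y" y] by (simp add: norm_cstar_mult_self power2_eq_square)
    with False show ?thesis by simp
  qed simp
  from le[of x] le[of "cstar x"] show ?thesis by (simp add: cstar_cstar)
qed

lemma cstar_scaleR [simp]: "cstar (r *\<^sub>R x) = r *\<^sub>R cstar (x::'a::c_star_algebra)"
  by (simp add: scaleR_scaleC cstar_scaleC)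

lemma cstar_zero [simp]: "cstar (0::'a::c_star_algebra) = 0"
  using cstar_scaleR[of 0 "0::'a"] by simp

lemma cstar_minus [simp]: "cstar (- x) = - cstar (x::'a::c_star_algebra)"
  using cstar_scaleR[of "-1" x] by simp

lemma cstar_diff: "cstar (x - y) = cstar x - cstar (y::'a::c_star_algebra)"
  using cstar_add[of x "- y"] by simp

lemma cstar_one [simp]: "cstar (1::'a::{c_star_algebra,real_normed_algebra_1}) = 1"
  by (metis cstar_cstar cstar_mult mult_1_left)

lemma bounded_linear_cstar: "bounded_linear (cstar :: 'a::c_star_algebra \<Rightarrow> 'a)"
  by (rule bounded_linear_intro[where K = 1]) (auto simp: cstar_add)

lemmas tendsto_cstar [tendsto_intros] = bounded_linear.tendsto[OF bounded_linear_cstar]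

lemma scaleC_one [simp]: "1 *\<^sub>C x = (x::'a::c_star_algebra)"
  using scaleR_scaleC[of 1 x] by simp

lemma scaleC_minus_one: "(-1) *\<^sub>C x = - (x::'a::c_star_algebra)"
  using scaleR_scaleC[of "-1" x] by simp

lemma scaleC_zero_left [simp]: "0 *\<^sub>C x = (0::'a::c_star_algebra)"
  using scaleR_scaleC[of 0 x] by simp

lemma scaleC_zero_right [simp]: "c *\<^sub>C 0 = (0::'a::c_star_algebra)"
  using scaleC_add_right[of c "0::'a" 0] by simp

lemma scaleC_minus_right [simp]: "c *\<^sub>C (- x) = - (c *\<^sub>C (x::'a::c_star_algebra))"
  by (metis scaleC_minus_one scaleC_scaleC mult.commute)

lemma scaleC_minus_left: "(- c) *\<^sub>C x = - (c *\<^sub>C (x::'a::c_star_algebra))"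
  by (metis scaleC_minus_one scaleC_scaleC mult_minus1)

lemma scaleC_diff_left: "(c - d) *\<^sub>C x = c *\<^sub>C x - d *\<^sub>C (x::'a::c_star_algebra)"
  using scaleC_add_left[of c "- d" x] by (simp add: scaleC_minus_left)

lemma scaleC_diff_right: "c *\<^sub>C (x - y) = c *\<^sub>C x - c *\<^sub>C (y::'a::c_star_algebra)"
  using scaleC_add_right[of c x "- y"] by simp

lemma scaleC_scaleR: "c *\<^sub>C (r *\<^sub>R x) = r *\<^sub>R (c *\<^sub>C (x::'a::c_star_algebra))"
  by (simp add: scaleR_scaleC scaleC_scaleC mult.commute)

lemma norm_mult_cstar_self: "norm (x * cstar x) = (norm (x::'a::c_star_algebra))\<^sup>2"
  using norm_cstar_mult_self[of "cstar x"] by (simp add: cstar_cstar)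

lemma norm_selfadjoint_mult:
  "cstar h = h \<Longrightarrow> norm (h * h) = (norm (h::'a::c_star_algebra))\<^sup>2"
  using norm_cstar_mult_self[of h] by simp

definition re_part :: "'a::c_star_algebra \<Rightarrow> 'a" where
  "re_part x = (1/2) *\<^sub>R (x + cstar x)"

definition im_part :: "'a::c_star_algebra \<Rightarrow> 'a" where
  "im_part x = (1/2) *\<^sub>R (\<i> *\<^sub>C (cstar x - x))"

lemma cstar_re_part [simp]: "cstar (re_part x) = re_part x"
  by (simp add: re_part_def cstar_add cstar_cstar add.commute)

lemma cstar_im_part [simp]: "cstar (im_part x) = im_part x"
  by (simp add: im_part_def cstar_diff cstar_cstar cstar_scaleC scaleC_minus_left scaleC_diff_right
      scaleR_diff_right)

lemma re_im_decomp: "x = re_part x + \<i> *\<^sub>C im_part (x::'a::c_star_algebra)"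
proof -
  have "\<i> *\<^sub>C im_part x = (1/2) *\<^sub>R (x - cstar x)"
    by (simp add: im_part_def scaleC_scaleR scaleC_scaleC scaleC_minus_one)
  then have "re_part x + \<i> *\<^sub>C im_part x = (1/2) *\<^sub>R (x + x)"
    by (simp add: re_part_def flip: scaleR_add_right)
  then show ?thesis by (simp flip: scaleR_2)
qed

lemma norm_re_part: "norm (re_part x) \<le> norm x"
  using norm_triangle_ineq[of x "cstar x"] by (simp add: re_part_def)

lemma norm_im_part: "norm (im_part x) \<le> norm x"
  using norm_triangle_ineq4[of "cstar x" x] by (simp add: im_part_def norm_scaleC)

lemma re_im_parts_eq:
  assumes "cstar h = h" "cstar k = k"
  shows "re_part (h + \<i> *\<^sub>C k) = h" and "im_part (h + \<i> *\<^sub>C k) = k"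
proof -
  have s: "cstar (h + \<i> *\<^sub>C k) = h - \<i> *\<^sub>C k"
    by (simp add: cstar_add cstar_scaleC scaleC_minus_left assms)
  show "re_part (h + \<i> *\<^sub>C k) = h"
    unfolding re_part_def s by (simp flip: scaleR_2)
  have "\<i> *\<^sub>C (h - \<i> *\<^sub>C k - (h + \<i> *\<^sub>C k)) = k + k"
    by (simp add: scaleC_diff_right scaleC_scaleC scaleC_minus_one)
  then show "im_part (h + \<i> *\<^sub>C k) = k"
    unfolding im_part_def s by (simp flip: scaleR_2)
qed


section \<open>Square roots\<close>

text \<open>The equation (1 - y)^2 = 1 - h is equivalent to y = (h + y^2) / 2, which is iterated
  from 0. The recursion also makes sense over the reals, and the real iterates at
  \<open>norm h\<close> dominate the norms of the iterates of \<open>h\<close>.\<close>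

primrec root_iter :: "'a::real_normed_algebra \<Rightarrow> nat \<Rightarrow> 'a" where
  "root_iter h 0 = 0"
| "root_iter h (Suc n) = (1/2) *\<^sub>R (h + root_iter h n * root_iter h n)"

text \<open>The limit is \<open>1 - sqrt (1 - h)\<close> when \<open>norm h \<le> 1\<close>.\<close>

definition root_defect :: "'a::{real_normed_algebra,banach} \<Rightarrow> 'a" where
  "root_defect h = lim (root_iter h)"

lemma root_iter_intertwine:
  "h * c = c * k \<Longrightarrow> root_iter h n * c = c * root_iter k n"
proof (induction n)
  case (Suc n)
  have "root_iter h n * root_iter h n * c = c * (root_iter k n * root_iter k n)"
    using Suc by (metis mult.assoc)
  then show ?case using Suc by (simp add: algebra_simps)
qed simp

lemma root_iter_real_bounds:
  fixes t :: real
  assumes "0 \<le> t" "t \<le> 1"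
  shows "0 \<le> root_iter t n" "root_iter t n \<le> root_iter t (Suc n)" "root_iter t n \<le> 1"
proof -
  show *: "0 \<le> root_iter t n" for n
    by (induction n) (auto simp: assms)
  show "root_iter t n \<le> root_iter t (Suc n)"
  proof (induction n)
    case (Suc n)
    then have "root_iter t n * root_iter t n \<le> root_iter t (Suc n) * root_iter t (Suc n)"
      using *[of n] by (intro mult_mono) (auto simp: * simp del: root_iter.simps)
    then show ?case by simp
  qed (simp add: assms)
  show "root_iter t n \<le> 1"
  proof (induction n)
    case (Suc n)
    then have "root_iter t n * root_iter t n \<le> 1 * 1"
      using *[of n] by (intro mult_mono) auto
    then show ?case using assms by simp
  qed simp
qed

lemma norm_root_iter_le:
  fixes h :: "'a::real_normed_algebra"
  shows "norm (root_iter h n) \<le> root_iter (norm h) n"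
proof (induction n)
  case (Suc n)
  have "norm (root_iter h n * root_iter h n) \<le> root_iter (norm h) n * root_iter (norm h) n"
    by (rule order_trans[OF norm_mult_ineq mult_mono])
      (use Suc in \<open>auto intro: order_trans[OF norm_ge_zero]\<close>)
  then show ?case
    using norm_triangle_ineq[of h "root_iter h n * root_iter h n"] by simp
qed simp

text \<open>The iterates are polynomials in \<open>h\<close> and commute, so a difference of squares
  is difference times sum. Induction bounds the first factor, the triangle inequality the
  second.\<close>

lemma root_iter_step:
  fixes h :: "'a::real_normed_algebra"
  assumes h: "norm h \<le> 1"
  shows "norm (root_iter h (Suc n) - root_iter h n) \<le> root_iter (norm h) (Suc n) - root_iter (norm h) n"
proof (induction n)
  case (Suc n)
  let ?y = "root_iter h" and ?t = "root_iter (norm h)"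
  have comm: "?y n * h = h * ?y n" for n
    using root_iter_intertwine[of h h h n] by simp
  have "?y (Suc n) * ?y n = ?y n * ?y (Suc n)"
    by (simp add: algebra_simps comm)
  then have "(?y (Suc n) - ?y n) * (?y (Suc n) + ?y n) = ?y (Suc n) * ?y (Suc n) - ?y n * ?y n"
    by (simp add: algebra_simps del: root_iter.simps)
  then have "?y (Suc (Suc n)) - ?y (Suc n) = (1/2) *\<^sub>R ((?y (Suc n) - ?y n) * (?y (Suc n) + ?y n))"
    unfolding root_iter.simps(2)[of h "Suc n"] root_iter.simps(2)[of h n] scaleR_diff_right[symmetric]
    by (intro arg_cong[of _ _ "\<lambda>z. (1/2) *\<^sub>R z"]) (simp del: root_iter.simps)
  then have "norm (?y (Suc (Suc n)) - ?y (Suc n)) \<le> (1/2) * (norm (?y (Suc n) - ?y n) * norm (?y (Suc n) + ?y n))"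
    by (simp add: norm_mult_ineq del: root_iter.simps)
  also have "norm (?y (Suc n) - ?y n) * norm (?y (Suc n) + ?y n) \<le> (?t (Suc n) - ?t n) * (?t (Suc n) + ?t n)"
    by (rule mult_mono[OF Suc norm_triangle_mono[OF norm_root_iter_le norm_root_iter_le]])
      (use root_iter_real_bounds(2)[OF norm_ge_zero h, of n] in \<open>auto simp del: root_iter.simps\<close>)
  then have "(1/2) * (norm (?y (Suc n) - ?y n) * norm (?y (Suc n) + ?y n)) \<le>
      (1/2) * ((?t (Suc n) - ?t n) * (?t (Suc n) + ?t n))"
    by (simp del: root_iter.simps)
  also have "(1/2) * ((?t (Suc n) - ?t n) * (?t (Suc n) + ?t n)) = ?t (Suc (Suc n)) - ?t (Suc n)"
  proof -
    have "(?t (Suc n) - ?t n) * (?t (Suc n) + ?t n) = ?t (Suc n) * ?t (Suc n) - ?t n * ?t n"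
      by (simp add: algebra_simps del: root_iter.simps)
    then show ?thesis
      unfolding root_iter.simps(2)[of _ "Suc n"] by (simp add: field_simps)
  qed
  finally show ?case .
qed simp

text \<open>The scalar increments are nonnegative with bounded partial sums, so the increments of
  the iteration are absolutely summable. This reaches the boundary case \<open>norm h = 1\<close>,
  where no uniform contraction constant below 1 is available.\<close>

lemma root_iter_tendsto:
  fixes h :: "'a::{real_normed_algebra,banach}"
  assumes h: "norm h \<le> 1"
  shows "root_iter h \<longlonglongrightarrow> root_defect h"
proof -
  let ?t = "root_iter (norm h)"
  have "norm (?t n) \<le> 1" for n
    using root_iter_real_bounds[OF norm_ge_zero h, of n] by simp
  then have "Bseq ?t" by (rule BseqI')
  moreover have "incseq ?t"
    by (rule incseq_SucI) (rule root_iter_real_bounds(2)[OF norm_ge_zero h])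
  ultimately have "convergent ?t"
    by (intro Bseq_mono_convergent) (auto dest: incseqD)
  then have "summable (\<lambda>n. ?t (Suc n) - ?t n)"
    unfolding convergent_def using telescope_sums sums_summable by blast
  then have "summable (\<lambda>n. root_iter h (Suc n) - root_iter h n)"
    by (rule summable_comparison_test') (rule root_iter_step[OF h])
  then have "convergent (\<lambda>n. \<Sum>i<n. root_iter h (Suc i) - root_iter h i)"
    by (simp add: summable_iff_convergent del: root_iter.simps)
  then have "convergent (root_iter h)"
    by (simp add: sum_lessThan_telescope del: root_iter.simps(2))
  then show ?thesis
    unfolding root_defect_def by (simp add: convergent_LIMSEQ_iff)
qed

lemma root_defect_eq:
  fixes h :: "'a::{real_normed_algebra_1,banach}"
  assumes h: "norm h \<le> 1"
  shows "(1 - root_defect h) * (1 - root_defect h) = 1 - h"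
proof -
  let ?y = "root_defect h"
  note lim = root_iter_tendsto[OF h]
  have "(\<lambda>n. root_iter h (Suc n)) \<longlonglongrightarrow> (1/2) *\<^sub>R (h + ?y * ?y)"
    unfolding root_iter.simps by (intro tendsto_intros lim)
  then have eq: "?y = (1/2) *\<^sub>R (h + ?y * ?y)"
    by (rule LIMSEQ_unique[OF LIMSEQ_Suc[OF lim]])
  have "2 *\<^sub>R ?y = 2 *\<^sub>R ((1/2) *\<^sub>R (h + ?y * ?y))"
    by (rule arg_cong[OF eq])
  also have "\<dots> = h + ?y * ?y" by simp
  finally have "?y + ?y = h + ?y * ?y" by (simp add: scaleR_2)
  then show ?thesis by (simp add: algebra_simps)
qed

lemma norm_root_defect:
  fixes h :: "'a::{real_normed_algebra,banach}"
  assumes h: "norm h \<le> 1"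
  shows "norm (root_defect h) \<le> 1"
  by (rule LIMSEQ_le_const2[OF tendsto_norm[OF root_iter_tendsto[OF h]]])
    (meson norm_root_iter_le root_iter_real_bounds(3)[OF norm_ge_zero h] order_trans)

lemma root_defect_intertwine:
  fixes h :: "'a::{real_normed_algebra,banach}"
  assumes "norm h \<le> 1" "norm k \<le> 1" "h * c = c * k"
  shows "root_defect h * c = c * root_defect k"
proof (rule LIMSEQ_unique)
  show "(\<lambda>n. root_iter h n * c) \<longlonglongrightarrow> root_defect h * c"
    by (intro tendsto_intros root_iter_tendsto assms)
  show "(\<lambda>n. root_iter h n * c) \<longlonglongrightarrow> c * root_defect k"
    unfolding root_iter_intertwine[OF assms(3)] by (intro tendsto_intros root_iter_tendsto assms)
qed

lemma cstar_root_defect: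
  assumes "norm h \<le> 1" "cstar h = (h::'a::c_star_algebra)"
  shows "cstar (root_defect h) = root_defect h"
proof (rule LIMSEQ_unique)
  have "cstar (root_iter h n) = root_iter h n" for n
    by (induction n) (auto simp: assms cstar_add cstar_mult)
  then show "root_iter h \<longlonglongrightarrow> cstar (root_defect h)"
    using tendsto_cstar[OF root_iter_tendsto[OF assms(1)]] by simp
qed (rule root_iter_tendsto[OF assms(1)])


section \<open>Positivity in a unital C*-algebra\<close>

text \<open>Squares of selfadjoint elements are chosen because the root iteration produces such
  squares directly. That every \<open>cstar b * b\<close> is one of them is the content of
  \<open>pos_cstar_mult_self\<close>.\<close>

definition pos :: "'b::{c_star_algebra,real_normed_algebra_1} \<Rightarrow> bool" where
  "pos a \<longleftrightarrow> (\<exists>h. cstar h = h \<and> a = h * h)"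

definition cle :: "'b::{c_star_algebra,real_normed_algebra_1} \<Rightarrow> 'b \<Rightarrow> bool"  (infix "\<preceq>" 50) where
  "a \<preceq> b \<longleftrightarrow> pos (b - a)"

lemma pos_selfadjoint: "pos a \<Longrightarrow> cstar a = a"
  by (auto simp: pos_def cstar_mult)

text \<open>Because \<open>h\<close> and \<open>k\<close> commute, U = h + i k satisfies
  \<open>cstar U * U = 1\<close> and has norm 1; now 2 i k = U - \<open>cstar U\<close>. This
  replaces a spectral estimate.\<close>

lemma norm_le_one_of_sum_squares:
  fixes h k :: "'b::{c_star_algebra,real_normed_algebra_1}"
  assumes sa: "cstar h = h" "cstar k = k" and comm: "h * k = k * h" and eq: "h * h + k * k = 1"
  shows "norm k \<le> 1"
proof -
  define U where "U = h + \<i> *\<^sub>C k"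
  have sU: "cstar U = h - \<i> *\<^sub>C k"
    by (simp add: U_def cstar_add cstar_scaleC sa scaleC_minus_left)
  have "cstar U * U = 1"
    using eq by (simp add: sU, simp add: U_def algebra_simps mult_scaleC_left mult_scaleC_right scaleC_scaleC
        scaleC_diff_right scaleC_minus_one comm)
  then have "(norm U)\<^sup>2 = 1"
    by (metis norm_cstar_mult_self norm_one)
  then have nU: "norm U = 1"
    by (metis abs_norm_cancel power2_eq_1_iff abs_minus_cancel abs_one)
  have "U - cstar U = 2 *\<^sub>R (\<i> *\<^sub>C k)"
    by (simp add: sU, simp add: U_def scaleR_2)
  then have "2 * norm k = norm (U - cstar U)"
    by (simp add: norm_scaleC)
  also have "\<dots> \<le> 2"
    using norm_triangle_ineq4[of U "cstar U"] nU by simp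
  finally show ?thesis by simp
qed

text \<open>The complementary root \<open>k\<close> of 1 - h^2 commutes with \<open>h\<close>, so
  the preceding lemma bounds \<open>k\<close>, hence also \<open>k * k\<close>.\<close>

lemma norm_one_minus_square:
  fixes h :: "'b::{c_star_algebra,real_normed_algebra_1}"
  assumes "cstar h = h" "norm h \<le> 1"
  shows "norm (1 - h * h) \<le> 1"
proof -
  have n: "norm (h * h) \<le> 1"
    using norm_mult_ineq[of h h] mult_mono[of "norm h" 1 "norm h" 1] assms by simp
  define k where "k = 1 - root_defect (h * h)"
  have sa: "cstar k = k"
    by (simp add: k_def cstar_diff cstar_root_defect[OF n] cstar_mult assms)
  have kk: "k * k = 1 - h * h"
    by (simp add: k_def root_defect_eq[OF n])
  have "root_defect (h * h) * h = h * root_defect (h * h)"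
    by (rule root_defect_intertwine[OF n n]) (simp add: mult.assoc)
  then have "h * k = k * h"
    by (simp add: k_def algebra_simps)
  then have "norm k \<le> 1"
    using norm_le_one_of_sum_squares[of h k] sa kk assms by simp
  then have "norm (k * k) \<le> 1"
    using norm_mult_ineq[of k k] mult_mono[of "norm k" 1 "norm k" 1] by simp
  then show ?thesis by (simp add: kk)
qed

text \<open>Together with its converse \<open>norm_le_imp_pos\<close> this describes positivity by a
  norm inequality. Closure of the cone under sums and limits then follows from the triangle
  inequality and continuity.\<close>

lemma pos_imp_norm_le:
  assumes "pos a" "norm a \<le> R"
  shows "norm (R *\<^sub>R 1 - a) \<le> R"
proof -
  obtain h where h: "cstar h = h" "a = h * h" using assms by (auto simp: pos_def)
  show ?thesis
  proof (cases "R > 0")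
    case True
    define h' where "h' = (1 / sqrt R) *\<^sub>R h"
    have hh: "h' * h' = (1/R) *\<^sub>R a"
      using True by (simp add: h'_def h)
    have "(norm h)\<^sup>2 \<le> R"
      using assms h norm_selfadjoint_mult by metis
    then have "norm h \<le> sqrt R" by (rule real_le_rsqrt)
    then have "norm h' \<le> 1" using True by (simp add: h'_def)
    moreover have "cstar h' = h'" by (simp add: h'_def h)
    ultimately have "norm (1 - h' * h') \<le> 1" by (intro norm_one_minus_square)
    then have "norm (R *\<^sub>R (1 - h' * h')) \<le> R" using True by simp
    also have "R *\<^sub>R (1 - h' * h') = R *\<^sub>R 1 - a"
      using True by (simp add: hh scaleR_diff_right)
    finally show ?thesis .
  next
    case False
    then have "R = 0" using assms order_trans[OF norm_ge_zero] by force
    with assms show ?thesis by simp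
  qed
qed

text \<open>Division by the norm brings the argument of \<open>root_defect\<close> into the unit
  ball when \<open>a\<close> is positive. For \<open>a = 0\<close> the quotient is 0 by convention,
  and the outer factor makes the value 0.\<close>

definition pos_sqrt :: "'b::{c_star_algebra,real_normed_algebra_1} \<Rightarrow> 'b" where
  "pos_sqrt a = sqrt (norm a) *\<^sub>R (1 - root_defect (1 - (1 / norm a) *\<^sub>R a))"

lemma norm_le_imp_pos:
  assumes sa: "cstar a = a" and le: "norm (R *\<^sub>R 1 - a) \<le> R"
  shows "pos a"
proof (cases "R = 0")
  case True
  then show ?thesis using le by (auto simp: pos_def intro: exI[of _ 0])
next
  case False
  then have R: "R > 0" using order_trans[OF norm_ge_zero le] by simp
  define b where "b = 1 - (1/R) *\<^sub>R a"
  have "b = (1/R) *\<^sub>R (R *\<^sub>R 1 - a)" using R by (simp add: b_def scaleR_diff_right)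
  then have n: "norm b \<le> 1" using le R by simp
  have sb: "cstar b = b" by (simp add: b_def cstar_diff sa)
  define s where "s = sqrt R *\<^sub>R (1 - root_defect b)"
  have "s * s = a"
    using R by (simp add: s_def root_defect_eq[OF n]) (simp add: b_def)
  moreover have "cstar s = s"
    by (simp add: s_def cstar_diff cstar_root_defect[OF n sb])
  ultimately show ?thesis unfolding pos_def by metis
qed

lemma pos_sqrt_arg_norm:
  assumes "pos a" shows "norm (1 - (1 / norm a) *\<^sub>R a) \<le> 1"
proof (cases "a = 0")
  case False
  have "1 - (1 / norm a) *\<^sub>R a = (1 / norm a) *\<^sub>R (norm a *\<^sub>R 1 - a)"
    using False by (simp add: scaleR_diff_right)
  then show ?thesis using pos_imp_norm_le[OF assms order_refl] False by simp
qed simp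

lemma pos_pos_sqrt:
  assumes "pos a" shows "pos (pos_sqrt a)"
proof -
  note n = pos_sqrt_arg_norm[OF assms]
  have sa: "cstar (root_defect (1 - (1 / norm a) *\<^sub>R a)) = root_defect (1 - (1 / norm a) *\<^sub>R a)"
    by (rule cstar_root_defect[OF n]) (simp add: cstar_diff pos_selfadjoint[OF assms])
  show ?thesis
  proof (rule norm_le_imp_pos[where R = "sqrt (norm a)"])
    show "cstar (pos_sqrt a) = pos_sqrt a"
      by (simp add: pos_sqrt_def cstar_diff sa)
    have "sqrt (norm a) *\<^sub>R 1 - pos_sqrt a = sqrt (norm a) *\<^sub>R root_defect (1 - (1 / norm a) *\<^sub>R a)"
      by (simp add: pos_sqrt_def scaleR_diff_right)
    then show "norm (sqrt (norm a) *\<^sub>R 1 - pos_sqrt a) \<le> sqrt (norm a)"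
      using norm_root_defect[OF n] by (simp add: mult_left_le)
  qed
qed

lemmas cstar_pos_sqrt = pos_selfadjoint[OF pos_pos_sqrt]

lemma pos_sqrt_mult_self:
  assumes "pos a" shows "pos_sqrt a * pos_sqrt a = a"
proof (cases "a = 0")
  case False
  then show ?thesis
    by (simp add: pos_sqrt_def root_defect_eq[OF pos_sqrt_arg_norm[OF assms]])
qed (simp add: pos_sqrt_def)

lemma pos_sqrt_commute:
  assumes "pos a" "a * c = c * a"
  shows "pos_sqrt a * c = c * pos_sqrt a"
proof -
  have "root_defect (1 - (1 / norm a) *\<^sub>R a) * c = c * root_defect (1 - (1 / norm a) *\<^sub>R a)"
    by (intro root_defect_intertwine pos_sqrt_arg_norm assms) (simp add: algebra_simps assms(2))
  then show ?thesis by (simp add: pos_sqrt_def algebra_simps)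
qed

lemma pos_zero [simp]: "pos 0" and pos_one [simp]: "pos 1"
  by (auto simp: pos_def intro: exI[of _ 0] exI[of _ 1])

lemma pos_scaleR: "pos a \<Longrightarrow> 0 \<le> r \<Longrightarrow> pos (r *\<^sub>R a)"
  unfolding pos_def
proof (elim exE conjE)
  fix h assume "0 \<le> r" "cstar h = h" "a = h * h"
  then show "\<exists>k. cstar k = k \<and> r *\<^sub>R a = k * k"
    by (intro exI[of _ "sqrt r *\<^sub>R h"]) simp
qed

lemma pos_add:
  assumes "pos a" "pos b" shows "pos (a + b)"
proof (rule norm_le_imp_pos[where R = "norm a + norm b"])
  have "(norm a + norm b) *\<^sub>R 1 - (a + b) = (norm a *\<^sub>R 1 - a) + (norm b *\<^sub>R 1 - b)"
    by (simp add: algebra_simps)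
  then show "norm ((norm a + norm b) *\<^sub>R 1 - (a + b)) \<le> norm a + norm b"
    by (simp only:) (rule norm_triangle_mono; rule pos_imp_norm_le; simp add: assms)
qed (use assms in \<open>simp add: cstar_add pos_selfadjoint\<close>)

lemma pos_commuting_mult:
  assumes "pos a" "pos b" "a * b = b * a" shows "pos (a * b)"
proof -
  define s t where "s = pos_sqrt a" and "t = pos_sqrt b"
  have "s * b = b * s"
    unfolding s_def by (rule pos_sqrt_commute[OF assms(1,3)])
  then have st: "t * s = s * t"
    unfolding t_def using pos_sqrt_commute[OF assms(2), of s] by simp
  have ss: "s * s = a" "t * t = b"
    by (simp_all add: s_def t_def pos_sqrt_mult_self assms)
  have "(s * t) * (s * t) = s * (t * s) * t" by (simp add: mult.assoc)
  also have "\<dots> = (s * s) * (t * t)" unfolding st by (simp add: mult.assoc)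
  finally have "a * b = (s * t) * (s * t)" by (simp add: ss)
  moreover have "cstar (s * t) = s * t"
    by (simp add: cstar_mult st) (simp add: s_def t_def cstar_pos_sqrt assms st[unfolded s_def t_def])
  ultimately show ?thesis unfolding pos_def by blast
qed

lemma pos_mult_self: "cstar h = h \<Longrightarrow> pos (h * h)"
  by (auto simp: pos_def)

lemma pos_limit:
  assumes lim: "X \<longlonglongrightarrow> a" and pos: "\<And>n. pos (X n)"
  shows "pos a"
proof -
  obtain R where R: "\<And>n. norm (X n) \<le> R"
    using convergent_imp_Bseq[OF convergentI[OF lim]] by (metis BseqE)
  show ?thesis
  proof (rule norm_le_imp_pos)
    show "cstar a = a"
      by (rule LIMSEQ_unique[OF tendsto_cstar[OF lim]]) (simp add: pos_selfadjoint[OF pos] lim)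
    show "norm (R *\<^sub>R 1 - a) \<le> R"
      by (rule LIMSEQ_le_const2[where X = "\<lambda>n. norm (R *\<^sub>R 1 - X n)"])
        (auto intro!: tendsto_intros lim pos_imp_norm_le pos R)
  qed
qed

section \<open>The order relation and its link with the norm\<close>

lemma cle_refl [simp]: "a \<preceq> a"
  by (simp add: cle_def)

lemma cle_trans: "a \<preceq> b \<Longrightarrow> b \<preceq> c \<Longrightarrow> a \<preceq> c"
  unfolding cle_def using pos_add[of "b - a" "c - b"] by simp

lemma cle_add_mono: "a \<preceq> b \<Longrightarrow> c \<preceq> d \<Longrightarrow> a + c \<preceq> b + d"
  unfolding cle_def using pos_add[of "b - a" "d - c"] by (simp add: algebra_simps)

lemma cle_scaleR: "a \<preceq> b \<Longrightarrow> 0 \<le> r \<Longrightarrow> r *\<^sub>R a \<preceq> r *\<^sub>R b"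
  unfolding cle_def using pos_scaleR[of "b - a" r] by (simp add: scaleR_diff_right)

lemma zero_cle_iff [simp]: "0 \<preceq> a \<longleftrightarrow> pos a"
  by (simp add: cle_def)

lemma pos_cle_trans: "pos a \<Longrightarrow> a \<preceq> b \<Longrightarrow> pos b"
  using cle_trans[of 0 a b] by simp

lemma cle_norm:
  assumes "cstar a = a" "norm a \<le> R" shows "a \<preceq> R *\<^sub>R 1"
  unfolding cle_def
  by (rule norm_le_imp_pos[where R = R]) (use assms in \<open>simp_all add: cstar_diff\<close>)

text \<open>After scaling to 0 \<le> z \<le> 1, the roots of \<open>z\<close> and
  \<open>1 - z\<close> commute and their squares sum to 1, so the root of \<open>z\<close> has norm
  at most 1.\<close>

lemma norm_le_of_cle:
  assumes y: "pos y" and le: "y \<preceq> R *\<^sub>R 1" and R: "0 \<le> R"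
  shows "norm y \<le> R"
proof (rule field_le_epsilon)
  fix e :: real assume e: "0 < e"
  \<comment> \<open>\<open>R\<close> may be 0, so the scaling divides by the slightly larger
    \<open>R + e\<close>.\<close>
  define S where "S = R + e"
  have S: "S > 0" using R e by (simp add: S_def)
  have "R *\<^sub>R 1 \<preceq> S *\<^sub>R (1::'a)"
    unfolding cle_def using pos_scaleR[OF pos_one, of e] e by (simp add: S_def scaleR_add_left)
  then have le: "y \<preceq> S *\<^sub>R 1" using le cle_trans by blast
  define z where "z = (1/S) *\<^sub>R y"
  have z: "pos z" using y S by (simp add: z_def pos_scaleR)
  have "z \<preceq> (1/S) *\<^sub>R (S *\<^sub>R 1)"
    unfolding z_def by (rule cle_scaleR[OF le]) (use S in simp)
  then have z1: "pos (1 - z)" using S by (simp add: cle_def)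
  define h k where "h = pos_sqrt (1 - z)" and "k = pos_sqrt z"
  have "h * z = z * h"
    unfolding h_def by (rule pos_sqrt_commute[OF z1]) (simp add: algebra_simps)
  then have "h * k = k * h"
    unfolding k_def using pos_sqrt_commute[OF z, of h] by simp
  moreover have "h * h + k * k = 1"
    by (simp add: h_def k_def pos_sqrt_mult_self z z1)
  ultimately have "norm k \<le> 1"
    by (intro norm_le_one_of_sum_squares[of h k]) (auto simp: h_def k_def cstar_pos_sqrt z z1)
  then have "norm (k * k) \<le> 1"
    using norm_mult_ineq[of k k] mult_mono[of "norm k" 1 "norm k" 1] by simp
  then have "norm z \<le> 1" by (simp add: k_def pos_sqrt_mult_self z)
  then show "norm y \<le> R + e" using S by (simp add: z_def S_def)
qed

lemma norm_mono:
  assumes "pos x" "x \<preceq> y" shows "norm x \<le> norm y"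
proof -
  have "pos y" using assms pos_cle_trans by blast
  then have "y \<preceq> norm y *\<^sub>R 1" by (simp add: cle_norm pos_selfadjoint)
  then show ?thesis using assms cle_trans norm_le_of_cle norm_ge_zero by blast
qed

lemma pos_antisym:
  assumes "pos x" "pos (- x)" shows "x = 0"
  using norm_mono[of x 0] assms by (simp add: cle_def)


subsection \<open>Closed unital subalgebras and inverses\<close>

text \<open>Stability under \<open>cstar\<close> is left out on purpose: the left multipliers of a
  C*-subalgebra, to which this is applied, need not have it.\<close>

definition closed_unital_subalgebra :: "'b::{c_star_algebra,real_normed_algebra_1} set \<Rightarrow> bool" where
  "closed_unital_subalgebra S \<longleftrightarrow> closed S \<and> 1 \<in> S \<and> (\<forall>x\<in>S. \<forall>y\<in>S. x + y \<in> S \<and> x * y \<in> S) \<and>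
     (\<forall>r. \<forall>x\<in>S. r *\<^sub>R x \<in> S)"

context
  fixes S :: "'b::{c_star_algebra,real_normed_algebra_1} set"
  assumes S: "closed_unital_subalgebra S"
begin

lemma cus_intros:
  shows "1 \<in> S" "0 \<in> S" "x \<in> S \<Longrightarrow> y \<in> S \<Longrightarrow> x + y \<in> S" "x \<in> S \<Longrightarrow> y \<in> S \<Longrightarrow> x - y \<in> S"
    "x \<in> S \<Longrightarrow> y \<in> S \<Longrightarrow> x * y \<in> S" "x \<in> S \<Longrightarrow> r *\<^sub>R x \<in> S" "x \<in> S \<Longrightarrow> x ^ n \<in> S"
proof -
  have *: "x \<in> S \<Longrightarrow> y \<in> S \<Longrightarrow> x + y \<in> S" "x \<in> S \<Longrightarrow> y \<in> S \<Longrightarrow> x * y \<in> S" "x \<in> S \<Longrightarrow> r *\<^sub>R x \<in> S" "1 \<in> S"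
    for x y r using S by (auto simp: closed_unital_subalgebra_def)
  show "1 \<in> S" "x \<in> S \<Longrightarrow> y \<in> S \<Longrightarrow> x + y \<in> S" "x \<in> S \<Longrightarrow> y \<in> S \<Longrightarrow> x * y \<in> S" "x \<in> S \<Longrightarrow> r *\<^sub>R x \<in> S"
    by (fact *)+
  show "0 \<in> S" using *(3)[of 1 0] *(4) by simp
  show "x \<in> S \<Longrightarrow> y \<in> S \<Longrightarrow> x - y \<in> S" using *(1)[of x "(-1) *\<^sub>R y"] *(3)[of y "-1"] by simp
  show "x \<in> S \<Longrightarrow> x ^ n \<in> S" by (induction n) (auto simp: *)
qed

lemma cus_limit: "X \<longlonglongrightarrow> x \<Longrightarrow> (\<And>n. X n \<in> S) \<Longrightarrow> x \<in> S"
  using S by (auto simp: closed_unital_subalgebra_def intro: closed_sequentially)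

lemma root_defect_in_cus: "norm h \<le> 1 \<Longrightarrow> h \<in> S \<Longrightarrow> root_defect h \<in> S"
  by (rule cus_limit[OF root_iter_tendsto], assumption, induct_tac n) (auto intro: cus_intros)

lemma pos_sqrt_in_cus: "pos a \<Longrightarrow> a \<in> S \<Longrightarrow> pos_sqrt a \<in> S"
  unfolding pos_sqrt_def by (intro cus_intros root_defect_in_cus pos_sqrt_arg_norm)

end

lemma neumann_inverse:
  fixes b :: "'b::{real_normed_algebra_1,banach}"
  assumes "norm b < 1"
  shows "(1 - b) * (\<Sum>n. b ^ n) = 1" "(\<Sum>n. b ^ n) * (1 - b) = 1"
    "(\<lambda>n. \<Sum>i<n. b ^ i) \<longlonglongrightarrow> (\<Sum>n. b ^ n)"
proof -
  have "summable (\<lambda>n. norm b ^ n)" using assms by (simp add: summable_geometric)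
  then have s: "summable (\<lambda>n. b ^ n)"
    by (rule summable_comparison_test'[where N = 0]) (rule norm_power_ineq)
  have "(\<Sum>n. b ^ n) = (\<Sum>n. b ^ Suc n) + 1"
    using suminf_split_head[OF s] by (simp del: power_Suc)
  moreover have "(\<Sum>n. b ^ Suc n) = b * (\<Sum>n. b ^ n)"
    using suminf_mult[OF s, of b] by simp
  moreover have "(\<Sum>n. b ^ Suc n) = (\<Sum>n. b ^ n) * b"
    using suminf_mult2[OF s, of b] by (simp add: power_commutes)
  ultimately show "(1 - b) * (\<Sum>n. b ^ n) = 1" "(\<Sum>n. b ^ n) * (1 - b) = 1"
    by (simp_all add: algebra_simps)
  show "(\<lambda>n. \<Sum>i<n. b ^ i) \<longlonglongrightarrow> (\<Sum>n. b ^ n)"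
    by (rule summable_LIMSEQ[OF s])
qed

text \<open>Write a + \<epsilon> = R (1 - b) with R = norm a + \<epsilon>. Positivity of
  \<open>a\<close> makes the norm of b at most norm a / R < 1, so the Neumann series converges,
  inside every closed unital subalgebra containing \<open>a\<close>.\<close>

lemma pos_shift_inverse:
  fixes a :: "'b::{c_star_algebra,real_normed_algebra_1}"
  assumes a: "pos a" and e: "\<epsilon> > 0"
  obtains w where "w * (a + \<epsilon> *\<^sub>R 1) = 1" "(a + \<epsilon> *\<^sub>R 1) * w = 1" "pos w"
    "\<And>S. closed_unital_subalgebra S \<Longrightarrow> a \<in> S \<Longrightarrow> w \<in> S"
    "\<And>c. a * c = c * a \<Longrightarrow> w * c = c * w"
proof -
  define R where "R = norm a + \<epsilon>"
  have R: "R > 0" using e by (simp add: R_def add_nonneg_pos)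
  define b where "b = (1/R) *\<^sub>R (norm a *\<^sub>R 1 - a)"
  define G where "G = (\<Sum>n. b ^ n)"
  define w where "w = (1/R) *\<^sub>R G"
  have "norm b \<le> norm a / R"
    using pos_imp_norm_le[OF a order_refl] R by (simp add: b_def divide_right_mono)
  also have "\<dots> < 1" using e R by (simp add: R_def)
  finally have b1: "norm b < 1" .
  note neu = neumann_inverse[OF b1, folded G_def]
  have aR: "a + \<epsilon> *\<^sub>R 1 = R *\<^sub>R (1 - b)"
  proof -
    have "R *\<^sub>R b = norm a *\<^sub>R 1 - a" using R by (simp add: b_def)
    then show ?thesis by (simp add: R_def scaleR_diff_right scaleR_add_left)
  qed
  have w1: "w * (a + \<epsilon> *\<^sub>R 1) = 1" and w2: "(a + \<epsilon> *\<^sub>R 1) * w = 1"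
    unfolding aR w_def using neu(1,2) R by simp_all
  have comm: "w * c = c * w" if "a * c = c * a" for c
  proof -
    have "w * c = w * c * ((a + \<epsilon> *\<^sub>R 1) * w)" by (simp add: w2)
    also have "\<dots> = w * (c * (a + \<epsilon> *\<^sub>R 1)) * w" by (simp add: mult.assoc)
    also have "c * (a + \<epsilon> *\<^sub>R 1) = (a + \<epsilon> *\<^sub>R 1) * c" using that by (simp add: algebra_simps)
    also have "w * ((a + \<epsilon> *\<^sub>R 1) * c) * w = c * w" by (simp add: w1 flip: mult.assoc)
    finally show ?thesis .
  qed
  have sa: "cstar w = w"
  proof -
    have "cstar (w * (a + \<epsilon> *\<^sub>R 1)) = 1" by (simp add: w1)
    then have "(a + \<epsilon> *\<^sub>R 1) * cstar w = 1"
      by (simp add: cstar_mult cstar_add pos_selfadjoint[OF a])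
    then have "w * (a + \<epsilon> *\<^sub>R 1) * cstar w = w" by (simp add: mult.assoc)
    then show ?thesis by (simp add: w1)
  qed
  \<comment> \<open>\<open>w\<close> equals w^2 (a + \<epsilon>), a product of commuting positive
    elements.\<close>
  have "pos (a + \<epsilon> *\<^sub>R 1)" using a e by (simp add: pos_add pos_scaleR)
  moreover have "w * w * a = a * (w * w)"
    using comm[of a] by (metis mult.assoc)
  ultimately have "pos ((w * w) * (a + \<epsilon> *\<^sub>R 1))"
    by (intro pos_commuting_mult[OF pos_mult_self[OF sa]]) (simp_all add: distrib_left distrib_right)
  then have "pos w" using w1 by (simp add: mult.assoc)
  moreover have "w \<in> S" if S: "closed_unital_subalgebra S" "a \<in> S" for S
  proof -
    note cus = cus_intros[OF S(1)]
    have "b \<in> S" unfolding b_def by (intro cus S)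
    then have "(\<Sum>i<n. b ^ i) \<in> S" for n
      by (induction n) (auto intro: cus)
    then have "G \<in> S" by (rule cus_limit[OF S(1) neu(3)])
    then show ?thesis unfolding w_def by (intro cus)
  qed
  ultimately show ?thesis using that w1 w2 comm by blast
qed


subsection \<open>Positive and negative parts\<close>

text \<open>Both \<open>1 - a\<close> and \<open>1 + a\<close> are fixed points of the iteration for \<open>1 - a\<^sup>2\<close>, and they
  dominate its limit \<open>1 - \<bar>a\<bar>\<close>.\<close>

lemma root_iter_le_fixed_point:
  assumes sa: "cstar a = a" and n: "norm a \<le> 1"
  shows "pos (root_iter (1 - a * a) n) \<and> pos (1 - a - root_iter (1 - a * a) n)"
proof (induction n)
  case 0
  show ?case using cle_norm[OF sa n] by (simp add: cle_def)
next
  case (Suc n)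
  let ?y = "root_iter (1 - a * a)"
  have b: "pos (1 - a * a)"
    using cle_norm[of "a * a" 1] norm_selfadjoint_mult[OF sa] n sa
    by (simp add: cle_def cstar_mult power_le_one)
  have comm: "?y n * a = a * ?y n"
    by (rule root_iter_intertwine) (simp add: algebra_simps)
  have "pos (?y (Suc n))"
    using Suc b by (simp add: pos_scaleR pos_add pos_mult_self pos_selfadjoint)
  moreover have "pos (1 - a)" using cle_norm[OF sa n] by (simp add: cle_def)
  then have "pos (1 - a + ?y n)" using Suc by (simp add: pos_add)
  then have "pos ((1 - a - ?y n) * (1 - a + ?y n))"
    using Suc by (intro pos_commuting_mult) (auto simp: algebra_simps comm)
  then have "pos ((1/2) *\<^sub>R ((1 - a - ?y n) * (1 - a + ?y n)))" by (rule pos_scaleR) simp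
  moreover have "(1/2) *\<^sub>R ((1 - a - ?y n) * (1 - a + ?y n)) = 1 - a - ?y (Suc n)"
  proof -
    have "(1 - a - ?y n) * (1 - a + ?y n) = 2 *\<^sub>R (1 - a) - (1 - a * a + ?y n * ?y n)"
      by (simp add: algebra_simps comm scaleR_2)
    then show ?thesis by (simp add: scaleR_diff_right)
  qed
  ultimately show ?case by simp
qed

text \<open>With |a| = 1 - r the parts are (|a| + a) / 2 and (|a| - a) / 2, and their product is
  (|a|^2 - a^2) / 4 = 0.\<close>

lemma pos_neg_parts_unit_ball:
  fixes a :: "'b::{c_star_algebra,real_normed_algebra_1}"
  assumes sa: "cstar a = a" and n: "norm a \<le> 1"
  obtains p q where "pos p" "pos q" "a = p - q" "p * q = 0"
    "\<And>S. closed_unital_subalgebra S \<Longrightarrow> a \<in> S \<Longrightarrow> p \<in> S \<and> q \<in> S"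
proof -
  define b where "b = 1 - a * a"
  have nb: "norm b \<le> 1" unfolding b_def by (rule norm_one_minus_square[OF sa n])
  define r where "r = root_defect b"
  define p q where "p = (1/2) *\<^sub>R (1 + a - r)" and "q = (1/2) *\<^sub>R (1 - a - r)"
  have lim: "root_iter b \<longlonglongrightarrow> r" unfolding r_def by (rule root_iter_tendsto[OF nb])
  have "pos (1 - a - r)"
    by (rule pos_limit[of "\<lambda>n. 1 - a - root_iter b n"])
      (use root_iter_le_fixed_point[OF sa n] in \<open>auto intro!: tendsto_intros lim simp flip: b_def\<close>)
  then have q: "pos q" unfolding q_def by (rule pos_scaleR) simp
  have "pos (1 + a - r)"
    by (rule pos_limit[of "\<lambda>n. 1 + a - root_iter b n"])
      (use root_iter_le_fixed_point[of "- a"] sa n in \<open>auto intro!: tendsto_intros lim simp flip: b_def\<close>)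
  then have p: "pos p" unfolding p_def by (rule pos_scaleR) simp
  have apq: "a = p - q" by (simp add: p_def q_def flip: scaleR_diff_right scaleR_2)
  have comm: "r * a = a * r"
    unfolding r_def by (rule root_defect_intertwine[OF nb nb]) (simp add: b_def algebra_simps)
  have "(1 + a - r) * (1 - a - r) = (1 - r) * (1 - r) - a * a"
    by (simp add: algebra_simps comm)
  then have "p * q = 0"
    by (simp add: p_def q_def r_def root_defect_eq[OF nb]) (simp add: b_def)
  moreover have "p \<in> S \<and> q \<in> S" if S: "closed_unital_subalgebra S" "a \<in> S" for S
  proof -
    note cus = cus_intros[OF S(1)]
    have "r \<in> S" unfolding r_def b_def by (intro root_defect_in_cus[OF S(1)] nb[unfolded b_def] cus S)
    then show ?thesis by (auto simp: p_def q_def intro!: cus S)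
  qed
  ultimately show ?thesis using that p q apq by blast
qed

text \<open>The norm bounds come from p^2 \<le> p^2 + q^2 = a^2 and monotonicity of the norm. The
  \<open>max 1\<close> in the scaling covers \<open>a = 0\<close>.\<close>

lemma pos_neg_parts:
  fixes a :: "'b::{c_star_algebra,real_normed_algebra_1}"
  assumes sa: "cstar a = a"
  obtains p q where "pos p" "pos q" "a = p - q" "p * q = 0" "q * p = 0" "a * a = p * p + q * q"
    "norm p \<le> norm a" "norm q \<le> norm a"
    "\<And>S. closed_unital_subalgebra S \<Longrightarrow> a \<in> S \<Longrightarrow> p \<in> S \<and> q \<in> S"
proof -
  define R where "R = max 1 (norm a)"
  have R: "R > 0" "norm a \<le> R" by (auto simp: R_def)
  have "cstar ((1/R) *\<^sub>R a) = (1/R) *\<^sub>R a" "norm ((1/R) *\<^sub>R a) \<le> 1"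
    using sa R by auto
  then obtain p' q' where *: "pos p'" "pos q'" "(1/R) *\<^sub>R a = p' - q'" "p' * q' = 0"
    "\<And>S. closed_unital_subalgebra S \<Longrightarrow> (1/R) *\<^sub>R a \<in> S \<Longrightarrow> p' \<in> S \<and> q' \<in> S"
    using pos_neg_parts_unit_ball by metis
  define p q where "p = R *\<^sub>R p'" and "q = R *\<^sub>R q'"
  have p: "pos p" and q: "pos q" using * R by (simp_all add: p_def q_def pos_scaleR)
  have "R *\<^sub>R ((1/R) *\<^sub>R a) = p - q" by (simp only: *(3) p_def q_def scaleR_diff_right)
  then have apq: "a = p - q" using R by simp
  have pq: "p * q = 0" by (simp add: p_def q_def *)
  have "cstar (p * q) = 0" by (simp add: pq)
  then have qp: "q * p = 0" by (simp add: cstar_mult pos_selfadjoint p q)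
  have sq: "a * a = p * p + q * q" by (simp add: apq algebra_simps pq qp)
  have pos2: "pos (p * p)" "pos (q * q)" by (simp_all add: pos_mult_self pos_selfadjoint p q)
  have le: "norm z \<le> norm a" if "pos z" "z * z \<preceq> a * a" for z
  proof -
    have "norm (z * z) \<le> norm (a * a)"
      by (rule norm_mono[OF _ that(2)]) (simp add: pos_mult_self pos_selfadjoint that)
    then have "(norm z)\<^sup>2 \<le> (norm a)\<^sup>2"
      by (simp add: norm_selfadjoint_mult pos_selfadjoint that sa)
    then show ?thesis by (rule power2_le_imp_le) simp
  qed
  have "norm p \<le> norm a" "norm q \<le> norm a"
    by (rule le, use p q pos2 sq in \<open>simp_all add: cle_def\<close>)+
  moreover have "p \<in> S \<and> q \<in> S" if "closed_unital_subalgebra S" "a \<in> S" for S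
    using *(5)[OF that(1)] cus_intros[OF that(1)] that(2) by (simp add: p_def q_def)
  ultimately show ?thesis using that p q apq pq qp sq by blast
qed


subsection \<open>Positivity of \<open>x\<^sup>* x\<close>\<close>

text \<open>Write \<open>d = - c\<^sup>* c\<close>. Then \<open>c c\<^sup>*\<close> is positive, so \<open>\<parallel>d\<parallel> + c c\<^sup>*\<close> is invertible, and hence so is
  \<open>\<parallel>d\<parallel> - d\<close>, which is impossible for a positive \<open>d \<noteq> 0\<close>.\<close>

lemma cstar_mult_self_negative:
  fixes c :: "'b::{c_star_algebra,real_normed_algebra_1}"
  assumes d: "pos (- (cstar c * c))"
  shows "c = 0"
proof (rule ccontr)
  assume c: "c \<noteq> 0"
  define d e where "d = - (cstar c * c)" and "e = c * cstar c"
  define t where "t = norm d"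
  have t: "t > 0" using c by (simp add: t_def d_def norm_cstar_mult_self)
  define h k where "h = re_part c" and "k = im_part c"
  have hk: "cstar h = h" "cstar k = k" "c = h + \<i> *\<^sub>C k"
    by (simp_all add: h_def k_def re_im_decomp[symmetric])
  have "cstar c = h - \<i> *\<^sub>C k"
    unfolding hk(3) by (simp add: cstar_add cstar_scaleC hk(1,2) scaleC_minus_left)
  \<comment> \<open>\<open>cstar c * c + c * cstar c\<close> is twice h^2 + k^2, even if
    \<open>h\<close> and \<open>k\<close> do not commute.\<close>
  then have "e = 2 *\<^sub>R (h * h) + 2 *\<^sub>R (k * k) + d"
    unfolding e_def d_def by (simp add: hk(3)) (simp add: algebra_simps mult_scaleC_left
      mult_scaleC_right scaleC_scaleC scaleC_add_right scaleC_diff_right scaleC_minus_one scaleR_2)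
  moreover have "pos (2 *\<^sub>R (h * h) + 2 *\<^sub>R (k * k) + d)"
    using d by (intro pos_add pos_scaleR pos_mult_self hk(1,2)) (simp_all add: d_def)
  ultimately have e: "pos e" by simp
  obtain w where w: "w * (e + t *\<^sub>R 1) = 1" "(e + t *\<^sub>R 1) * w = 1" "pos w"
    using pos_shift_inverse[OF e t] by metis
  \<comment> \<open>Up to the factor t this inverts t - d = t + \<open>cstar c * c\<close>: the
    inverse of 1 + x y is 1 - x (1 + y x)^-1 y.\<close>
  define v where "v = 1 - cstar c * w * c"
  have sv: "cstar v = v"
    by (simp add: v_def cstar_diff cstar_mult cstar_cstar pos_selfadjoint[OF w(3)] mult.assoc)
  have sd: "cstar d = d" by (simp add: d_def cstar_mult cstar_cstar)
  have "(t *\<^sub>R 1 - d) * v = t *\<^sub>R 1 + cstar c * c - cstar c * ((e + t *\<^sub>R 1) * w) * c"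
    by (simp add: v_def d_def e_def algebra_simps)
  then have kv: "(t *\<^sub>R 1 - d) * v = t *\<^sub>R 1" by (simp add: w(2))
  have "cstar ((t *\<^sub>R 1 - d) * v) = t *\<^sub>R 1" by (simp only: kv) simp
  then have vk: "v * (t *\<^sub>R 1 - d) = t *\<^sub>R 1"
    by (simp add: cstar_mult cstar_diff sv sd)
  have vd: "v * d = d * v" using kv vk by (simp add: algebra_simps)
  have k: "pos (t *\<^sub>R 1 - d)"
    using cle_norm[OF sd, of t] by (simp add: cle_def t_def)
  have "v * v * d = d * (v * v)" using vd by (metis mult.assoc)
  then have "pos (v * v * (t *\<^sub>R 1 - d))"
    by (intro pos_commuting_mult[OF pos_mult_self[OF sv] k]) (simp add: algebra_simps)
  then have "pos (t *\<^sub>R v)" by (simp add: mult.assoc vk)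
  then have "pos ((1/t) *\<^sub>R (t *\<^sub>R v))" by (rule pos_scaleR) (use t in simp)
  then have v: "pos v" using t by simp
  have nv: "norm v > 0" using kv t by (auto intro: ccontr)
  \<comment> \<open>The product is \<open>norm v\<close> (t - d) - t. Its positivity pushes d below
    t - t / \<open>norm v\<close>, strictly less than t = \<open>norm d\<close>.\<close>
  have "pos ((t *\<^sub>R 1 - d) * (norm v *\<^sub>R 1 - v))"
    using cle_norm[OF sv order_refl]
    by (intro pos_commuting_mult[OF k]) (auto simp: cle_def algebra_simps vd)
  then have "pos (norm v *\<^sub>R (t *\<^sub>R 1 - d) - t *\<^sub>R 1)"
    by (simp add: right_diff_distrib kv)
  then have "pos ((1 / norm v) *\<^sub>R (norm v *\<^sub>R (t *\<^sub>R 1 - d) - t *\<^sub>R 1))"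
    by (rule pos_scaleR) simp
  then have "d \<preceq> (t - t / norm v) *\<^sub>R 1"
    using nv by (simp add: cle_def scaleR_diff_right scaleR_diff_left algebra_simps)
  moreover have "norm v \<ge> 1"
  proof -
    have "t = norm ((t *\<^sub>R 1 - d) * v)" using t by (simp add: kv)
    also have "\<dots> \<le> norm (t *\<^sub>R 1 - d) * norm v" by (rule norm_mult_ineq)
    also have "\<dots> \<le> t * norm v"
      using pos_imp_norm_le[of d t] d by (intro mult_right_mono) (simp_all add: t_def d_def)
    finally show ?thesis using t by simp
  qed
  then have "t / norm v \<le> t" using t nv divide_left_mono[of 1 "norm v" t] by simp
  ultimately have "norm d \<le> t - t / norm v"
    using d by (intro norm_le_of_cle) (simp_all add: d_def[symmetric])
  then show False using divide_pos_pos[OF t nv] by (simp add: t_def)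
qed

text \<open>If q is the negative part, c = x q satisfies \<open>cstar c * c\<close> = -q^3, so
  \<open>cstar_mult_self_negative\<close> gives c = 0. Then q^3 = 0, which forces q = 0.\<close>

theorem pos_cstar_mult_self: "pos (cstar x * x)"
proof -
  have "cstar (cstar x * x) = cstar x * x" by (simp add: cstar_mult cstar_cstar)
  then obtain p q where pq: "pos p" "pos q" "cstar x * x = p - q" "p * q = 0" "q * p = 0"
    using pos_neg_parts by metis
  have sq: "cstar q = q" using pq by (simp add: pos_selfadjoint)
  have "cstar (x * q) * (x * q) = q * (p - q) * q"
    by (simp add: cstar_mult sq mult.assoc flip: pq(3))
  also have "\<dots> = - (q * q * q)" by (simp add: algebra_simps pq)
  finally have eq: "- (cstar (x * q) * (x * q)) = q * q * q" by simp
  have "pos (q * q * q)"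
    by (intro pos_commuting_mult pos_mult_self sq pq) (simp add: mult.assoc)
  then have "x * q = 0" using cstar_mult_self_negative[of "x * q"] eq by simp
  then have "q * q * q = 0" using eq by simp
  then have "norm ((q * q) * (q * q)) = 0" by (simp add: mult.assoc)
  then have "q = 0" using norm_selfadjoint_mult[of "q * q"] norm_selfadjoint_mult[OF sq]
    by (simp add: cstar_mult sq)
  then show ?thesis using pq by simp
qed

lemma pos_mult_cstar_self: "pos (x * cstar x)"
  using pos_cstar_mult_self[of "cstar x"] by (simp add: cstar_cstar)

lemma pos_conj: assumes "pos a" shows "pos (cstar c * a * c)"
proof -
  have "cstar (pos_sqrt a * c) * (pos_sqrt a * c) = cstar c * (pos_sqrt a * pos_sqrt a) * c"
    by (simp add: cstar_mult cstar_pos_sqrt assms mult.assoc)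
  then show ?thesis
    using pos_cstar_mult_self[of "pos_sqrt a * c"] by (simp add: pos_sqrt_mult_self assms)
qed

lemma cle_conj: "a \<preceq> b \<Longrightarrow> cstar c * a * c \<preceq> cstar c * b * c"
  unfolding cle_def using pos_conj[of "b - a" c] by (simp add: algebra_simps)

lemma cstar_mult_add_le: "cstar (x + y) * (x + y) \<preceq> 2 *\<^sub>R (cstar x * x + cstar y * y)"
  unfolding cle_def using pos_cstar_mult_self[of "x - y"]
  by (simp add: cstar_add cstar_diff algebra_simps scaleR_2)

lemma cstar_mult_left_le: "cstar (c * x) * (c * x) \<preceq> (norm c)\<^sup>2 *\<^sub>R (cstar x * x)"
proof -
  have "cstar c * c \<preceq> (norm c)\<^sup>2 *\<^sub>R 1"
    by (rule cle_norm) (simp_all add: cstar_mult cstar_cstar norm_cstar_mult_self)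
  from cle_conj[OF this, of x] show ?thesis
    by (simp add: cstar_mult mult.assoc)
qed


subsection \<open>Approximate units\<close>

text \<open>\<open>w\<close> is the inverse square root of a + \<epsilon>. Expanding w^2 (a +
  \<epsilon>) = 1 writes the defect 1 - w a w as \<epsilon> w^2, the form in which later errors are
  estimated.\<close>

lemma pos_inverse_sqrt:
  fixes a :: "'b::{c_star_algebra,real_normed_algebra_1}"
  assumes a: "pos a" and e: "\<epsilon> > 0"
  obtains w where "pos w" "w * a = a * w" "\<epsilon> *\<^sub>R (w * w) = 1 - w * a * w" "w * a * w \<preceq> 1"
proof -
  obtain v where v: "v * (a + \<epsilon> *\<^sub>R 1) = 1" "pos v" "v * a = a * v"
    using pos_shift_inverse[OF a e] by metis
  define w where "w = pos_sqrt v"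
  have w: "pos w" "w * w = v" by (simp_all add: w_def pos_pos_sqrt pos_sqrt_mult_self v)
  have wa: "w * a = a * w" unfolding w_def by (rule pos_sqrt_commute) (use v in auto)
  have "w * a * w = v * a" by (simp add: wa w(2) v(3) mult.assoc)
  moreover have "v * a + \<epsilon> *\<^sub>R v = 1" using v(1) by (simp add: algebra_simps)
  ultimately have eq: "\<epsilon> *\<^sub>R (w * w) = 1 - w * a * w" by (simp add: w(2) algebra_simps)
  moreover have "pos (\<epsilon> *\<^sub>R (w * w))" using e v by (simp add: w(2) pos_scaleR)
  ultimately show ?thesis using that w(1) wa by (simp add: cle_def)
qed

text \<open>For v = (x + \<epsilon>)^-1 the error c - c v x is \<epsilon> c v, whose squared norm is
  at most \<epsilon>^2 K times the norm of v x v. Since v x v \<le> v \<le> 1/\<epsilon>, this is at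
  most K \<epsilon>.\<close>

lemma dominated_approx:
  fixes c x :: "'b::{c_star_algebra,real_normed_algebra_1}"
  assumes x: "pos x" and le: "cstar c * c \<preceq> K *\<^sub>R x" and K: "K \<ge> 0" and e: "\<epsilon> > 0"
  obtains v where "pos v" "v * x = x * v" "(norm (c - c * v * x))\<^sup>2 \<le> K * \<epsilon>"
    "\<And>S. closed_unital_subalgebra S \<Longrightarrow> x \<in> S \<Longrightarrow> v \<in> S"
proof -
  obtain v where v: "v * (x + \<epsilon> *\<^sub>R 1) = 1" "pos v" "v * x = x * v"
    "\<And>S. closed_unital_subalgebra S \<Longrightarrow> x \<in> S \<Longrightarrow> v \<in> S"
    using pos_shift_inverse[OF x e] by metis
  have sv: "cstar v = v" by (rule pos_selfadjoint[OF v(2)])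
  have one: "v * x + \<epsilon> *\<^sub>R v = 1" using v(1) by (simp add: algebra_simps)
  have "c * 1 - c * v * x = \<epsilon> *\<^sub>R (c * v)"
    unfolding one[symmetric] by (simp add: algebra_simps)
  then have "(norm (c - c * v * x))\<^sup>2 = \<epsilon>\<^sup>2 * norm (v * (cstar c * c) * v)"
    using e norm_cstar_mult_self[of "c * v"] by (simp add: cstar_mult sv mult.assoc power_mult_distrib)
  also have "norm (v * (cstar c * c) * v) \<le> norm (K *\<^sub>R (v * x * v))"
    using cle_conj[OF le, of v] pos_conj[OF pos_cstar_mult_self, of v c]
    by (intro norm_mono) (simp_all add: sv)
  also have "\<dots> = K * norm (v * x * v)" using K by simp
  also have "norm (v * x * v) \<le> norm v"
  proof (rule norm_mono)
    show "pos (v * x * v)" using pos_conj[OF x, of v] by (simp add: sv)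
    have "v * (v * x + \<epsilon> *\<^sub>R v) = v" by (simp add: one)
    moreover have "v * (v * x) = v * x * v" by (metis v(3) mult.assoc)
    ultimately have "v * x * v + \<epsilon> *\<^sub>R (v * v) = v" by (simp add: distrib_left)
    then have "v - v * x * v = \<epsilon> *\<^sub>R (v * v)" by (metis add_diff_cancel_left')
    then show "v * x * v \<preceq> v"
      using e pos_mult_self[OF sv] by (simp add: cle_def pos_scaleR)
  qed
  also have "norm v \<le> 1 / \<epsilon>"
  proof (rule norm_le_of_cle[OF v(2)])
    have "pos (v * x)" by (rule pos_commuting_mult) (use v x in auto)
    moreover have "(1/\<epsilon>) *\<^sub>R (v * x) = (1/\<epsilon>) *\<^sub>R 1 - v"
      unfolding one[symmetric] using e by (simp add: algebra_simps)
    ultimately show "v \<preceq> (1/\<epsilon>) *\<^sub>R 1"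
      using pos_scaleR[of "v * x" "1/\<epsilon>"] e by (simp add: cle_def)
  qed (use e in simp)
  finally have "(norm (c - c * v * x))\<^sup>2 \<le> \<epsilon>\<^sup>2 * (K * (1 / \<epsilon>))"
    using e K by (simp add: mult_left_mono)
  also have "\<dots> = K * \<epsilon>" using e by (simp add: power2_eq_square)
  finally show ?thesis using that v by blast
qed

text \<open>The approximants (c v) x have c v in \<open>S\<close> and x in \<open>D\<close>, so
  their limit lies in the closed set \<open>D\<close>. In this way elements built with the help of
  the unit are shown to lie in ideals and subalgebras that do not contain it.\<close>

lemma dominated_mem:
  fixes c x :: "'b::{c_star_algebra,real_normed_algebra_1}"
  assumes x: "pos x" "x \<in> D" and le: "cstar c * c \<preceq> K *\<^sub>R x" and K: "K \<ge> 0"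
    and D: "closed D" and S: "closed_unital_subalgebra S" "x \<in> S" "c \<in> S"
    and SD: "\<And>z d. z \<in> S \<Longrightarrow> d \<in> D \<Longrightarrow> z * d \<in> D"
  shows "c \<in> D"
proof -
  have "\<exists>y\<in>D. dist y c < e" if e: "e > 0" for e
  proof -
    \<comment> \<open>The summand 1 covers \<open>K = 0\<close>; with \<epsilon> = e^2 / (2 L) the
      squared error K \<epsilon> is at most e^2 / 2.\<close>
    define L where "L = K + 1"
    have L: "L > 0" using K by (simp add: L_def)
    define \<epsilon> where "\<epsilon> = e\<^sup>2 / L / 2"
    have \<epsilon>: "\<epsilon> > 0" using e L by (simp add: \<epsilon>_def)
    obtain v where v: "(norm (c - c * v * x))\<^sup>2 \<le> K * \<epsilon>" "v \<in> S"
      using dominated_approx[OF x(1) le K \<epsilon>] S by metis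
    have "K * \<epsilon> \<le> L * \<epsilon>" using \<epsilon> by (simp add: L_def algebra_simps)
    also have "\<dots> = e\<^sup>2 / 2" using L by (simp add: \<epsilon>_def)
    also have "\<dots> < e\<^sup>2" using e by simp
    finally have "norm (c - c * v * x) < e"
      using v(1) e by (intro power2_less_imp_less[of _ e]) auto
    moreover have "c * v * x \<in> D" by (intro SD cus_intros[OF S(1)] S v x)
    ultimately show ?thesis by (auto simp: dist_norm norm_minus_commute)
  qed
  then have "c \<in> closure D" by (simp add: closure_approachable)
  then show ?thesis using D by (simp add: closure_closed)
qed


section \<open>The minimal dense ideal of a closed ideal\<close>

text \<open>Closure under scalars comes from the unit: a scalar multiple is a product with
  \<open>c *\<^sub>C 1\<close>.\<close>

definition ideal_of :: "'b::real_normed_algebra_1 set \<Rightarrow> bool" where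
  "ideal_of I \<longleftrightarrow> 0 \<in> I \<and> (\<forall>x\<in>I. \<forall>y\<in>I. x + y \<in> I) \<and> (\<forall>b. \<forall>x\<in>I. b * x \<in> I \<and> x * b \<in> I)"

lemma ideal_ofD:
  assumes "ideal_of I"
  shows "0 \<in> I" "x \<in> I \<Longrightarrow> y \<in> I \<Longrightarrow> x + y \<in> I" "x \<in> I \<Longrightarrow> b * x \<in> I" "x \<in> I \<Longrightarrow> x * b \<in> I"
  using assms by (auto simp: ideal_of_def)

lemma ideal_of_scaleC:
  fixes I :: "'b::{c_star_algebra,real_normed_algebra_1} set"
  shows "ideal_of I \<Longrightarrow> x \<in> I \<Longrightarrow> c *\<^sub>C x \<in> I"
  using ideal_ofD(3)[of I x "c *\<^sub>C 1"] by (simp add: mult_scaleC_left)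

lemma ideal_of_scaleR:
  fixes I :: "'b::{c_star_algebra,real_normed_algebra_1} set"
  shows "ideal_of I \<Longrightarrow> x \<in> I \<Longrightarrow> r *\<^sub>R x \<in> I"
  by (simp add: scaleR_scaleC ideal_of_scaleC)

lemma ideal_of_diff:
  fixes I :: "'b::{c_star_algebra,real_normed_algebra_1} set"
  shows "ideal_of I \<Longrightarrow> x \<in> I \<Longrightarrow> y \<in> I \<Longrightarrow> x - y \<in> I"
  using ideal_ofD(2)[of I x "(-1) *\<^sub>R y"] ideal_of_scaleR[of I y "-1"] by simp

lemma closed_unital_subalgebra_UNIV: "closed_unital_subalgebra UNIV"
  by (simp add: closed_unital_subalgebra_def)

text \<open>The left unit must lie in \<open>J\<close>; in the ambient algebra 1 would serve for
  every element. These elements take the place of the f(a), with f vanishing near 0, of the usual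
  construction.\<close>

definition left_unital :: "'b::real_normed_algebra_1 set \<Rightarrow> 'b set" where
  "left_unital J = {h \<in> J. \<exists>g\<in>J. g * h = h}"

text \<open>Finite sums of products, built one summand at a time to allow induction. They also form
  a right ideal because \<open>h * b\<close> keeps the left unit of \<open>h\<close>.\<close>

inductive_set ped_ideal :: "'b::real_normed_algebra_1 set \<Rightarrow> 'b set" for J where
  ped_zero: "0 \<in> ped_ideal J"
| ped_step: "a \<in> ped_ideal J \<Longrightarrow> h \<in> left_unital J \<Longrightarrow> c * h + a \<in> ped_ideal J"

definition right_closure :: "'b::real_normed_algebra_1 \<Rightarrow> 'b set" where
  "right_closure q = closure (range ((*) q))"

definition hereditary :: "'b::{c_star_algebra,real_normed_algebra_1} set \<Rightarrow> bool" where
  "hereditary D \<longleftrightarrow> c_star_subalgebra D \<and> (\<forall>x\<in>D. \<forall>y. pos y \<and> y \<preceq> x \<longrightarrow> y \<in> D)"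

text \<open>For positive \<open>q\<close> this is the closure of all q b q, the hereditary
  subalgebra generated by \<open>q\<close>. In this form membership splits into two one-sided
  conditions, each of which domination by \<open>q\<close> can check.\<close>

definition corner :: "'b::{c_star_algebra,real_normed_algebra_1} \<Rightarrow> 'b set" where
  "corner q = {x. x \<in> right_closure q \<and> cstar x \<in> right_closure q}"

section \<open>Closed right ideals and hereditary corners\<close>

lemma right_closure_intros:
  fixes q :: "'b::{c_star_algebra,real_normed_algebra_1}"
  shows "q \<in> right_closure q" "closed (right_closure q)"
    "x \<in> right_closure q \<Longrightarrow> y \<in> right_closure q \<Longrightarrow> x + y \<in> right_closure q"
    "x \<in> right_closure q \<Longrightarrow> x * b \<in> right_closure q"
    "x \<in> right_closure q \<Longrightarrow> c *\<^sub>C x \<in> right_closure q"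
proof -
  show "q \<in> right_closure q"
    unfolding right_closure_def using subsetD[OF closure_subset rangeI[of "(*) q" 1]] by simp
  show "closed (right_closure q)" by (simp add: right_closure_def)
  show "x + y \<in> right_closure q" if xy: "x \<in> right_closure q" "y \<in> right_closure q"
  proof -
    obtain X where X: "\<And>n. X n \<in> range ((*) q)" "X \<longlonglongrightarrow> x"
      using xy(1) unfolding right_closure_def closure_sequential by blast
    obtain Y where Y: "\<And>n. Y n \<in> range ((*) q)" "Y \<longlonglongrightarrow> y"
      using xy(2) unfolding right_closure_def closure_sequential by blast
    have "X n + Y n \<in> range ((*) q)" for n
    proof -
      obtain b c where "X n = q * b" "Y n = q * c" using X(1) Y(1) by (metis imageE)
      then have "X n + Y n = q * (b + c)" by (simp add: distrib_left)
      then show ?thesis by simp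
    qed
    then show ?thesis
      unfolding right_closure_def closure_sequential
      by (intro exI[of _ "\<lambda>n. X n + Y n"] conjI allI tendsto_add[OF X(2) Y(2)])
  qed
  show mult: "x * b \<in> right_closure q" if "x \<in> right_closure q" for x b
  proof -
    have "(\<lambda>x. x * b) ` closure (range ((*) q)) \<subseteq> closure (range ((*) q))"
    proof (rule image_closure_subset)
      show "(\<lambda>x. x * b) ` range ((*) q) \<subseteq> closure (range ((*) q))"
        by (rule order_trans[OF _ closure_subset]) (auto simp: mult.assoc intro: rangeI)
    qed (simp_all add: continuous_on_mult_right)
    then show ?thesis using that by (auto simp: right_closure_def)
  qed
  show "x \<in> right_closure q \<Longrightarrow> c *\<^sub>C x \<in> right_closure q"
    using mult[of x "c *\<^sub>C 1"] by (simp add: mult_scaleC_right)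
qed

text \<open>The elements whose adjoint lies in the closed right ideal form a closed left ideal
  containing \<open>x\<close>, so \<open>dominated_mem\<close> applies with all elements as
  multipliers.\<close>

lemma left_dominated:
  fixes c x :: "'b::{c_star_algebra,real_normed_algebra_1}"
  assumes x: "pos x" "x \<in> right_closure q" and le: "cstar c * c \<preceq> K *\<^sub>R x" "K \<ge> 0"
  shows "cstar c \<in> right_closure q"
proof -
  have "c \<in> cstar -` right_closure q"
  proof (rule dominated_mem[OF x(1) _ le _ closed_unital_subalgebra_UNIV])
    show "closed (cstar -` right_closure q)"
      by (intro continuous_closed_vimage right_closure_intros)
        (simp add: linear_continuous_at bounded_linear_cstar)
  qed (use x in \<open>auto simp: pos_selfadjoint cstar_mult intro: right_closure_intros\<close>)
  then show ?thesis by simp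
qed

lemma hereditary_corner: "hereditary (corner q)"
proof -
  note rc = right_closure_intros
  have cl: "closed (corner q)"
  proof -
    have "corner q = right_closure q \<inter> cstar -` right_closure q" by (auto simp: corner_def)
    moreover have "closed (cstar -` right_closure q)"
      by (intro continuous_closed_vimage rc) (simp add: linear_continuous_at bounded_linear_cstar)
    ultimately show ?thesis by (simp add: closed_Int rc)
  qed
  have "0 \<in> right_closure q" using rc(4)[OF rc(1), of _ 0] by simp
  then have "c_star_subalgebra (corner q)"
    unfolding c_star_subalgebra_def csubspace_def using cl
    by (auto simp: corner_def cstar_add cstar_scaleC cstar_mult cstar_cstar intro: rc)
  moreover have "y \<in> corner q" if x: "x \<in> corner q" and y: "pos y" "y \<preceq> x" for x y
  proof -
    \<comment> \<open>The square of the root is \<open>y\<close> and is dominated by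
      \<open>x\<close>; afterwards \<open>y\<close> is a right multiple of its root.\<close>
    have "cstar (pos_sqrt y) \<in> right_closure q"
      by (rule left_dominated[of x _ _ 1])
        (use x y in \<open>auto simp: corner_def cstar_pos_sqrt pos_sqrt_mult_self intro: pos_cle_trans\<close>)
    then have "y \<in> right_closure q"
      using rc(4)[of "pos_sqrt y" q "pos_sqrt y"] by (simp add: cstar_pos_sqrt pos_sqrt_mult_self y)
    then show ?thesis by (simp add: corner_def pos_selfadjoint y)
  qed
  ultimately show ?thesis unfolding hereditary_def by blast
qed

lemma csubspace_scaleR: "csubspace D \<Longrightarrow> x \<in> D \<Longrightarrow> r *\<^sub>R x \<in> D"
  by (simp add: csubspace_def scaleR_scaleC)

lemma csubspace_diff: "csubspace D \<Longrightarrow> x \<in> D \<Longrightarrow> y \<in> D \<Longrightarrow> x - y \<in> D"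
  using csubspace_scaleR[of D y "-1"] unfolding csubspace_def
  by (metis scaleR_minus1_left uminus_add_conv_diff add.commute)

lemma csubspace_re_im:
  assumes "csubspace D" "x \<in> D" "cstar x \<in> D" shows "re_part x \<in> D" "im_part x \<in> D"
  using assms csubspace_scaleR[OF assms(1)] csubspace_diff[OF assms(1)]
  unfolding re_part_def im_part_def by (auto simp: csubspace_def)

text \<open>Square roots and positive parts of elements of a C*-subalgebra \<open>D\<close> stay in \<open>D\<close>, although
  \<open>D\<close> does not contain the unit: they lie in the closed unital algebra of multipliers of \<open>D\<close>
  and are dominated by elements of \<open>D\<close>.\<close>

lemma closed_unital_subalgebra_multipliers:
  assumes D: "c_star_subalgebra D"
  shows "closed_unital_subalgebra {z. \<forall>d\<in>D. z * d \<in> D}"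
proof -
  have "closed {z. \<forall>d\<in>D. z * d \<in> D}"
  proof -
    have "{z. \<forall>d\<in>D. z * d \<in> D} = (\<Inter>d\<in>D. (\<lambda>z. z * d) -` D)" by auto
    moreover have "closed ((\<lambda>z. z * d) -` D)" for d
      using D by (intro continuous_closed_vimage) (auto simp: c_star_subalgebra_def)
    ultimately show ?thesis by auto
  qed
  then show ?thesis
    using D csubspace_scaleR[of D]
    by (auto simp: closed_unital_subalgebra_def c_star_subalgebra_def csubspace_def
        distrib_right mult.assoc)
qed

lemma pos_sqrt_in_subalgebra:
  assumes D: "c_star_subalgebra D" and a: "pos a" "a \<in> D"
  shows "pos_sqrt a \<in> D"
proof -
  note S = closed_unital_subalgebra_multipliers[OF D]
  show ?thesis
    by (rule dominated_mem[OF a _ _ _ S, of _ 1])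
      (use D a pos_sqrt_in_cus[OF S a(1)]
        in \<open>auto simp: cstar_pos_sqrt pos_sqrt_mult_self c_star_subalgebra_def\<close>)
qed

lemma pos_neg_parts_in_subalgebra:
  assumes D: "c_star_subalgebra D" and a: "cstar a = a" "a \<in> D"
  obtains p q where "pos p" "pos q" "p \<in> D" "q \<in> D" "a = p - q" "norm p \<le> norm a" "norm q \<le> norm a"
proof -
  let ?S = "{z. \<forall>d\<in>D. z * d \<in> D}"
  note S = closed_unital_subalgebra_multipliers[OF D]
  have DS: "D \<subseteq> ?S" using D by (auto simp: c_star_subalgebra_def)
  obtain p q where pq: "pos p" "pos q" "a = p - q" "p * q = 0" "q * p = 0" "a * a = p * p + q * q"
    "norm p \<le> norm a" "norm q \<le> norm a"
    "\<And>S. closed_unital_subalgebra S \<Longrightarrow> a \<in> S \<Longrightarrow> p \<in> S \<and> q \<in> S"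
    by (rule pos_neg_parts[OF a(1)]) blast
  have pqS: "p \<in> ?S" "q \<in> ?S" using pq(9)[OF S] a(2) DS by blast+
  have aa: "pos (a * a)" "a * a \<in> D" using pos_mult_self a D by (auto simp: c_star_subalgebra_def)
  have *: "z \<in> D" if z: "pos z" "z \<in> ?S" "z * z \<preceq> a * a" for z
    by (rule dominated_mem[OF aa _ _ _ S, of _ 1])
      (use D z aa DS in \<open>auto simp: pos_selfadjoint c_star_subalgebra_def\<close>)
  have "p \<in> D" "q \<in> D"
    by (rule *; use pq(1,2,6) pqS in \<open>simp add: cle_def pos_mult_self pos_selfadjoint\<close>)+
  then show ?thesis using that pq by blast
qed

abbreviation square_sum :: "'b::c_star_algebra list \<Rightarrow> 'b" where
  "square_sum hs \<equiv> sum_list (map (\<lambda>h. cstar h * h) hs)"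

lemma pos_square_sum: "pos (square_sum hs)"
  by (induction hs) (auto intro: pos_add pos_cstar_mult_self)

lemma square_le_square_sum: "h \<in> set hs \<Longrightarrow> cstar h * h \<preceq> square_sum hs"
proof (induction hs)
  case (Cons k ks)
  then show ?case
    using cle_add_mono[of "cstar h * h" "cstar k * k" 0 "square_sum ks"]
      cle_add_mono[of 0 "cstar k * k" "cstar h * h" "square_sum ks"]
    by (auto simp: pos_square_sum pos_cstar_mult_self)
qed simp

section \<open>The ideal spanned by left unital elements: minimality, density, hereditary
  subalgebras\<close>

locale closed_star_ideal =
  fixes J :: "'b::{c_star_algebra,real_normed_algebra_1} set"
  assumes closed_J: "closed J" and ideal_J: "ideal_of J" and cstar_J: "\<And>x. x \<in> J \<Longrightarrow> cstar x \<in> J"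
begin

abbreviation "L \<equiv> left_unital J"
abbreviation "P \<equiv> ped_ideal J"

lemma c_star_subalgebra_J: "c_star_subalgebra J"
  using closed_J cstar_J ideal_ofD[OF ideal_J] ideal_of_scaleC[OF ideal_J]
  by (auto simp: c_star_subalgebra_def csubspace_def)

lemma left_unital_rmult: "h \<in> L \<Longrightarrow> h * b \<in> L"
  unfolding left_unital_def by (auto intro!: ideal_ofD(4)[OF ideal_J]) (metis mult.assoc)

lemma left_unital_subset_ped: "h \<in> L \<Longrightarrow> h \<in> P"
  using ped_step[OF ped_zero, of h J 1] by simp

lemma ideal_ped: "ideal_of P"
proof -
  have "a + b \<in> P" if "a \<in> P" "b \<in> P" for a b
    using that by induction (auto simp: add.assoc intro: ped_step)
  moreover have "x * a \<in> P" if "a \<in> P" for a x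
    using that by induction (auto simp: distrib_left simp flip: mult.assoc intro: ped_zero ped_step)
  moreover have "a * x \<in> P" if "a \<in> P" for a x
    using that by induction (auto simp: distrib_right mult.assoc intro: ped_zero ped_step left_unital_rmult)
  ultimately show ?thesis by (auto simp: ideal_of_def ped_zero)
qed

lemmas P_intros = ideal_ofD[OF ideal_ped] ideal_of_scaleC[OF ideal_ped]
  ideal_of_scaleR[OF ideal_ped] ideal_of_diff[OF ideal_ped]

lemma ped_subset: "P \<subseteq> J"
proof
  show "x \<in> J" if "x \<in> P" for x
    using that by induction (auto simp: left_unital_def intro: ideal_ofD[OF ideal_J])
qed

text \<open>If \<open>g h = h\<close> and \<open>y\<close> in the ideal is so close to \<open>g\<close> that \<open>1 - (g - y)\<close> is invertible,
  then \<open>(1 - (g - y)) h = y h\<close> exhibits \<open>h\<close> as an element of the ideal.\<close>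

lemma ped_minimal:
  assumes I: "ideal_of I" and dense: "\<And>x e. x \<in> J \<Longrightarrow> e > 0 \<Longrightarrow> \<exists>y\<in>I. norm (x - y) < e"
  shows "P \<subseteq> I"
proof -
  have L: "h \<in> I" if h: "h \<in> L" for h
  proof -
    obtain g where g: "g \<in> J" "g * h = h" using h by (auto simp: left_unital_def)
    obtain y where y: "y \<in> I" "norm (g - y) < 1" using dense[OF g(1), of 1] by auto
    define G where "G = (\<Sum>n. (g - y) ^ n)"
    have "(1 - (g - y)) * h = y * h" by (simp add: algebra_simps g)
    then have "G * (1 - (g - y)) * h = G * (y * h)" by (simp add: mult.assoc)
    then have "h = G * (y * h)" unfolding G_def using neumann_inverse(2)[OF y(2)] by simp
    then show ?thesis using ideal_ofD[OF I] y by metis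
  qed
  show ?thesis
  proof
    show "x \<in> I" if "x \<in> P" for x
      using that by induction (auto intro: ideal_ofD[OF I] L)
  qed
qed

text \<open>With \<open>p = (a - \<epsilon>)\<^sub>+\<close> and \<open>q = (a - \<epsilon>)\<^sub>-\<close>, the local unit of \<open>p\<close> is
  \<open>1 - q/\<epsilon> = min(1, a/\<epsilon>)\<close>.\<close>

lemma ped_dense_pos:
  assumes a: "pos a" "a \<in> J" and e: "\<epsilon> > 0"
  shows "\<exists>p\<in>L. norm (a - p) \<le> \<epsilon>"
proof -
  have "cstar (a - \<epsilon> *\<^sub>R 1) = a - \<epsilon> *\<^sub>R 1" by (simp add: cstar_diff pos_selfadjoint a)
  then obtain p q where pq: "pos p" "pos q" "a - \<epsilon> *\<^sub>R 1 = p - q" "p * q = 0" "q * p = 0"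
    by (metis pos_neg_parts)
  have a_eq: "a = p - q + \<epsilon> *\<^sub>R 1" using pq(3) by (simp add: algebra_simps)
  have qa: "q * a = \<epsilon> *\<^sub>R q - q * q" "a * q = \<epsilon> *\<^sub>R q - q * q"
    unfolding a_eq by (simp_all add: algebra_simps pq)
  have sq: "cstar q = q" by (rule pos_selfadjoint[OF pq(2)])
  \<comment> \<open>q commutes with \<open>a\<close>, so q a = \<epsilon> q - q^2 is positive. This
    bounds the norm of q by \<epsilon> and makes the local unit positive.\<close>
  have "pos (q * a)" by (rule pos_commuting_mult) (use pq a qa in auto)
  then have "q * q \<preceq> \<epsilon> *\<^sub>R q" by (simp add: cle_def qa)
  then have "norm (q * q) \<le> norm (\<epsilon> *\<^sub>R q)" by (intro norm_mono pos_mult_self sq)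
  then have "norm q * norm q \<le> \<epsilon> * norm q"
    using e norm_selfadjoint_mult[OF sq] by (simp add: power2_eq_square)
  then have "norm q \<le> \<epsilon>" using e by (cases "q = 0") auto
  then have q_le: "pos (\<epsilon> *\<^sub>R 1 - q)" using cle_norm[OF sq] by (simp add: cle_def)
  define g where "g = (1/\<epsilon>) *\<^sub>R (\<epsilon> *\<^sub>R 1 - q)"
  have g: "pos g" unfolding g_def using q_le e by (simp add: pos_scaleR)
  have one_g: "1 - g = (1/\<epsilon>) *\<^sub>R q" using e by (simp add: g_def scaleR_diff_right)
  have g1: "pos (1 - g)" unfolding one_g using pq e by (simp add: pos_scaleR)
  \<comment> \<open>From 0 \<le> g \<le> 1 follows g^2 \<le> g, and g \<le> a / \<epsilon> then
    places g in \<open>J\<close> by domination.\<close>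
  have "pos (g * (1 - g))" by (rule pos_commuting_mult[OF g g1]) (simp add: algebra_simps)
  then have "g * g \<preceq> g" by (simp add: cle_def algebra_simps)
  moreover have "(1/\<epsilon>) *\<^sub>R a - g = (1/\<epsilon>) *\<^sub>R p"
    by (simp add: g_def a_eq flip: scaleR_diff_right)
  then have "g \<preceq> (1/\<epsilon>) *\<^sub>R a" using pq e by (simp add: cle_def pos_scaleR)
  ultimately have "cstar g * g \<preceq> (1/\<epsilon>) *\<^sub>R a"
    using cle_trans pos_selfadjoint[OF g] by metis
  then have "g \<in> J"
    by (rule dominated_mem[OF a _ _ closed_J closed_unital_subalgebra_UNIV])
      (use e in \<open>auto intro: ideal_ofD[OF ideal_J]\<close>)
  moreover have "p = a - \<epsilon> *\<^sub>R g" using e by (simp add: g_def a_eq)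
  then have "p \<in> J" using a \<open>g \<in> J\<close> by (simp add: ideal_of_diff ideal_of_scaleR ideal_J)
  moreover have "g * p = p" using e by (simp add: g_def left_diff_distrib pq)
  ultimately have "p \<in> L" by (auto simp: left_unital_def)
  moreover have "norm (a - p) \<le> \<epsilon>"
    using norm_le_of_cle[of g 1] g g1 e \<open>p = a - \<epsilon> *\<^sub>R g\<close> by (simp add: cle_def mult_left_le)
  ultimately show ?thesis by blast
qed

lemma ped_dense:
  assumes x: "x \<in> J" and e: "e > 0"
  shows "\<exists>y\<in>P. norm (x - y) < e"
proof -
  have cs: "csubspace J" using c_star_subalgebra_J by (simp add: c_star_subalgebra_def)
  have sa: "\<exists>y\<in>P. norm (h - y) \<le> 2 * d" if h: "h \<in> J" "cstar h = h" and d: "d > 0" for h d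
  proof -
    obtain p q where pq: "pos p" "pos q" "p \<in> J" "q \<in> J" "h = p - q"
      using pos_neg_parts_in_subalgebra[OF c_star_subalgebra_J h(2,1)] by metis
    obtain p' q' where *: "p' \<in> L" "norm (p - p') \<le> d" "q' \<in> L" "norm (q - q') \<le> d"
      using ped_dense_pos pq d by metis
    have "norm (h - (p' - q')) \<le> norm (p - p') + norm (q - q')"
      using norm_triangle_ineq4[of "p - p'" "q - q'"] by (simp add: pq algebra_simps)
    then show ?thesis using * by (intro bexI[of _ "p' - q'"] P_intros left_unital_subset_ped) auto
  qed
  \<comment> \<open>Each part is approximated within e / 4, so the total error is at most e /
    2.\<close>
  obtain y z where *: "y \<in> P" "norm (re_part x - y) \<le> 2 * (e/8)" "z \<in> P" "norm (im_part x - z) \<le> 2 * (e/8)"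
    using sa[of _ "e/8"] csubspace_re_im[OF cs x cstar_J[OF x]] e
    by (metis cstar_re_part cstar_im_part divide_pos_pos zero_less_numeral)
  have "x - (y + \<i> *\<^sub>C z) = (re_part x - y) + \<i> *\<^sub>C (im_part x - z)"
    using re_im_decomp[of x] by (simp add: scaleC_diff_right algebra_simps)
  then have "norm (x - (y + \<i> *\<^sub>C z)) = norm ((re_part x - y) + \<i> *\<^sub>C (im_part x - z))"
    by (rule arg_cong)
  also have "\<dots> \<le> norm (re_part x - y) + norm (im_part x - z)"
    using norm_triangle_ineq[of "re_part x - y" "\<i> *\<^sub>C (im_part x - z)"] by (simp add: norm_scaleC)
  also have "\<dots> < e" using * e by simp
  finally show ?thesis using * by (intro bexI[of _ "y + \<i> *\<^sub>C z"] P_intros) auto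
qed

text \<open>The adjoint turns left units into right units, so the spanning set is not visibly
  stable. Instead, the preimage of the ideal under \<open>cstar\<close> is an ideal that still
  approximates all of \<open>J\<close>, and minimality applies.\<close>

lemma cstar_ped: assumes "x \<in> P" shows "cstar x \<in> P"
proof -
  have "ideal_of (cstar -` P)"
    unfolding ideal_of_def by (auto simp: cstar_add cstar_mult intro: P_intros)
  moreover have "\<exists>y\<in>cstar -` P. norm (z - y) < e" if z: "z \<in> J" "e > 0" for z e
  proof -
    obtain y where "y \<in> P" "norm (cstar z - y) < e" using ped_dense[OF cstar_J[OF z(1)] z(2)] by blast
    moreover have "norm (z - cstar y) = norm (cstar z - y)"
      by (metis norm_cstar cstar_diff cstar_cstar)
    ultimately show ?thesis by (intro bexI[of _ "cstar y"]) (auto simp: cstar_cstar)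
  qed
  ultimately show ?thesis using ped_minimal assms by blast
qed

text \<open>Square sums of left unital elements majorise the whole ideal. In the induction
  \<open>c\<close> is estimated by its norm and the cross terms by the parallelogram identity,
  whence the factor 2.\<close>

lemma ped_dominated:
  "a \<in> P \<Longrightarrow> \<exists>hs K. set hs \<subseteq> L \<and> K \<ge> 0 \<and> cstar a * a \<preceq> K *\<^sub>R square_sum hs"
proof (induction rule: ped_ideal.induct)
  case ped_zero
  show ?case by (intro exI[of _ "[]"] exI[of _ 0]) auto
next
  case (ped_step a h c)
  then obtain hs K where IH: "set hs \<subseteq> L" "K \<ge> 0" "cstar a * a \<preceq> K *\<^sub>R square_sum hs" by blast
  define M where "M = (norm c)\<^sup>2 + K"
  have "cstar (c * h) * (c * h) \<preceq> M *\<^sub>R (cstar h * h)"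
    by (rule cle_trans[OF cstar_mult_left_le])
      (use IH in \<open>simp add: cle_def M_def pos_scaleR pos_cstar_mult_self flip: scaleR_diff_left\<close>)
  moreover have "cstar a * a \<preceq> M *\<^sub>R square_sum hs"
    by (rule cle_trans[OF IH(3)])
      (simp add: cle_def M_def pos_scaleR pos_square_sum flip: scaleR_diff_left)
  ultimately have "cstar (c * h) * (c * h) + cstar a * a \<preceq> M *\<^sub>R square_sum (h # hs)"
    using cle_add_mono by (fastforce simp: scaleR_add_right)
  from cle_scaleR[OF this, of 2] have
    "cstar (c * h + a) * (c * h + a) \<preceq> (2 * M) *\<^sub>R square_sum (h # hs)"
    using cle_trans[OF cstar_mult_add_le] by simp
  then show ?case using IH ped_step
    by (intro exI[of _ "h # hs"] exI[of _ "2 * M"]) (auto simp: M_def)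
qed

text \<open>With \<open>q = \<Sum> h\<^sup>* h\<close>, the elements \<open>u\<^sub>h = lim h (q + 1/n)\<^sup>-\<^sup>1\<^sup>/\<^sup>2 x\<close> exist, inherit the local
  units of the \<open>h\<close>, and satisfy \<open>\<Sum> u\<^sub>h\<^sup>* u\<^sub>h = x\<^sup>* x\<close>.\<close>

lemma cstar_mult_self_in_ped:
  assumes hs: "set hs \<subseteq> L" and x: "x \<in> right_closure (square_sum hs)"
  shows "cstar x * x \<in> P"
proof -
  define q where "q = square_sum hs"
  have q: "pos q" by (simp add: q_def pos_square_sum)
  define s where "s = pos_sqrt q"
  have s: "pos s" "s * s = q" "cstar s = s"
    by (simp_all add: s_def pos_pos_sqrt pos_sqrt_mult_self cstar_pos_sqrt q)
  define \<epsilon> where "\<epsilon> n = 1 / real (Suc n)" for n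
  have "\<exists>w. pos w \<and> w * q = q * w \<and> \<epsilon> n *\<^sub>R (w * w) = 1 - w * q * w \<and> w * q * w \<preceq> 1" for n
    using pos_inverse_sqrt[OF q, of "\<epsilon> n"] unfolding \<epsilon>_def by (metis zero_less_divide_1_iff of_nat_0_less_iff zero_less_Suc)
  then obtain w where w: "\<And>n. pos (w n)" "\<And>n. w n * q = q * w n"
    "\<And>n. \<epsilon> n *\<^sub>R (w n * w n) = 1 - w n * q * w n" "\<And>n. w n * q * w n \<preceq> 1"
    by metis
  have sw: "s * w n = w n * s" for n
    unfolding s_def by (rule pos_sqrt_commute[OF q]) (simp add: w)
  \<comment> \<open>\<open>r n\<close> is the root of q / (q + \<epsilon>), so it acts as an
    approximate unit on the closed right ideal of q.\<close>
  define r where "r n = s * w n" for n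
  have r: "pos (r n)" for n unfolding r_def by (rule pos_commuting_mult) (use s w sw in auto)
  have sr: "cstar (r n) = r n" for n by (rule pos_selfadjoint[OF r])
  have rr: "r n * r n = w n * q * w n" for n
  proof -
    have "r n * r n = (w n * s) * (s * w n)" unfolding r_def by (simp only: sw)
    then show ?thesis by (simp add: mult.assoc flip: s(2))
  qed
  have r_norm: "norm (r n) \<le> 1" for n
  proof -
    have "norm (r n * r n) \<le> 1"
      unfolding rr using norm_le_of_cle[of "w n * q * w n" 1] w(4) r[of n] pos_mult_self[OF sr] rr by simp
    then show ?thesis using norm_selfadjoint_mult[OF sr] by (simp add: power_le_one_iff)
  qed
  have rs: "r n * s = s * r n" for n unfolding r_def by (metis sw mult.assoc)
  have "(norm ((1 - r n) * s))\<^sup>2 \<le> \<epsilon> n" for n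
  proof -
    have r1: "pos (1 - r n)" using cle_norm[OF sr r_norm] by (simp add: cle_def)
    have rq: "r n * q = q * r n" using rs s(2) by (metis mult.assoc)
    \<comment> \<open>r (1 - r) \<ge> 0 gives (1 - r)^2 \<le> 1 - r^2 = \<epsilon> w^2. Hence the
      squared norm of (1 - r) s is at most the norm of \<epsilon> w q w.\<close>
    have "pos (r n * (1 - r n))" by (rule pos_commuting_mult[OF r r1]) (simp add: algebra_simps)
    then have "pos (r n * (1 - r n) * q)"
      using q by (rule pos_commuting_mult) (metis mult.assoc rq left_diff_distrib right_diff_distrib mult_1_left mult_1_right)
    then have "pos (2 *\<^sub>R (r n * (1 - r n) * q))" by (rule pos_scaleR) simp
    moreover have "2 *\<^sub>R (r n * (1 - r n) * q) = (1 - r n * r n) * q - (1 - r n) * (1 - r n) * q"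
      by (simp add: algebra_simps scaleR_2)
    moreover have "(1 - r n * r n) * q = \<epsilon> n *\<^sub>R (w n * q * w n)"
      unfolding rr using w(3)[of n] w(2)[of n] by (metis mult.assoc mult_scaleR_left)
    ultimately have le: "(1 - r n) * (1 - r n) * q \<preceq> \<epsilon> n *\<^sub>R (w n * q * w n)"
      by (simp add: cle_def)
    have "cstar ((1 - r n) * s) * ((1 - r n) * s) = (1 - r n) * (1 - r n) * q"
    proof -
      have "s * (1 - r n) = (1 - r n) * s" by (simp add: algebra_simps rs)
      then show ?thesis by (simp add: cstar_mult cstar_diff sr s(3)) (metis mult.assoc s(2))
    qed
    then have "(norm ((1 - r n) * s))\<^sup>2 = norm ((1 - r n) * (1 - r n) * q)" "pos ((1 - r n) * (1 - r n) * q)"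
      by (metis norm_cstar_mult_self) (metis pos_cstar_mult_self \<open>cstar ((1 - r n) * s) * _ = _\<close>)
    then have "(norm ((1 - r n) * s))\<^sup>2 \<le> norm (\<epsilon> n *\<^sub>R (w n * q * w n))"
      using norm_mono[OF _ le] by simp
    also have "\<dots> \<le> \<epsilon> n"
      using r_norm[of n] norm_selfadjoint_mult[OF sr, of n] rr[of n]
      by (simp add: \<epsilon>_def power_le_one divide_right_mono)
    finally show ?thesis .
  qed
  moreover have \<epsilon>0: "\<epsilon> \<longlonglongrightarrow> 0" unfolding \<epsilon>_def by (rule LIMSEQ_Suc[OF lim_1_over_n])
  ultimately have "(\<lambda>n. (norm ((1 - r n) * s))\<^sup>2) \<longlonglongrightarrow> 0"
    by (intro tendsto_sandwich[OF _ _ tendsto_const \<epsilon>0]) auto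
  then have "(\<lambda>n. sqrt ((norm ((1 - r n) * s))\<^sup>2)) \<longlonglongrightarrow> sqrt 0"
    by (rule tendsto_real_sqrt)
  then have "(\<lambda>n. (1 - r n) * s) \<longlonglongrightarrow> 0" by (simp add: tendsto_norm_zero_iff)
  then have rs_lim: "(\<lambda>n. r n * s) \<longlonglongrightarrow> s"
    using tendsto_diff[OF tendsto_const[of s], of "\<lambda>n. (1 - r n) * s" 0] by (simp add: algebra_simps)
  have r_lim: "(\<lambda>n. r n * x) \<longlonglongrightarrow> x"
  proof (rule LIMSEQ_I)
    fix e :: real assume e: "e > 0"
    obtain b where b: "norm (x - q * b) < e / 4"
      using x e unfolding right_closure_def closure_approachable q_def[symmetric]
      by (metis (no_types, lifting) dist_norm dist_commute imageE divide_pos_pos zero_less_numeral)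
    have "(\<lambda>n. r n * s * (s * b)) \<longlonglongrightarrow> s * (s * b)"
      by (intro tendsto_mult rs_lim tendsto_const)
    then have "(\<lambda>n. r n * (q * b)) \<longlonglongrightarrow> q * b" by (simp add: mult.assoc flip: s(2))
    then obtain N where N: "\<And>n. n \<ge> N \<Longrightarrow> norm (r n * (q * b) - q * b) < e / 4"
      using LIMSEQ_D e by (metis divide_pos_pos zero_less_numeral)
    have "norm (r n * x - x) < e" if n: "n \<ge> N" for n
    proof -
      have "r n * x - x = r n * (x - q * b) + (r n * (q * b) - q * b) - (x - q * b)"
        by (simp add: algebra_simps)
      then have "norm (r n * x - x) \<le> norm (r n * (x - q * b)) + norm (r n * (q * b) - q * b) + norm (x - q * b)"
        by (metis norm_triangle_ineq norm_triangle_ineq4 add_right_mono order_trans)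
      moreover have "norm (r n * (x - q * b)) \<le> 1 * norm (x - q * b)"
        by (rule order_trans[OF norm_mult_ineq mult_right_mono]) (simp_all add: r_norm)
      ultimately show ?thesis using b N[OF n] e by simp
    qed
    then show "\<exists>no. \<forall>n\<ge>no. norm (r n * x - x) < e" by blast
  qed
  have conv: "\<exists>u\<in>L. (\<lambda>n. h * w n * x) \<longlonglongrightarrow> u" if h: "h \<in> set hs" for h
  proof -
    have hq: "cstar h * h \<preceq> q" unfolding q_def by (rule square_le_square_sum[OF h])
    \<comment> \<open>As \<open>cstar h * h\<close> is below q = s^2, differences of h w x are
      bounded by those of s w x = r x, which converges.\<close>
    have "norm (h * w m * x - h * w n * x) \<le> norm (r m * x - r n * x)" for m n
    proof -
      define z where "z = (w m - w n) * x"
      have *: "h * w m * x - h * w n * x = h * z" "r m * x - r n * x = s * z"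
        by (simp_all add: z_def r_def algebra_simps)
      have "norm (cstar z * (cstar h * h) * z) \<le> norm (cstar z * q * z)"
        by (rule norm_mono[OF pos_conj[OF pos_cstar_mult_self] cle_conj[OF hq]])
      then have "(norm (h * z))\<^sup>2 \<le> (norm (s * z))\<^sup>2"
      proof -
        have "cstar (h * z) * (h * z) = cstar z * (cstar h * h) * z"
          by (simp add: cstar_mult mult.assoc)
        moreover have "cstar (s * z) * (s * z) = cstar z * q * z"
          by (simp add: cstar_mult s(3) mult.assoc flip: s(2))
        ultimately show ?thesis
          using \<open>norm (cstar z * (cstar h * h) * z) \<le> _\<close> by (simp flip: norm_cstar_mult_self)
      qed
      then show ?thesis unfolding * by (rule power2_le_imp_le) simp
    qed
    moreover have "Cauchy (\<lambda>n. r n * x)" using r_lim by (intro convergent_Cauchy convergentI)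
    ultimately have "Cauchy (\<lambda>n. h * w n * x)"
      unfolding Cauchy_iff by (meson order_le_less_trans)
    then obtain u where u: "(\<lambda>n. h * w n * x) \<longlonglongrightarrow> u" using Cauchy_convergent_iff convergent_def by blast
    obtain g where g: "h \<in> J" "g \<in> J" "g * h = h" using h hs by (auto simp: left_unital_def)
    have "u \<in> J"
      by (rule closed_sequentially[OF closed_J _ u]) (use g in \<open>auto intro: ideal_ofD[OF ideal_J]\<close>)
    moreover have "g * u = u"
    proof (rule LIMSEQ_unique[OF _ u])
      have "(\<lambda>n. g * (h * w n * x)) \<longlonglongrightarrow> g * u" by (intro tendsto_intros u)
      then show "(\<lambda>n. h * w n * x) \<longlonglongrightarrow> g * u" by (simp add: g flip: mult.assoc)
    qed
    ultimately show ?thesis using u g by (auto simp: left_unital_def)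
  qed
  have sum: "\<exists>y\<in>P. (\<lambda>n. square_sum (map (\<lambda>h. h * w n * x) ks)) \<longlonglongrightarrow> y" if "set ks \<subseteq> set hs" for ks
    using that
  proof (induction ks)
    case Nil
    show ?case using ped_zero by auto
  next
    case (Cons k ks)
    then obtain y where y: "y \<in> P" "(\<lambda>n. square_sum (map (\<lambda>h. h * w n * x) ks)) \<longlonglongrightarrow> y" by auto
    obtain u where u: "u \<in> L" "(\<lambda>n. k * w n * x) \<longlonglongrightarrow> u" using conv[of k] Cons by auto
    have "(\<lambda>n. cstar (k * w n * x) * (k * w n * x) + square_sum (map (\<lambda>h. h * w n * x) ks))
        \<longlonglongrightarrow> cstar u * u + y"
      by (intro tendsto_intros u y)
    then show ?case
      by (intro bexI[of _ "cstar u * u + y"]) (auto intro: P_intros left_unital_subset_ped u y)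
  qed
  then obtain y where y: "y \<in> P" "(\<lambda>n. square_sum (map (\<lambda>h. h * w n * x) hs)) \<longlonglongrightarrow> y" by blast
  \<comment> \<open>Factoring out w x turns the square sum into
    \<open>cstar (r n * x) * (r n * x)\<close>, whose limit is \<open>cstar x * x\<close>.\<close>
  have factor: "square_sum (map (\<lambda>h. h * z) ks) = cstar z * square_sum ks * z" for z ks
    by (induction ks) (auto simp: cstar_mult algebra_simps)
  have "square_sum (map (\<lambda>h. h * w n * x) hs) = cstar (r n * x) * (r n * x)" for n
  proof -
    have "square_sum (map (\<lambda>h. h * w n * x) hs) = cstar (w n * x) * q * (w n * x)"
      using factor[of "w n * x" hs] by (simp only: mult.assoc q_def)
    also have "\<dots> = cstar x * (w n * q * w n) * x"
      by (simp add: cstar_mult pos_selfadjoint[OF w(1)] mult.assoc)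
    also have "\<dots> = cstar (r n * x) * (r n * x)"
      by (simp only: rr[symmetric]) (simp add: cstar_mult sr mult.assoc)
    finally show ?thesis .
  qed
  moreover have "(\<lambda>n. cstar (r n * x) * (r n * x)) \<longlonglongrightarrow> cstar x * x"
    by (intro tendsto_intros r_lim)
  ultimately have "y = cstar x * x" using y(2) LIMSEQ_unique by simp
  then show ?thesis using y by simp
qed

text \<open>A positive element of the corner is the square of its root, which lies in the closed
  right ideal, so \<open>cstar_mult_self_in_ped\<close> applies. Linear combinations give the
  rest.\<close>

lemma corner_subset_ped:
  assumes hs: "set hs \<subseteq> L" shows "corner (square_sum hs) \<subseteq> P"
proof
  fix x assume x: "x \<in> corner (square_sum hs)"
  let ?D = "corner (square_sum hs)"
  have D: "c_star_subalgebra ?D" using hereditary_corner[of "square_sum hs"] by (simp add: hereditary_def)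
  have pos: "p \<in> P" if p: "pos p" "p \<in> ?D" for p
  proof -
    have "pos_sqrt p \<in> ?D" by (rule pos_sqrt_in_subalgebra[OF D p])
    then have "pos_sqrt p \<in> right_closure (square_sum hs)" by (simp add: corner_def)
    from cstar_mult_self_in_ped[OF hs this] show ?thesis
      by (simp add: cstar_pos_sqrt pos_sqrt_mult_self p)
  qed
  have sa: "h \<in> P" if h: "cstar h = h" "h \<in> ?D" for h
    using pos_neg_parts_in_subalgebra[OF D h] pos P_intros by metis
  have "re_part x \<in> ?D" "im_part x \<in> ?D"
    using csubspace_re_im[of ?D x] D x by (auto simp: c_star_subalgebra_def)
  then have "re_part x + \<i> *\<^sub>C im_part x \<in> P" using sa by (intro P_intros) auto
  then show "x \<in> P" using re_im_decomp[of x] by simp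
qed

text \<open>The corner asks for both \<open>a\<close> and \<open>cstar a\<close> in the closed right
  ideal. One list dominates \<open>cstar a * a\<close>, another \<open>a * cstar a\<close>, and
  their concatenation serves both.\<close>

theorem ped_hereditary_subalgebra:
  assumes a: "a \<in> P"
  obtains D where "hereditary D" "D \<subseteq> P" "a \<in> D"
proof -
  obtain hs K where h: "set hs \<subseteq> L" "K \<ge> 0" "cstar a * a \<preceq> K *\<^sub>R square_sum hs"
    using ped_dominated[OF a] by blast
  obtain ks M where k: "set ks \<subseteq> L" "M \<ge> 0" "cstar (cstar a) * cstar a \<preceq> M *\<^sub>R square_sum ks"
    using ped_dominated[OF cstar_ped[OF a]] by blast
  let ?q = "square_sum (hs @ ks)"
  have "square_sum hs \<preceq> ?q" "square_sum ks \<preceq> ?q" by (simp_all add: cle_def pos_square_sum)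
  then have "cstar a * a \<preceq> K *\<^sub>R ?q" "cstar (cstar a) * cstar a \<preceq> M *\<^sub>R ?q"
    using h k cle_trans cle_scaleR by blast+
  then have "cstar a \<in> right_closure ?q" "cstar (cstar a) \<in> right_closure ?q"
    using left_dominated[OF pos_square_sum right_closure_intros(1)] h k by blast+
  then have "a \<in> corner ?q" by (simp add: corner_def cstar_cstar)
  moreover have "corner ?q \<subseteq> P" by (rule corner_subset_ped) (use h k in auto)
  ultimately show ?thesis using that hereditary_corner by blast
qed

end


section \<open>The Jordan decomposition of a trace\<close>

definition clinear_on :: "'b::c_star_algebra set \<Rightarrow> ('b \<Rightarrow> complex) \<Rightarrow> bool" where
  "clinear_on P \<sigma> \<longleftrightarrow> (\<forall>x\<in>P. \<forall>y\<in>P. \<sigma> (x + y) = \<sigma> x + \<sigma> y) \<and> (\<forall>c. \<forall>x\<in>P. \<sigma> (c *\<^sub>C x) = c * \<sigma> x)"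

definition tracial_on :: "'b::c_star_algebra set \<Rightarrow> ('b \<Rightarrow> complex) \<Rightarrow> bool" where
  "tracial_on P \<sigma> \<longleftrightarrow> (\<forall>x\<in>P. \<forall>y\<in>P. \<sigma> (x * y) = \<sigma> (y * x))"

definition positive_trace_on :: "'b::{c_star_algebra,real_normed_algebra_1} set \<Rightarrow> ('b \<Rightarrow> complex) \<Rightarrow> bool" where
  "positive_trace_on P \<sigma> \<longleftrightarrow> clinear_on P \<sigma> \<and> tracial_on P \<sigma> \<and> (\<forall>a\<in>P. pos a \<longrightarrow> \<sigma> a \<in> \<real>\<^sub>\<ge>\<^sub>0)"

lemma clinear_onD:
  assumes "clinear_on P \<sigma>"
  shows "x \<in> P \<Longrightarrow> y \<in> P \<Longrightarrow> \<sigma> (x + y) = \<sigma> x + \<sigma> y" "x \<in> P \<Longrightarrow> \<sigma> (c *\<^sub>C x) = c * \<sigma> x"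
    "x \<in> P \<Longrightarrow> \<sigma> (r *\<^sub>R x) = r * \<sigma> x" "x \<in> P \<Longrightarrow> \<sigma> (- x) = - \<sigma> x"
  using assms by (auto simp: clinear_on_def scaleR_scaleC simp flip: scaleC_minus_one)

context closed_star_ideal
begin

lemma ped_minus: "x \<in> P \<Longrightarrow> - x \<in> P"
  using P_intros(6)[of x "-1"] by simp

lemma csubspace_ped: "csubspace P"
  by (auto simp: csubspace_def intro: P_intros)

lemma ped_re_im: assumes "x \<in> P" shows "re_part x \<in> P" "im_part x \<in> P"
  by (intro csubspace_re_im csubspace_ped cstar_ped assms)+

text \<open>An ideal that is not closed need not contain the roots of its positive elements. This
  one does, because \<open>a\<close> lies in a C*-subalgebra inside it.\<close>

lemma ped_pos_sqrt: assumes "pos a" "a \<in> P" shows "pos_sqrt a \<in> P"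
  using ped_hereditary_subalgebra[OF assms(2)] pos_sqrt_in_subalgebra[OF _ assms(1)]
  unfolding hereditary_def by (metis subsetD)

lemma ped_hereditary: assumes "a \<in> P" "pos y" "y \<preceq> a" shows "y \<in> P"
  using ped_hereditary_subalgebra[OF assms(1)] assms(2,3) unfolding hereditary_def by (metis subsetD)

lemma ped_pos_neg_parts:
  assumes "h \<in> P" "cstar h = h"
  obtains p q where "pos p" "pos q" "p \<in> P" "q \<in> P" "h = p - q"
proof -
  obtain D where D: "hereditary D" "D \<subseteq> P" "h \<in> D" by (rule ped_hereditary_subalgebra[OF assms(1)])
  then show ?thesis
    using pos_neg_parts_in_subalgebra[of D h] assms(2) that unfolding hereditary_def by (metis subsetD)
qed

text \<open>Polarisation: the hypothesis for z + u gives an identity linking z and u, and replacing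
  z by i z separates its two halves. Taking u = \<open>cstar y\<close> yields the trace
  property.\<close>

lemma tracial_onI:
  assumes lin: "clinear_on P \<sigma>" and sq: "\<And>z. z \<in> P \<Longrightarrow> \<sigma> (cstar z * z) = \<sigma> (z * cstar z)"
  shows "tracial_on P \<sigma>"
  unfolding tracial_on_def
proof (intro ballI)
  fix x y assume x: "x \<in> P" and "y \<in> P"
  define u where "u = cstar y"
  have u: "u \<in> P" "cstar u = y" by (simp_all add: u_def cstar_ped cstar_cstar \<open>y \<in> P\<close>)
  note lin = clinear_onD[OF lin]
  note in_P = P_intros cstar_ped ped_minus
  have polar: "\<sigma> (cstar u * z) + \<sigma> (cstar z * u) = \<sigma> (z * cstar u) + \<sigma> (u * cstar z)" if z: "z \<in> P" for z
  proof -
    have e: "cstar (z + u) * (z + u) = (cstar z * z + cstar u * u) + (cstar u * z + cstar z * u)"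
      "(z + u) * cstar (z + u) = (z * cstar z + u * cstar u) + (z * cstar u + u * cstar z)"
      by (simp_all add: cstar_add algebra_simps)
    have "\<sigma> (cstar (z + u) * (z + u)) = \<sigma> (cstar z * z) + \<sigma> (cstar u * u) + (\<sigma> (cstar u * z) + \<sigma> (cstar z * u))"
      unfolding e using z u by (simp add: lin in_P)
    moreover have "\<sigma> ((z + u) * cstar (z + u)) = \<sigma> (z * cstar z) + \<sigma> (u * cstar u) + (\<sigma> (z * cstar u) + \<sigma> (u * cstar z))"
      unfolding e using z u by (simp add: lin in_P)
    ultimately show ?thesis using sq[of "z + u"] sq[OF z] sq[OF u(1)] z u by (simp add: in_P)
  qed
  have "\<i> * (\<sigma> (cstar u * x) - \<sigma> (cstar x * u)) = \<i> * (\<sigma> (x * cstar u) - \<sigma> (u * cstar x))"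
    using polar[of "\<i> *\<^sub>C x"] x u
    by (simp add: lin in_P cstar_scaleC mult_scaleC_left mult_scaleC_right scaleC_minus_left right_diff_distrib)
  then have "\<sigma> (cstar u * x) - \<sigma> (cstar x * u) = \<sigma> (x * cstar u) - \<sigma> (u * cstar x)" by simp
  with polar[OF x] have "\<sigma> (cstar u * x) = \<sigma> (x * cstar u)" by algebra
  then show "\<sigma> (x * y) = \<sigma> (y * x)" using u by simp
qed

text \<open>For additive \<open>f\<close> the value does not depend on the chosen \<open>p\<close>. If \<open>h\<close> is not a selfadjoint
  element of \<open>P\<close>, it is junk.\<close>

definition sa_extension :: "('b \<Rightarrow> real) \<Rightarrow> 'b \<Rightarrow> real" where
  "sa_extension f h = (let p = (SOME p. p \<in> P \<and> pos p \<and> pos (p - h)) in f p - f (p - h))"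

definition cone_extension :: "('b \<Rightarrow> real) \<Rightarrow> 'b \<Rightarrow> complex" where
  "cone_extension f x = Complex (sa_extension f (re_part x)) (sa_extension f (im_part x))"

context
  fixes f :: "'b \<Rightarrow> real"
  assumes f_add: "\<And>a b. a \<in> P \<Longrightarrow> b \<in> P \<Longrightarrow> pos a \<Longrightarrow> pos b \<Longrightarrow> f (a + b) = f a + f b"
    and f_scale: "\<And>r a. a \<in> P \<Longrightarrow> pos a \<Longrightarrow> r \<ge> 0 \<Longrightarrow> f (r *\<^sub>R a) = r * f a"
begin

text \<open>If h = p - q and p' is the chosen majorant of h, then p + (p' - h) = p' + q, and
  additivity on both sides compares the two differences.\<close>

lemma sa_extension_eq:
  assumes "p \<in> P" "q \<in> P" "pos p" "pos q"
  shows "sa_extension f (p - q) = f p - f q"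
proof -
  define p' where "p' = (SOME p'. p' \<in> P \<and> pos p' \<and> pos (p' - (p - q)))"
  have *: "p' \<in> P \<and> pos p' \<and> pos (p' - (p - q))"
    unfolding p'_def by (rule someI[of _ p]) (use assms in simp)
  then have "p' - (p - q) \<in> P" using assms by (intro P_intros) auto
  then have "f (p + (p' - (p - q))) = f p + f (p' - (p - q))"
    using * assms by (intro f_add) auto
  moreover have "f (p' + q) = f p' + f q"
    using * assms by (intro f_add) auto
  moreover have "p + (p' - (p - q)) = p' + q" by simp
  ultimately show ?thesis
    unfolding sa_extension_def p'_def[symmetric] Let_def by simp
qed

lemma sa_extension_add:
  assumes "h \<in> P" "cstar h = h" "k \<in> P" "cstar k = k"
  shows "sa_extension f (h + k) = sa_extension f h + sa_extension f k"
proof -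
  obtain p q where h: "pos p" "pos q" "p \<in> P" "q \<in> P" "h = p - q" by (rule ped_pos_neg_parts[OF assms(1,2)])
  obtain p' q' where k: "pos p'" "pos q'" "p' \<in> P" "q' \<in> P" "k = p' - q'" by (rule ped_pos_neg_parts[OF assms(3,4)])
  have "h + k = (p + p') - (q + q')" by (simp add: h k)
  then have "sa_extension f (h + k) = f (p + p') - f (q + q')"
    using h k by (simp only:) (intro sa_extension_eq P_intros pos_add; assumption)
  then show ?thesis using h k by (simp add: sa_extension_eq f_add)
qed

lemma sa_extension_scaleR:
  assumes "h \<in> P" "cstar h = h"
  shows "sa_extension f (r *\<^sub>R h) = r * sa_extension f h"
proof -
  obtain p q where h: "pos p" "pos q" "p \<in> P" "q \<in> P" "h = p - q" by (rule ped_pos_neg_parts[OF assms])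
  show ?thesis
  proof (cases "r \<ge> 0")
    case True
    have "r *\<^sub>R h = r *\<^sub>R p - r *\<^sub>R q" by (simp add: h scaleR_diff_right)
    then have "sa_extension f (r *\<^sub>R h) = f (r *\<^sub>R p) - f (r *\<^sub>R q)"
      using h True by (simp only:) (intro sa_extension_eq P_intros pos_scaleR; assumption)
    then show ?thesis using h True by (simp add: sa_extension_eq f_scale right_diff_distrib)
  next
    case False
    then have r: "- r \<ge> 0" by simp
    have "r *\<^sub>R h = (- r) *\<^sub>R q - (- r) *\<^sub>R p" by (simp add: h scaleR_diff_right)
    then have "sa_extension f (r *\<^sub>R h) = f ((- r) *\<^sub>R q) - f ((- r) *\<^sub>R p)"
      using h r by (simp only:) (intro sa_extension_eq P_intros pos_scaleR; assumption)
    then show ?thesis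
      using h r f_scale[of q "- r"] f_scale[of p "- r"] by (simp add: sa_extension_eq right_diff_distrib)
  qed
qed

lemma clinear_cone_extension: "clinear_on P (cone_extension f)"
  unfolding clinear_on_def
proof (intro conjI ballI allI)
  fix x y assume xy: "x \<in> P" "y \<in> P"
  have "re_part (x + y) = re_part x + re_part y" "im_part (x + y) = im_part x + im_part y"
    by (simp_all add: re_part_def im_part_def cstar_add scaleC_add_right scaleC_diff_right algebra_simps)
  then show "cone_extension f (x + y) = cone_extension f x + cone_extension f y"
    using xy by (simp add: cone_extension_def sa_extension_add ped_re_im complex_eq_iff)
next
  fix c x assume x: "x \<in> P"
  let ?h = "re_part x" and ?k = "im_part x"
  define h' k' where "h' = Re c *\<^sub>R ?h + (- Im c) *\<^sub>R ?k" and "k' = Re c *\<^sub>R ?k + Im c *\<^sub>R ?h"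
  have c: "c = complex_of_real (Re c) + complex_of_real (Im c) * \<i>"
    by (simp add: complex_eq_iff)
  have "c *\<^sub>C x = c *\<^sub>C (?h + \<i> *\<^sub>C ?k)" using re_im_decomp[of x] by simp
  also have "\<dots> = h' + \<i> *\<^sub>C k'"
    unfolding h'_def k'_def
    by (subst (1) c) (simp add: scaleC_add_left scaleC_add_right scaleR_scaleC scaleC_scaleC
        scaleC_minus_left scaleC_diff_left algebra_simps)
  finally have cx: "c *\<^sub>C x = h' + \<i> *\<^sub>C k'" .
  have sa: "cstar h' = h'" "cstar k' = k'" by (simp_all add: h'_def k'_def cstar_add cstar_diff)
  have "re_part (c *\<^sub>C x) = h'" "im_part (c *\<^sub>C x) = k'"
    unfolding cx using re_im_parts_eq[OF sa] by auto
  moreover note sc = sa_extension_scaleR[OF ped_re_im(1)[OF x] cstar_re_part]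
    sa_extension_scaleR[OF ped_re_im(2)[OF x] cstar_im_part]
  have "sa_extension f h' = Re c * sa_extension f ?h + (- Im c) * sa_extension f ?k"
    unfolding h'_def sc(1)[symmetric] sc(2)[symmetric]
    by (rule sa_extension_add) (use ped_re_im[OF x] in \<open>auto simp: cstar_scaleR intro: P_intros simp del: scaleR_minus_left\<close>)
  moreover have "sa_extension f k' = Re c * sa_extension f ?k + Im c * sa_extension f ?h"
    unfolding k'_def sc(1)[symmetric] sc(2)[symmetric]
    by (rule sa_extension_add) (use ped_re_im[OF x] in \<open>auto intro: P_intros\<close>)
  ultimately show "cone_extension f (c *\<^sub>C x) = c * cone_extension f x"
    by (simp add: cone_extension_def complex_eq_iff)
qed

lemma cone_extension_pos:
  assumes "a \<in> P" "pos a" shows "cone_extension f a = of_real (f a)"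
proof -
  have "re_part a = a - 0" "im_part a = 0 - 0"
    by (simp_all add: re_part_def im_part_def pos_selfadjoint assms flip: scaleR_2)
  moreover have "f 0 = 0" using f_scale[of 0 0] by (simp add: P_intros)
  ultimately show ?thesis
    using assms sa_extension_eq[of a 0] sa_extension_eq[of 0 0]
    by (simp add: cone_extension_def P_intros complex_eq_iff)
qed

end

end

section \<open>The positive part of a bounded hermitian trace\<close>

locale bounded_hermitian_trace = closed_star_ideal J
  for J :: "'b::{c_star_algebra,real_normed_algebra_1} set" +
  fixes \<tau> :: "'b \<Rightarrow> complex"
  assumes linear: "clinear_on (ped_ideal J) \<tau>" and tracial: "tracial_on (ped_ideal J) \<tau>"
    and hermitian: "\<And>x. x \<in> ped_ideal J \<Longrightarrow> \<tau> (cstar x) = cnj (\<tau> x)"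
    and bounded: "\<And>D. c_star_subalgebra D \<Longrightarrow> D \<subseteq> ped_ideal J \<Longrightarrow> \<exists>M. \<forall>x\<in>D. cmod (\<tau> x) \<le> M * norm x"
begin

definition re_trace :: "'b \<Rightarrow> real" where "re_trace x = Re (\<tau> x)"

definition pos_part :: "'b \<Rightarrow> real" where
  "pos_part a = Sup (re_trace ` {y. pos y \<and> y \<preceq> a})"

lemma re_trace_add: "x \<in> P \<Longrightarrow> y \<in> P \<Longrightarrow> re_trace (x + y) = re_trace x + re_trace y"
  by (simp add: re_trace_def clinear_onD[OF linear])

lemma re_trace_scaleR: "x \<in> P \<Longrightarrow> re_trace (r *\<^sub>R x) = r * re_trace x"
  by (simp add: re_trace_def clinear_onD[OF linear])

lemma re_trace_commute: "x \<in> P \<Longrightarrow> y \<in> P \<Longrightarrow> re_trace (x * y) = re_trace (y * x)"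
  using tracial by (simp add: re_trace_def tracial_on_def)

text \<open>All positive elements below \<open>a\<close> lie in one hereditary subalgebra of the
  ideal, where the trace is bounded. The bound keeps \<open>norm y\<close> because it must also
  control small error terms.\<close>

lemma re_trace_bound:
  assumes "a \<in> P"
  obtains M where "M \<ge> 0" "\<And>y. pos y \<Longrightarrow> y \<preceq> a \<Longrightarrow> re_trace y \<le> M * norm y"
proof -
  obtain D where D: "hereditary D" "D \<subseteq> P" "a \<in> D" by (rule ped_hereditary_subalgebra[OF assms])
  then obtain M where M: "\<And>x. x \<in> D \<Longrightarrow> cmod (\<tau> x) \<le> M * norm x"
    using bounded unfolding hereditary_def by blast
  \<comment> \<open>The constant given by boundedness may be negative if \<open>D\<close> is
    zero.\<close>
  have "re_trace y \<le> \<bar>M\<bar> * norm y" if "pos y" "y \<preceq> a" for y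
  proof -
    have "y \<in> D" using that D by (auto simp: hereditary_def)
    then have "re_trace y \<le> M * norm y" using M complex_Re_le_cmod order_trans unfolding re_trace_def by blast
    also have "\<dots> \<le> \<bar>M\<bar> * norm y" by (simp add: mult_right_mono)
    finally show ?thesis .
  qed
  then show ?thesis using that[of "\<bar>M\<bar>"] by simp
qed

lemma pos_part_upper:
  assumes a: "a \<in> P" "pos a" and y: "pos y" "y \<preceq> a" shows "re_trace y \<le> pos_part a"
  unfolding pos_part_def
proof (rule cSup_upper)
  obtain M where M: "M \<ge> 0" "\<And>y. pos y \<Longrightarrow> y \<preceq> a \<Longrightarrow> re_trace y \<le> M * norm y" by (rule re_trace_bound[OF a(1)]) blast
  show "bdd_above (re_trace ` {y. pos y \<and> y \<preceq> a})"
  proof (intro bdd_aboveI2)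
    fix y assume "y \<in> {y. pos y \<and> y \<preceq> a}"
    then have "re_trace y \<le> M * norm y" "norm y \<le> norm a" using M norm_mono by auto
    then show "re_trace y \<le> M * norm a" using M(1) by (meson mult_left_mono order_trans)
  qed
qed (use y in auto)

lemma pos_part_least:
  assumes "pos a" "\<And>y. pos y \<Longrightarrow> y \<preceq> a \<Longrightarrow> re_trace y \<le> B" shows "pos_part a \<le> B"
  unfolding pos_part_def by (rule cSup_least) (use assms in \<open>auto intro: exI[of _ 0]\<close>)

lemma pos_part_nonneg: "a \<in> P \<Longrightarrow> pos a \<Longrightarrow> 0 \<le> pos_part a"
  using pos_part_upper[of a 0] re_trace_scaleR[of 0 0] by (simp add: P_intros)

text \<open>The witness \<open>w\<close> is \<open>(a + \<epsilon>)\<^sup>-\<^sup>1\<^sup>/\<^sup>2\<close>, so that \<open>s w a w s\<close> is close to \<open>s s = y\<close>.\<close>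

lemma re_trace_factor_approx:
  assumes a: "a \<in> P" "pos a" and y: "pos y" "y \<preceq> a" and e: "e > 0"
  obtains w where "cstar w = w" "w * y * w \<preceq> 1"
    "re_trace y \<le> re_trace (pos_sqrt y * w * a * w * pos_sqrt y) + e"
proof -
  obtain M where M: "M \<ge> 0" "\<And>y. pos y \<Longrightarrow> y \<preceq> a \<Longrightarrow> re_trace y \<le> M * norm y" by (rule re_trace_bound[OF a(1)]) blast
  \<comment> \<open>The denominator M + 1 is positive and makes M \<epsilon> at most
    \<open>e\<close>.\<close>
  define \<epsilon> where "\<epsilon> = e / (M + 1)"
  have \<epsilon>: "\<epsilon> > 0" using M e by (simp add: \<epsilon>_def)
  obtain w where w: "pos w" "w * a = a * w" "\<epsilon> *\<^sub>R (w * w) = 1 - w * a * w" "w * a * w \<preceq> 1"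
    by (rule pos_inverse_sqrt[OF a(2) \<epsilon>])
  have sw: "cstar w = w" by (rule pos_selfadjoint[OF w(1)])
  define s where "s = pos_sqrt y"
  have s: "cstar s = s" "s * s = y" by (simp_all add: s_def cstar_pos_sqrt pos_sqrt_mult_self y)
  define z where "z = s * w * a * w * s"
  have "z = cstar (w * s) * a * (w * s)" by (simp add: z_def cstar_mult sw s mult.assoc)
  then have z: "pos z" by (simp add: pos_conj a)
  \<comment> \<open>This is exactly the error y - z, since \<epsilon> w^2 = 1 - w a w.\<close>
  define d where "d = \<epsilon> *\<^sub>R (cstar (w * s) * (w * s))"
  have d: "pos d" unfolding d_def using \<epsilon> by (simp add: pos_scaleR pos_cstar_mult_self)
  have "d = s * (\<epsilon> *\<^sub>R (w * w)) * s" by (simp add: d_def cstar_mult sw s mult.assoc)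
  also have "\<dots> = y - z" unfolding w(3) by (simp add: z_def algebra_simps s)
  finally have yz: "y = z + d" by simp
  have wyw: "w * y * w \<preceq> 1"
    using cle_conj[OF y(2), of w] w(4) by (auto simp: sw intro: cle_trans)
  \<comment> \<open>Exchanging the two factors keeps the norm and turns s w^2 s into w y w, which
    lies below w a w \<le> 1.\<close>
  have "norm (cstar (w * s) * (w * s)) = norm ((w * s) * cstar (w * s))"
    by (simp add: norm_cstar_mult_self norm_mult_cstar_self)
  also have "(w * s) * cstar (w * s) = w * y * w"
    by (simp add: cstar_mult sw s mult.assoc flip: s(2))
  also have "norm \<dots> \<le> 1"
    using wyw pos_conj[OF y(1), of w] norm_le_of_cle[of "w * y * w" 1] by (simp add: sw)
  finally have "norm d \<le> \<epsilon>" using \<epsilon> by (simp add: d_def)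
  moreover have "d \<preceq> y" "z \<preceq> y" using z d by (simp_all add: cle_def yz)
  ultimately have "re_trace d \<le> M * \<epsilon>"
    using M(2)[OF d] cle_trans[OF _ y(2)] M(1) by (meson mult_left_mono order_trans)
  also have "\<dots> \<le> e" using M(1) e by (simp add: \<epsilon>_def field_simps)
  finally have "re_trace d \<le> e" .
  moreover have "re_trace y = re_trace z + re_trace d"
    unfolding yz using ped_hereditary[OF a(1)] d z \<open>d \<preceq> y\<close> \<open>z \<preceq> y\<close> cle_trans[OF _ y(2)] by (intro re_trace_add) auto
  ultimately show ?thesis using that sw wyw by (simp add: z_def s_def)
qed

text \<open>With s the root of \<open>y\<close>, the trace property exchanges the factors s w
  \<open>cstar c\<close> and c w s, both in the ideal. The result c w y w \<open>cstar c\<close>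
  lies below \<open>c * cstar c\<close> and so competes in the supremum.\<close>

lemma re_trace_conj_le_pos_part:
  assumes c: "c \<in> P" and y: "y \<in> P" "pos y" and w: "cstar w = w" "w * y * w \<preceq> 1"
  shows "re_trace (pos_sqrt y * w * (cstar c * c) * w * pos_sqrt y) \<le> pos_part (c * cstar c)"
proof -
  define s where "s = pos_sqrt y"
  have s: "cstar s = s" "s * s = y" "s \<in> P"
    by (simp_all add: s_def cstar_pos_sqrt pos_sqrt_mult_self ped_pos_sqrt y)
  have "s * w * (cstar c * c) * w * s = (s * w * cstar c) * (c * w * s)"
    by (simp add: mult.assoc)
  also have "re_trace \<dots> = re_trace ((c * w * s) * (s * w * cstar c))"
    by (intro re_trace_commute P_intros s)
  also have "(c * w * s) * (s * w * cstar c) = c * (w * y * w) * cstar c"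
    by (simp add: mult.assoc flip: s(2))
  also have "re_trace \<dots> \<le> pos_part (c * cstar c)"
  proof (rule pos_part_upper)
    have conj: "c * x * cstar c = cstar (cstar c) * x * cstar c" for x by (simp add: cstar_cstar)
    show "pos (c * (w * y * w) * cstar c)"
      unfolding conj using pos_conj[OF y(2), of w] by (intro pos_conj) (simp add: w)
    show "c * (w * y * w) * cstar c \<preceq> c * cstar c"
      using cle_conj[OF w(2), of "cstar c"] by (simp add: cstar_cstar)
  qed (simp_all add: pos_mult_cstar_self P_intros c)
  finally show ?thesis by (simp add: s_def)
qed

text \<open>For subadditivity y is replaced by s w (a + b) w s, with s the root of y; this splits
  linearly, and the trace property moves the summands below \<open>a\<close> and \<open>b\<close>.
  For superadditivity one adds competitors for \<open>a\<close> and \<open>b\<close>.\<close>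

lemma pos_part_add:
  assumes a: "a \<in> P" "pos a" and b: "b \<in> P" "pos b"
  shows "pos_part (a + b) = pos_part a + pos_part b"
proof (rule antisym)
  have ab: "a + b \<in> P" "pos (a + b)" using a b by (simp_all add: P_intros pos_add)
  show "pos_part (a + b) \<le> pos_part a + pos_part b"
  proof (rule pos_part_least[OF ab(2)], rule field_le_epsilon)
    fix y e assume y: "pos y" "y \<preceq> a + b" and e: "(0::real) < e"
    obtain w where w: "cstar w = w" "w * y * w \<preceq> 1"
      and le: "re_trace y \<le> re_trace (pos_sqrt y * w * (a + b) * w * pos_sqrt y) + e"
      by (rule re_trace_factor_approx[OF ab y e])
    have yP: "y \<in> P" by (rule ped_hereditary[OF ab(1) y])
    have "re_trace (pos_sqrt y * w * (a + b) * w * pos_sqrt y) =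
        re_trace (pos_sqrt y * w * a * w * pos_sqrt y) + re_trace (pos_sqrt y * w * b * w * pos_sqrt y)"
      using a b by (simp add: distrib_left distrib_right re_trace_add P_intros)
    \<comment> \<open>With c the root of x, both \<open>cstar c * c\<close> and
      \<open>c * cstar c\<close> are x.\<close>
    moreover have *: "re_trace (pos_sqrt y * w * x * w * pos_sqrt y) \<le> pos_part x" if "x \<in> P" "pos x" for x
      using re_trace_conj_le_pos_part[OF ped_pos_sqrt[OF that(2,1)] yP y(1) w]
      by (simp add: cstar_pos_sqrt pos_sqrt_mult_self that)
    ultimately show "re_trace y \<le> pos_part a + pos_part b + e" using le *[OF a] *[OF b] by linarith
  qed
  have "re_trace y + re_trace z \<le> pos_part (a + b)" if "pos y" "y \<preceq> a" "pos z" "z \<preceq> b" for y z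
  proof -
    have "re_trace (y + z) \<le> pos_part (a + b)"
      by (rule pos_part_upper) (use that ab in \<open>auto intro: pos_add cle_add_mono\<close>)
    then show ?thesis using that a b ped_hereditary by (simp add: re_trace_add)
  qed
  then have "pos_part a \<le> pos_part (a + b) - re_trace z" if "pos z" "z \<preceq> b" for z
    using that by (intro pos_part_least a) (simp add: le_diff_eq)
  then have "pos_part b \<le> pos_part (a + b) - pos_part a"
    by (intro pos_part_least b) (simp add: le_diff_eq algebra_simps)
  then show "pos_part a + pos_part b \<le> pos_part (a + b)" by simp
qed

lemma pos_part_scaleR:
  assumes a: "a \<in> P" "pos a" and r: "r \<ge> 0"
  shows "pos_part (r *\<^sub>R a) = r * pos_part a"
proof -
  have le: "r * pos_part a \<le> pos_part (r *\<^sub>R a)" if a: "a \<in> P" "pos a" and r: "r > 0" for r a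
  proof -
    have "pos_part a \<le> pos_part (r *\<^sub>R a) / r"
    proof (rule pos_part_least[OF a(2)])
      fix y assume y: "pos y" "y \<preceq> a"
      then have "re_trace (r *\<^sub>R y) \<le> pos_part (r *\<^sub>R a)"
        using r a by (intro pos_part_upper P_intros pos_scaleR cle_scaleR) auto
      then show "re_trace y \<le> pos_part (r *\<^sub>R a) / r"
        using r ped_hereditary[OF a(1) y] by (simp add: re_trace_scaleR field_simps)
    qed
    then show ?thesis using r by (simp add: field_simps)
  qed
  show ?thesis
  proof (cases "r = 0")
    case True
    have "pos_part 0 \<le> 0"
    proof (rule pos_part_least)
      fix y :: 'b assume "pos y" "y \<preceq> 0"
      then have "y = 0" by (intro pos_antisym) (simp_all add: cle_def)
      then show "re_trace y \<le> 0" using re_trace_scaleR[of 0 0] by (simp add: P_intros)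
    qed simp
    then show ?thesis using True pos_part_nonneg[of 0] by (simp add: P_intros)
  next
    case False
    then have r: "r > 0" using r by simp
    have "(1/r) * pos_part (r *\<^sub>R a) \<le> pos_part ((1/r) *\<^sub>R (r *\<^sub>R a))"
      by (rule le) (use a r in \<open>auto intro: P_intros pos_scaleR\<close>)
    then have "pos_part (r *\<^sub>R a) \<le> r * pos_part a" using r by (simp add: field_simps)
    then show ?thesis using le[OF a r] by simp
  qed
qed

text \<open>The two estimates behind additivity are used with c = z, so that exchanging factors
  leads from \<open>cstar z * z\<close> to \<open>z * cstar z\<close>. Applied to
  \<open>cstar z\<close> as well, this gives equality.\<close>

lemma pos_part_trace_le:
  assumes z: "z \<in> P" shows "pos_part (cstar z * z) \<le> pos_part (z * cstar z)"
proof (rule pos_part_least[OF pos_cstar_mult_self], rule field_le_epsilon)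
  fix y e assume y: "pos y" "y \<preceq> cstar z * z" and e: "(0::real) < e"
  have zz: "cstar z * z \<in> P" using z by (rule P_intros)
  obtain w where w: "cstar w = w" "w * y * w \<preceq> 1"
    and le: "re_trace y \<le> re_trace (pos_sqrt y * w * (cstar z * z) * w * pos_sqrt y) + e"
    by (rule re_trace_factor_approx[OF zz pos_cstar_mult_self y e])
  show "re_trace y \<le> pos_part (z * cstar z) + e"
    using le re_trace_conj_le_pos_part[OF z ped_hereditary[OF zz y] y(1) w] by simp
qed

theorem jordan_decomposition:
  obtains \<sigma>\<^sub>1 \<sigma>\<^sub>2 where "positive_trace_on P \<sigma>\<^sub>1" "positive_trace_on P \<sigma>\<^sub>2"
    "\<And>x. x \<in> P \<Longrightarrow> \<tau> x = \<sigma>\<^sub>1 x - \<sigma>\<^sub>2 x"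
proof -
  define \<sigma> where "\<sigma> = cone_extension pos_part"
  have lin: "clinear_on P \<sigma>"
    unfolding \<sigma>_def by (rule clinear_cone_extension) (simp_all add: pos_part_add pos_part_scaleR)
  have pos: "\<sigma> a = of_real (pos_part a)" if "a \<in> P" "pos a" for a
    unfolding \<sigma>_def by (rule cone_extension_pos) (simp_all add: pos_part_add pos_part_scaleR that)
  have tr: "tracial_on P \<sigma>"
  proof (rule tracial_onI[OF lin])
    fix z assume z: "z \<in> P"
    have "pos_part (cstar z * z) = pos_part (z * cstar z)"
      using pos_part_trace_le[OF z] pos_part_trace_le[OF cstar_ped[OF z]] by (simp add: cstar_cstar)
    then show "\<sigma> (cstar z * z) = \<sigma> (z * cstar z)"
      using z by (simp add: pos P_intros pos_cstar_mult_self pos_mult_cstar_self)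
  qed
  have "positive_trace_on P \<sigma>"
    using lin tr pos pos_part_nonneg by (auto simp: positive_trace_on_def)
  moreover have "positive_trace_on P (\<lambda>x. \<sigma> x - \<tau> x)"
    unfolding positive_trace_on_def
  proof (intro conjI ballI impI)
    show "clinear_on P (\<lambda>x. \<sigma> x - \<tau> x)"
      using lin linear by (auto simp: clinear_on_def algebra_simps)
    show "tracial_on P (\<lambda>x. \<sigma> x - \<tau> x)"
      using tr tracial by (auto simp: tracial_on_def)
    fix a assume a: "a \<in> P" "pos a"
    \<comment> \<open>A hermitian functional is real on selfadjoint elements. The difference is then
      nonnegative because \<open>a\<close> itself competes in the supremum.\<close>
    have "\<tau> a = of_real (re_trace a)"
      using hermitian[OF a(1)] by (simp add: pos_selfadjoint[OF a(2)] re_trace_def complex_eq_iff)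
    then have "\<sigma> a - \<tau> a = of_real (pos_part a - re_trace a)" by (simp add: pos a)
    moreover have "pos_part a - re_trace a \<ge> 0" using pos_part_upper[OF a a(2)] by simp
    ultimately show "\<sigma> a - \<tau> a \<in> \<real>\<^sub>\<ge>\<^sub>0" by (simp only: nonneg_Reals_of_real_iff)
  qed
  ultimately show ?thesis by (rule that) simp
qed

end


section \<open>The unitization\<close>

text \<open>The norm is the maximum of the operator norm on \<open>A\<close> and the modulus of the scalar; the
  operator norm alone is degenerate if \<open>A\<close> already has a unit.\<close>

datatype 'a unitization = Unitization (elt: 'a) (scal: complex)

instantiation unitization :: (c_star_algebra) real_algebra_1
begin

definition "0 = Unitization 0 0"
definition "1 = Unitization 0 1"
definition "x + y = Unitization (elt x + elt y) (scal x + scal y)"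
definition "x - y = Unitization (elt x - elt y) (scal x - scal y)"
definition "- x = Unitization (- elt x) (- scal x)"
definition "r *\<^sub>R x = Unitization (r *\<^sub>R elt x) (of_real r * scal x)"
definition "x * y =
  Unitization (elt x * elt y + scal x *\<^sub>C elt y + scal y *\<^sub>C elt x) (scal x * scal y)"

lemmas unitization_defs = zero_unitization_def one_unitization_def plus_unitization_def
  minus_unitization_def uminus_unitization_def scaleR_unitization_def times_unitization_def

instance
  by standard
    (auto simp: unitization_defs algebra_simps scaleC_add_left scaleC_add_right scaleC_scaleC
      mult_scaleC_left mult_scaleC_right scaleR_scaleC)

end

lemma unitization_sel [simp]:
  fixes x y :: "'a::c_star_algebra unitization"
  shows "elt 0 = (0::'a)" "elt 1 = (0::'a)" "elt (x + y) = elt x + elt y" "elt (x - y) = elt x - elt y"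
    "elt (- x) = - elt x" "elt (r *\<^sub>R x) = r *\<^sub>R elt x"
    "elt (x * y) = elt x * elt y + scal x *\<^sub>C elt y + scal y *\<^sub>C elt x"
    "scal (0::'a unitization) = 0" "scal (1::'a unitization) = 1" "scal (x + y) = scal x + scal y"
    "scal (x - y) = scal x - scal y" "scal (- x) = - scal x" "scal (r *\<^sub>R x) = of_real r * scal x"
    "scal (x * y) = scal x * scal y"
  by (simp_all add: unitization_defs)

section \<open>Left multiplication operators and the norm of the unitization\<close>

definition unitization_op :: "'a::c_star_algebra unitization \<Rightarrow> 'a \<Rightarrow> 'a" where
  "unitization_op z x = elt z * x + scal z *\<^sub>C x"

lemma bounded_linear_scaleC: "bounded_linear (\<lambda>x. c *\<^sub>C (x::'a::c_star_algebra))"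
  by (rule bounded_linear_intro[where K = "cmod c"])
    (auto simp: scaleC_add_right scaleC_scaleR norm_scaleC mult.commute)

lemma bounded_linear_unitization_op: "bounded_linear (unitization_op z)"
  unfolding unitization_op_def
  by (intro bounded_linear_add bounded_linear_mult_right bounded_linear_scaleC)

lemma norm_unitization_op: "norm (unitization_op z x) \<le> onorm (unitization_op z) * norm x"
  by (rule onorm[OF bounded_linear_unitization_op])

lemma unitization_op_mult: "unitization_op (y * z) = unitization_op y \<circ> unitization_op z"
  by (auto simp: unitization_op_def fun_eq_iff algebra_simps scaleC_add_right scaleC_scaleC
      mult_scaleC_left mult_scaleC_right)

lemma onorm_scaleC: "onorm (\<lambda>x. c *\<^sub>C unitization_op z x) = cmod c * onorm (unitization_op z)"
proof (rule antisym)
  show "onorm (\<lambda>x. c *\<^sub>C unitization_op z x) \<le> cmod c * onorm (unitization_op z)"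
    using norm_unitization_op[of z]
    by (intro onorm_bound mult_nonneg_nonneg onorm_pos_le bounded_linear_unitization_op)
      (auto simp: norm_scaleC mult.assoc mult_left_mono)
  show "cmod c * onorm (unitization_op z) \<le> onorm (\<lambda>x. c *\<^sub>C unitization_op z x)"
  proof (cases "c = 0")
    case False
    have bl: "bounded_linear (\<lambda>x. c *\<^sub>C unitization_op z x)"
      by (rule bounded_linear_compose[OF bounded_linear_scaleC bounded_linear_unitization_op])
    have "onorm (unitization_op z) \<le> onorm (\<lambda>x. c *\<^sub>C unitization_op z x) / cmod c"
      using onorm[OF bl] False
      by (intro onorm_bound divide_nonneg_pos onorm_pos_le[OF bl])
        (auto simp: norm_scaleC field_simps)
    then show ?thesis using False by (simp add: field_simps)
  qed (simp add: onorm_pos_le bounded_linear_zero)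
qed

instantiation unitization :: (c_star_algebra) real_normed_algebra_1
begin

definition "norm z = max (onorm (unitization_op z)) (cmod (scal z))"
definition "sgn z = z /\<^sub>R norm (z :: 'a unitization)"
definition "dist y z = norm (y - z :: 'a unitization)"
definition [code del]: "(uniformity :: ('a unitization \<times> 'a unitization) filter) =
  (INF e\<in>{0 <..}. principal {(x, y). dist x y < e})"
definition [code del]: "open U \<longleftrightarrow>
  (\<forall>x\<in>U. eventually (\<lambda>(x', y). x' = x \<longrightarrow> y \<in> U) (uniformity :: ('a unitization \<times> _) filter))"

instance
proof
  fix x y :: "'a unitization" and r :: real
  show "norm x = 0 \<longleftrightarrow> x = 0"
  proof
    assume "norm x = 0"
    then have s: "scal x = 0" and o: "onorm (unitization_op x) = 0"
      using onorm_pos_le[OF bounded_linear_unitization_op[of x]]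
      by (auto simp: norm_unitization_def max_def split: if_splits)
    \<comment> \<open>With scalar part 0, evaluation at the adjoint gives the element times its
      adjoint, whose norm is the square of its norm.\<close>
    have "unitization_op x (cstar (elt x)) = 0" using norm_unitization_op[of x] o by simp
    then have "elt x = 0" using s norm_mult_cstar_self[of "elt x"] by (simp add: unitization_op_def)
    then show "x = 0" using s by (simp add: unitization.expand)
  next
    have "unitization_op 0 = (\<lambda>x::'a. 0)" by (simp add: unitization_op_def fun_eq_iff)
    then show "norm x = 0" if "x = 0" using that by (simp add: norm_unitization_def onorm_zero)
  qed
  show "norm (x + y) \<le> norm x + norm y"
  proof -
    have "unitization_op (x + y) = (\<lambda>z. unitization_op x z + unitization_op y z)"
      by (simp add: unitization_op_def fun_eq_iff algebra_simps scaleC_add_left)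
    then have "onorm (unitization_op (x + y)) \<le> onorm (unitization_op x) + onorm (unitization_op y)"
      by (simp add: onorm_triangle bounded_linear_unitization_op)
    moreover have "cmod (scal (x + y)) \<le> cmod (scal x) + cmod (scal y)"
      by (simp add: norm_triangle_ineq)
    ultimately show ?thesis by (auto simp: norm_unitization_def max_def)
  qed
  show "norm (r *\<^sub>R x) = \<bar>r\<bar> * norm x"
  proof -
    have "unitization_op (r *\<^sub>R x) = (\<lambda>z. of_real r *\<^sub>C unitization_op x z)"
      by (simp add: unitization_op_def fun_eq_iff scaleR_scaleC scaleC_add_right scaleC_scaleC mult_scaleC_left)
    then have "onorm (unitization_op (r *\<^sub>R x)) = \<bar>r\<bar> * onorm (unitization_op x)"
      by (simp add: onorm_scaleC)
    then show ?thesis by (simp add: norm_unitization_def norm_mult max_mult_distrib_left)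
  qed
  show "norm (x * y) \<le> norm x * norm y"
  proof -
    have "onorm (unitization_op (x * y)) \<le> onorm (unitization_op x) * onorm (unitization_op y)"
      unfolding unitization_op_mult by (intro onorm_compose bounded_linear_unitization_op)
    also have "\<dots> \<le> norm x * norm y"
      by (intro mult_mono onorm_pos_le bounded_linear_unitization_op)
        (auto simp: norm_unitization_def intro: max.coboundedI2)
    finally have "onorm (unitization_op (x * y)) \<le> norm x * norm y" .
    moreover have "cmod (scal (x * y)) \<le> norm x * norm y"
      by (auto simp: norm_unitization_def norm_mult intro!: mult_mono max.coboundedI2)
    ultimately show ?thesis by (simp add: norm_unitization_def)
  qed
  show "norm (1::'a unitization) = 1"
  proof -
    have "onorm (unitization_op (1::'a unitization)) \<le> 1"
      by (rule onorm_bound) (simp_all add: unitization_op_def)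
    then show ?thesis by (simp add: norm_unitization_def)
  qed
qed (auto simp: sgn_unitization_def dist_unitization_def uniformity_unitization_def open_unitization_def)

end

lemma cmod_scal_le: "cmod (scal z) \<le> norm z"
  by (simp add: norm_unitization_def)

definition unitization_embed :: "'a::c_star_algebra \<Rightarrow> 'a unitization" where
  "unitization_embed a = Unitization a 0"

lemma unitization_embed_sel [simp]: "elt (unitization_embed a) = a" "scal (unitization_embed a) = 0"
  by (simp_all add: unitization_embed_def)

text \<open>By the C*-identity, left multiplication by \<open>a\<close> attains the factor
  \<open>norm a\<close> at \<open>cstar a\<close>.\<close>

lemma norm_unitization_embed [simp]: "norm (unitization_embed a) = norm a"
proof -
  have op: "unitization_op (unitization_embed a) = (\<lambda>x. a * x)"
    by (simp add: unitization_op_def fun_eq_iff)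
  have "onorm (\<lambda>x. a * x) \<le> norm a"
    by (rule onorm_bound) (simp_all add: norm_mult_ineq)
  moreover have "norm a \<le> onorm (\<lambda>x. a * x)"
  proof (cases "a = 0")
    case False
    have "norm a * norm a \<le> onorm (\<lambda>x. a * x) * norm a"
      using onorm[OF bounded_linear_mult_right, of a "cstar a"]
      by (simp add: norm_mult_cstar_self power2_eq_square)
    then show ?thesis using False by simp
  qed (simp add: onorm_zero)
  ultimately show ?thesis
    by (simp add: norm_unitization_def op onorm_pos_le bounded_linear_mult_right)
qed

text \<open>One \<open>norm z\<close> pays for \<open>z\<close>, the other for its scalar part.
  Continuity of both coordinates yields completeness.\<close>

lemma norm_elt_le: "norm (elt z) \<le> 2 * norm z"
proof -
  have "unitization_embed (elt z) = z - Unitization 0 (scal z)"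
    by (simp add: unitization.expand)
  then have "norm (elt z) \<le> norm z + norm (Unitization (0::'a) (scal z))"
    by (metis norm_unitization_embed norm_triangle_ineq4)
  moreover have "onorm (unitization_op (Unitization (0::'a) c)) \<le> cmod c" for c
    by (rule onorm_bound) (simp_all add: unitization_op_def norm_scaleC)
  then have "norm (Unitization (0::'a) (scal z)) \<le> cmod (scal z)"
    by (simp add: norm_unitization_def)
  ultimately show ?thesis using cmod_scal_le[of z] by simp
qed

lemma bounded_linear_scal: "bounded_linear (scal :: 'a::c_star_algebra unitization \<Rightarrow> complex)"
  by (rule bounded_linear_intro[where K = 1]) (auto simp: cmod_scal_le scaleR_conv_of_real[where 'a = complex])

lemma bounded_linear_elt: "bounded_linear (elt :: 'a::c_star_algebra unitization \<Rightarrow> 'a)"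
  by (rule bounded_linear_intro[where K = 2]) (use norm_elt_le in \<open>auto simp: mult.commute\<close>)

lemma bounded_linear_unitization_embed:
  "bounded_linear (unitization_embed :: 'a::c_star_algebra \<Rightarrow> 'a unitization)"
  by (rule bounded_linear_intro[where K = 1]) (auto simp: unitization.expand)

instance unitization :: (c_star_algebra) banach
proof
  fix X :: "nat \<Rightarrow> 'a unitization" assume X: "Cauchy X"
  obtain a where a: "(\<lambda>n. elt (X n)) \<longlonglongrightarrow> a"
    using bounded_linear.Cauchy[OF bounded_linear_elt X] Cauchy_convergent_iff convergent_def by blast
  obtain c where c: "(\<lambda>n. scal (X n)) \<longlonglongrightarrow> c"
    using bounded_linear.Cauchy[OF bounded_linear_scal X] Cauchy_convergent_iff convergent_def by blast
  \<comment> \<open>Complex scaling is not yet defined on the unitization, so scalars are written in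
    the real basis \<open>1\<close>, \<open>Unitization 0 \<i>\<close>.\<close>
  have sc: "Unitization (0::'a) c = Re c *\<^sub>R 1 + Im c *\<^sub>R Unitization 0 \<i>" for c
    by (rule unitization.expand) (simp add: complex_eq_iff)
  have "X n = unitization_embed (elt (X n)) + (Re (scal (X n)) *\<^sub>R 1 + Im (scal (X n)) *\<^sub>R Unitization 0 \<i>)" for n
    by (rule unitization.expand) (simp add: complex_eq_iff)
  then have "X \<longlonglongrightarrow> unitization_embed a + (Re c *\<^sub>R 1 + Im c *\<^sub>R Unitization 0 \<i>)"
    by (rule ssubst[OF ext])
      (intro tendsto_intros a c bounded_linear.tendsto[OF bounded_linear_unitization_embed])
  then show "convergent X" by (rule convergentI)
qed

instantiation unitization :: (c_star_algebra) c_star_algebra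
begin

definition "c *\<^sub>C z = Unitization (c *\<^sub>C elt z) (c * scal z)"
definition "cstar z = Unitization (cstar (elt z)) (cnj (scal z))"

lemma unitization_star_sel [simp]:
  "elt (c *\<^sub>C z :: 'a unitization) = c *\<^sub>C elt z" "scal (c *\<^sub>C z :: 'a unitization) = c * scal z"
  "elt (cstar z :: 'a unitization) = cstar (elt z)" "scal (cstar z :: 'a unitization) = cnj (scal z)"
  by (simp_all add: scaleC_unitization_def cstar_unitization_def)

instance
proof
  fix c d :: complex and x y z :: "'a unitization" and r :: real
  show "c *\<^sub>C (x + y) = c *\<^sub>C x + c *\<^sub>C y" "(c + d) *\<^sub>C x = c *\<^sub>C x + d *\<^sub>C x"
    "c *\<^sub>C d *\<^sub>C x = (c * d) *\<^sub>C x" "r *\<^sub>R x = complex_of_real r *\<^sub>C x"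
    "c *\<^sub>C x * y = c *\<^sub>C (x * y)" "x * c *\<^sub>C y = c *\<^sub>C (x * y)"
    "cstar (cstar x) = x" "cstar (x + y) = cstar x + cstar y" "cstar (c *\<^sub>C x) = cnj c *\<^sub>C cstar x"
    by (auto intro!: unitization.expand simp: algebra_simps scaleC_add_left scaleC_add_right
        scaleC_scaleC mult_scaleC_left mult_scaleC_right scaleR_scaleC cstar_cstar cstar_add cstar_scaleC)
  show "cstar (x * y) = cstar y * cstar x" for x y :: "'a unitization"
    by (auto intro!: unitization.expand simp: algebra_simps cstar_add cstar_scaleC cstar_mult)
  show "norm (c *\<^sub>C x) = cmod c * norm x"
  proof -
    have "unitization_op (c *\<^sub>C x) = (\<lambda>z. c *\<^sub>C unitization_op x z)"
      by (simp add: unitization_op_def fun_eq_iff scaleC_add_right scaleC_scaleC mult_scaleC_left)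
    then show ?thesis
      by (simp add: norm_unitization_def norm_mult max_mult_distrib_left onorm_scaleC)
  qed
  \<comment> \<open>This inequality suffices: it makes \<open>cstar\<close> isometric, and
    submultiplicativity gives the reverse one. For the operator norm it follows from the C*-identity
    applied to the vectors z v.\<close>
  have sq: "(norm z)\<^sup>2 \<le> norm (cstar z * z)" for z :: "'a unitization"
  proof -
    have "norm (unitization_op z v) \<le> sqrt (onorm (unitization_op (cstar z * z))) * norm v" for v
    proof -
      have "cstar v * unitization_op (cstar z * z) v = cstar (unitization_op z v) * unitization_op z v"
        unfolding unitization_op_mult
        by (simp add: unitization_op_def cstar_add cstar_mult cstar_scaleC algebra_simps
            mult_scaleC_left mult_scaleC_right scaleC_scaleC scaleC_add_right)
      then have "(norm (unitization_op z v))\<^sup>2 = norm (cstar v * unitization_op (cstar z * z) v)"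
        by (simp add: norm_cstar_mult_self)
      also have "\<dots> \<le> norm v * (onorm (unitization_op (cstar z * z)) * norm v)"
        by (rule order_trans[OF norm_mult_ineq])
          (simp add: mult_left_mono norm_unitization_op)
      finally have "(norm (unitization_op z v))\<^sup>2 \<le> (sqrt (onorm (unitization_op (cstar z * z))) * norm v)\<^sup>2"
        using onorm_pos_le[OF bounded_linear_unitization_op[of "cstar z * z"]]
        by (simp add: power_mult_distrib power2_eq_square ac_simps)
      then show ?thesis
        by (rule power2_le_imp_le)
          (simp add: onorm_pos_le bounded_linear_unitization_op)
    qed
    then have "onorm (unitization_op z) \<le> sqrt (onorm (unitization_op (cstar z * z)))"
      by (intro onorm_bound) (simp_all add: onorm_pos_le bounded_linear_unitization_op)
    then have "(onorm (unitization_op z))\<^sup>2 \<le> (sqrt (onorm (unitization_op (cstar z * z))))\<^sup>2"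
      by (rule power_mono) (simp add: onorm_pos_le bounded_linear_unitization_op)
    then have "(onorm (unitization_op z))\<^sup>2 \<le> norm (cstar z * z)"
      by (simp add: onorm_pos_le bounded_linear_unitization_op norm_unitization_def)
    moreover have "(cmod (scal z))\<^sup>2 \<le> norm (cstar z * z)"
      using cmod_scal_le[of "cstar z * z"] by (simp add: norm_mult power2_eq_square)
    ultimately show ?thesis by (auto simp: norm_unitization_def[of z] max_def)
  qed
  have le: "norm z \<le> norm (cstar z)" for z :: "'a unitization"
  proof (cases "z = 0")
    case False
    have "norm z * norm z \<le> norm (cstar z) * norm z"
      using sq[of z] norm_mult_ineq[of "cstar z" z] by (simp add: power2_eq_square)
    with False show ?thesis by simp
  qed simp
  have "cstar (cstar z) = z" for z :: "'a unitization"
    by (rule unitization.expand) (simp add: cstar_cstar)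
  then have "norm (cstar x) = norm x" using le[of x] le[of "cstar x"] by simp
  then show "norm (cstar x * x) = (norm x)\<^sup>2"
    using sq[of x] norm_mult_ineq[of "cstar x" x] by (simp add: power2_eq_square)
qed

end

lemma unitization_embed_simps:
  "unitization_embed (x + y) = unitization_embed x + unitization_embed y"
  "unitization_embed (x - y) = unitization_embed x - unitization_embed y"
  "unitization_embed (x * y) = unitization_embed x * unitization_embed y"
  "unitization_embed (c *\<^sub>C x) = c *\<^sub>C unitization_embed x"
  "unitization_embed (r *\<^sub>R x) = r *\<^sub>R unitization_embed x"
  "unitization_embed (cstar x) = cstar (unitization_embed x)"
  "unitization_embed 0 = (0::'a::c_star_algebra unitization)"
  by (auto intro!: unitization.expand)

lemma unitization_embed_eq_iff [simp]: "unitization_embed x = unitization_embed y \<longleftrightarrow> x = y"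
  by (simp add: unitization_embed_def)

lemma range_unitization_embed: "range unitization_embed = {z. scal z = 0}"
  by (auto intro!: image_eqI[of z unitization_embed "elt z" for z] unitization.expand)


subsection \<open>The Pedersen ideal inside the unitization\<close>

abbreviation "unitization_ped \<equiv> ped_ideal (range (unitization_embed :: 'a::c_star_algebra \<Rightarrow> _))"

interpretation unitization: closed_star_ideal "range (unitization_embed :: 'a::c_star_algebra \<Rightarrow> 'a unitization)"
proof
  have "range unitization_embed = scal -` {0}" by (auto simp: range_unitization_embed)
  moreover have "closed (scal -` {0} :: 'a unitization set)"
    by (intro continuous_closed_vimage) (simp_all add: linear_continuous_at bounded_linear_scal)
  ultimately show "closed (range (unitization_embed :: 'a \<Rightarrow> 'a unitization))" by metis
qed (auto simp: range_unitization_embed ideal_of_def)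

lemma unitization_mult_embed:
  "z * unitization_embed x = unitization_embed (elt z * x + scal z *\<^sub>C x)"
  "unitization_embed x * z = unitization_embed (x * elt z + scal z *\<^sub>C x)"
  by (auto intro!: unitization.expand)

lemma dense_ideal_vimage_ped: "dense_ideal (unitization_embed -` unitization_ped)"
proof -
  have "x \<in> closure (unitization_embed -` unitization_ped)" for x :: 'a
    unfolding closure_approachable
  proof (intro allI impI)
    fix e :: real assume "e > 0"
    then obtain y where y: "y \<in> unitization_ped" "norm (unitization_embed x - y) < e"
      using unitization.ped_dense[of "unitization_embed x" e] by blast
    then obtain y' where y': "y = unitization_embed y'" using unitization.ped_subset by blast
    have "norm (x - y') < e" using y(2) by (simp add: y' flip: unitization_embed_simps)
    then show "\<exists>y\<in>unitization_embed -` unitization_ped. dist y x < e"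
      using y(1) y' by (auto simp: dist_norm norm_minus_commute)
  qed
  then show ?thesis
    unfolding dense_ideal_def two_sided_ideal_def csubspace_def
    by (auto simp: unitization_embed_simps intro: unitization.P_intros)
qed

text \<open>A product with an element of the unitization is a product in A plus a scalar multiple,
  so an ideal of A remains an ideal in the unitization and \<open>ped_minimal\<close>
  applies.\<close>

lemma vimage_ped_subset:
  assumes I: "dense_ideal I" shows "unitization_embed -` unitization_ped \<subseteq> I"
proof -
  have "unitization_ped \<subseteq> unitization_embed ` I"
  proof (rule unitization.ped_minimal)
    have cs: "csubspace I" and id: "\<And>a x. x \<in> I \<Longrightarrow> a * x \<in> I \<and> x * a \<in> I"
      using I by (auto simp: dense_ideal_def two_sided_ideal_def)
    show "ideal_of (unitization_embed ` I)"
      unfolding ideal_of_def using cs id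
      by (auto simp: csubspace_def unitization_mult_embed simp flip: unitization_embed_simps
          intro!: imageI intro: image_eqI[of _ _ 0])
    fix x :: "'a unitization" and e :: real
    assume "x \<in> range unitization_embed" "e > 0"
    then obtain a where a: "x = unitization_embed a" by blast
    have "a \<in> closure I" using I by (simp add: dense_ideal_def)
    then obtain y where "y \<in> I" "dist y a < e" using \<open>e > 0\<close> unfolding closure_approachable by blast
    then show "\<exists>y\<in>unitization_embed ` I. norm (x - y) < e"
      by (auto simp: a dist_norm norm_minus_commute simp flip: unitization_embed_simps)
  qed
  then show ?thesis by auto
qed

text \<open>The preimage is a dense ideal contained in every dense ideal. Being least, it is the
  only minimal one, so the definite description is proper.\<close>

theorem Ped_eq: "Ped = unitization_embed -` unitization_ped"
  unfolding Ped_def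
proof (rule the_equality)
  show "dense_ideal (unitization_embed -` unitization_ped) \<and>
      (\<forall>J. dense_ideal J \<and> J \<subseteq> unitization_embed -` unitization_ped \<longrightarrow> J = unitization_embed -` unitization_ped)"
    using dense_ideal_vimage_ped vimage_ped_subset by (meson subset_antisym)
  fix I :: "'a set"
  assume "dense_ideal I \<and> (\<forall>J. dense_ideal J \<and> J \<subseteq> I \<longrightarrow> J = I)"
  then show "I = unitization_embed -` unitization_ped"
    using dense_ideal_vimage_ped vimage_ped_subset by metis
qed

lemma embed_in_ped_iff: "unitization_embed x \<in> unitization_ped \<longleftrightarrow> x \<in> Ped"
  by (simp add: Ped_eq)

lemma unitization_ped_eq: "unitization_ped = unitization_embed ` Ped"
  using unitization.ped_subset by (auto simp: embed_in_ped_iff)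

lemma csubspace_Ped: "csubspace (Ped :: 'a::c_star_algebra set)"
proof -
  have "dense_ideal (Ped :: 'a set)" unfolding Ped_eq by (rule dense_ideal_vimage_ped)
  then show ?thesis by (simp add: dense_ideal_def two_sided_ideal_def)
qed

lemma Ped_intros:
  fixes x y :: "'a::c_star_algebra"
  shows "(0::'a) \<in> Ped" "x \<in> Ped \<Longrightarrow> y \<in> Ped \<Longrightarrow> x + y \<in> Ped" "x \<in> Ped \<Longrightarrow> y \<in> Ped \<Longrightarrow> x - y \<in> Ped"
  "x \<in> Ped \<Longrightarrow> c *\<^sub>C x \<in> Ped" "x \<in> Ped \<Longrightarrow> r *\<^sub>R x \<in> Ped" "x \<in> Ped \<Longrightarrow> cstar x \<in> Ped"
  using csubspace_Ped[where 'a = 'a] csubspace_diff[OF csubspace_Ped] csubspace_scaleR[OF csubspace_Ped]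
    unitization.cstar_ped[of "unitization_embed x"]
  by (auto simp: csubspace_def embed_in_ped_iff simp flip: unitization_embed_simps)

text \<open>The root of an embedded positive element lies in the embedded algebra, so it comes from
  A and witnesses positivity there.\<close>

lemma positive_cone_iff: "x \<in> positive_cone \<longleftrightarrow> pos (unitization_embed x)"
proof
  assume "x \<in> positive_cone"
  then show "pos (unitization_embed x)"
    by (auto simp: positive_cone_def unitization_embed_simps pos_cstar_mult_self)
next
  assume p: "pos (unitization_embed x)"
  have "pos_sqrt (unitization_embed x) \<in> range unitization_embed"
    by (rule pos_sqrt_in_subalgebra[OF unitization.c_star_subalgebra_J p]) simp
  then obtain s where s: "pos_sqrt (unitization_embed x) = unitization_embed s" by blast
  have "unitization_embed x = unitization_embed (cstar s * s)"
    using pos_sqrt_mult_self[OF p] cstar_pos_sqrt[OF p] by (simp add: unitization_embed_simps s)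
  then have "x = cstar s * s" by simp
  then show "x \<in> positive_cone" by (auto simp: positive_cone_def)
qed

lemma positive_trace_on_unitization:
  assumes "positive_trace_on unitization_ped \<sigma>"
  shows "positive_trace_on_Ped (\<sigma> \<circ> unitization_embed)"
  using assms unfolding positive_trace_on_Ped_def positive_trace_on_def linear_functional_on_Ped_def
    tracial_on_Ped_def positive_on_Ped_def clinear_on_def tracial_on_def
  by (auto simp: unitization_embed_simps embed_in_ped_iff positive_cone_iff)

lemma linear_functional_onD:
  assumes "linear_functional_on_Ped \<tau>"
  shows "x \<in> Ped \<Longrightarrow> y \<in> Ped \<Longrightarrow> \<tau> (x + y) = \<tau> x + \<tau> y" "x \<in> Ped \<Longrightarrow> \<tau> (c *\<^sub>C x) = c * \<tau> x"
    "x \<in> Ped \<Longrightarrow> \<tau> (r *\<^sub>R x) = r * \<tau> x" "x \<in> Ped \<Longrightarrow> y \<in> Ped \<Longrightarrow> \<tau> (x - y) = \<tau> x - \<tau> y" "\<tau> 0 = 0"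
proof -
  show add: "x \<in> Ped \<Longrightarrow> y \<in> Ped \<Longrightarrow> \<tau> (x + y) = \<tau> x + \<tau> y" and sc: "x \<in> Ped \<Longrightarrow> \<tau> (c *\<^sub>C x) = c * \<tau> x" for x y c
    using assms by (auto simp: linear_functional_on_Ped_def)
  show "x \<in> Ped \<Longrightarrow> \<tau> (r *\<^sub>R x) = r * \<tau> x" by (simp add: scaleR_scaleC sc)
  show "\<tau> (x - y) = \<tau> x - \<tau> y" if "x \<in> Ped" "y \<in> Ped"
    using add[of x "(-1) *\<^sub>C y"] sc[of y "-1"] that Ped_intros(4)[of y "-1"]
    by (simp add: scaleC_minus_one)
  show "\<tau> 0 = 0" using sc[of 0 0] by (simp add: Ped_intros)
qed


section \<open>Continuity on the Pedersen ideal\<close>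

lemma direct_limit_nhd_Ped:
  "direct_limit_nhd Ped {D. c_star_subalgebra D \<and> D \<subseteq> Ped} Ped"
proof -
  have "convex Ped"
    by (intro convexI Ped_intros)
  then show ?thesis
    unfolding direct_limit_nhd_def by (auto simp: Int_absorb1 intro: Ped_intros)
qed

lemma topspace_Ped_topology [simp]: "topspace Ped_topology = Ped"
proof
  show "topspace Ped_topology \<subseteq> Ped"
    using openin_topspace[of Ped_topology] unfolding Ped_topology_def openin_direct_limit_topology by blast
  have "openin Ped_topology Ped"
    unfolding Ped_topology_def openin_direct_limit_topology
    by (auto intro!: exI[of _ Ped] direct_limit_nhd_Ped intro: Ped_intros)
  then show "Ped \<subseteq> topspace Ped_topology" by (rule openin_subset)
qed

text \<open>A neighbourhood where \<tau> has modulus below 1 meets \<open>D\<close> in a set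
  containing a ball of some radius e. Rescaling vectors to norm e / 2, inside the open ball, gives
  the bound 2 / e.\<close>

lemma continuous_Ped_imp_bounded:
  assumes lin: "linear_functional_on_Ped \<tau>" and cont: "continuous_map Ped_topology euclidean \<tau>"
    and D: "c_star_subalgebra D" "D \<subseteq> Ped"
  shows "\<exists>M. \<forall>x\<in>D. cmod (\<tau> x) \<le> M * norm x"
proof -
  note lin = linear_functional_onD[OF lin]
  have D0: "0 \<in> D" and DR: "\<And>r x. x \<in> D \<Longrightarrow> r *\<^sub>R x \<in> D"
    using D csubspace_scaleR[of D] by (auto simp: c_star_subalgebra_def csubspace_def)
  have "openin Ped_topology {x \<in> topspace Ped_topology. \<tau> x \<in> ball 0 1}"
    by (rule openin_continuous_map_preimage[OF cont]) simp
  moreover have "0 \<in> {x \<in> topspace Ped_topology. \<tau> x \<in> ball 0 1}"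
    using lin D D0 by auto
  ultimately obtain N where N: "direct_limit_nhd Ped {D. c_star_subalgebra D \<and> D \<subseteq> Ped} N"
    "(+) 0 ` N \<subseteq> {x \<in> topspace Ped_topology. \<tau> x \<in> ball 0 1}"
    unfolding Ped_topology_def openin_direct_limit_topology by blast
  have "openin (top_of_set D) (N \<inter> D)" "0 \<in> N \<inter> D"
    using N(1) D D0 by (auto simp: direct_limit_nhd_def)
  then obtain e where e: "e > 0" "\<And>x. x \<in> D \<Longrightarrow> dist x 0 < e \<Longrightarrow> x \<in> N"
    unfolding openin_euclidean_subtopology_iff by blast
  have "cmod (\<tau> x) \<le> (2 / e) * norm x" if x: "x \<in> D" for x
  proof (cases "x = 0")
    case False
    define r where "r = e / (2 * norm x)"
    have r: "r > 0" using e False by (simp add: r_def)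
    have "norm (r *\<^sub>R x) < e" using e False by (simp add: r_def)
    then have "r *\<^sub>R x \<in> N" using e(2)[OF DR[OF x]] by simp
    then have "cmod (\<tau> (r *\<^sub>R x)) < 1" using N(2) by force
    then have "r * cmod (\<tau> x) < 1" using x D r by (simp add: lin subset_iff norm_mult)
    then show ?thesis using e False by (simp add: r_def field_simps)
  qed (simp add: lin)
  then show ?thesis by blast
qed

text \<open>The sets where \<tau> has modulus below e are themselves basic neighbourhoods of 0,
  since \<tau> is Lipschitz on each subalgebra. Linearity carries this to other points.\<close>

lemma bounded_imp_continuous_Ped:
  assumes lin: "linear_functional_on_Ped \<tau>"
    and bdd: "\<And>D. c_star_subalgebra D \<Longrightarrow> D \<subseteq> Ped \<Longrightarrow> \<exists>M. \<forall>x\<in>D. cmod (\<tau> x) \<le> M * norm x"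
  shows "continuous_map Ped_topology euclidean \<tau>"
  unfolding continuous_map_def
proof (intro conjI allI impI)
  note lin = linear_functional_onD[OF lin]
  fix W :: "complex set" assume "openin euclidean W"
  then have W: "open W" by simp
  define nhd where "nhd e = {y \<in> Ped. cmod (\<tau> y) < e}" for e
  have nhd: "direct_limit_nhd Ped {D. c_star_subalgebra D \<and> D \<subseteq> Ped} (nhd e)" if e: "e > 0" for e
    unfolding direct_limit_nhd_def
  proof (intro conjI allI ballI impI)
    show "convex (nhd e)"
    proof (rule convexI)
      fix x y and u v :: real
      assume xy: "x \<in> nhd e" "y \<in> nhd e" and uv: "u \<ge> 0" "v \<ge> 0" "u + v = 1"
      have P: "x \<in> Ped" "y \<in> Ped" "u *\<^sub>R x \<in> Ped" "v *\<^sub>R y \<in> Ped"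
        using xy by (auto simp: nhd_def intro: Ped_intros)
      have "\<tau> (u *\<^sub>R x + v *\<^sub>R y) = u *\<^sub>R \<tau> x + v *\<^sub>R \<tau> y"
        using P by (simp add: lin scaleR_conv_of_real)
      moreover have "u *\<^sub>R \<tau> x + v *\<^sub>R \<tau> y \<in> ball 0 e"
        by (rule convexD[OF convex_ball]) (use xy uv in \<open>auto simp: nhd_def\<close>)
      ultimately show "u *\<^sub>R x + v *\<^sub>R y \<in> nhd e"
        using P by (simp add: nhd_def Ped_intros)
    qed
    show "c *\<^sub>C x \<in> nhd e" if "x \<in> nhd e" "cmod c \<le> 1" for c x
    proof -
      have "cmod c * cmod (\<tau> x) \<le> 1 * cmod (\<tau> x)" using that by (intro mult_right_mono) auto
      then show ?thesis
        using that by (auto simp: nhd_def Ped_intros lin norm_mult)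
    qed
    show "openin (top_of_set D) (nhd e \<inter> D)" if D: "D \<in> {D. c_star_subalgebra D \<and> D \<subseteq> Ped}" for D
    proof -
      obtain M where M: "\<And>x. x \<in> D \<Longrightarrow> cmod (\<tau> x) \<le> M * norm x" using bdd[of D] D by blast
      have cs: "csubspace D" using D by (simp add: c_star_subalgebra_def)
      have "\<bar>M\<bar>-lipschitz_on D \<tau>"
      proof (rule lipschitz_onI)
        fix x y assume xy: "x \<in> D" "y \<in> D"
        have "dist (\<tau> x) (\<tau> y) = cmod (\<tau> (x - y))" using xy D by (simp add: lin dist_norm subset_iff)
        also have "\<dots> \<le> M * norm (x - y)" by (intro M csubspace_diff[OF cs] xy)
        also have "\<dots> \<le> \<bar>M\<bar> * dist x y" by (simp add: dist_norm mult_right_mono)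
        finally show "dist (\<tau> x) (\<tau> y) \<le> \<bar>M\<bar> * dist x y" .
      qed simp
      then have "continuous_on D \<tau>" by (rule lipschitz_on_continuous_on)
      then have "openin (top_of_set D) (D \<inter> \<tau> -` ball 0 e)"
        by (rule continuous_openin_preimage_gen) simp
      moreover have "D \<inter> \<tau> -` ball 0 e = nhd e \<inter> D" using D by (auto simp: nhd_def)
      ultimately show ?thesis by simp
    qed
  qed (use e in \<open>auto simp: nhd_def lin Ped_intros\<close>)
  show "openin Ped_topology {x \<in> topspace Ped_topology. \<tau> x \<in> W}"
    unfolding topspace_Ped_topology unfolding Ped_topology_def openin_direct_limit_topology
  proof (intro conjI ballI)
    fix x assume x: "x \<in> {x \<in> Ped. \<tau> x \<in> W}"
    then have "\<tau> x \<in> W" by simp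
    then obtain e where e: "e > 0" "ball (\<tau> x) e \<subseteq> W" using openE[OF W] by blast
    have "(+) x ` nhd e \<subseteq> {x \<in> Ped. \<tau> x \<in> W}"
    proof clarify
      fix y assume y: "y \<in> nhd e"
      then have "\<tau> (x + y) \<in> ball (\<tau> x) e" using x by (simp add: nhd_def lin dist_norm)
      then show "x + y \<in> Ped \<and> \<tau> (x + y) \<in> W"
        using e y x by (auto simp: nhd_def intro: Ped_intros)
    qed
    then show "\<exists>N. direct_limit_nhd Ped {D. c_star_subalgebra D \<and> D \<subseteq> Ped} N \<and>
        (+) x ` N \<subseteq> {x \<in> Ped. \<tau> x \<in> W}"
      using nhd[OF e(1)] by blast
  qed auto
qed simp


section \<open>Positive traces are bounded on C*-subalgebras\<close>

lemma c_star_subalgebra_embed: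
  assumes "c_star_subalgebra D"
  shows "c_star_subalgebra (unitization_embed ` D)"
proof -
  have *: "unitization_embed ` D = scal -` {0} \<inter> elt -` D"
    by (auto intro!: image_eqI[of z unitization_embed "elt z" for z] unitization.expand)
  have "closed (unitization_embed ` D)"
    unfolding * using assms
    by (intro closed_Int continuous_closed_vimage)
      (simp_all add: c_star_subalgebra_def linear_continuous_at bounded_linear_scal bounded_linear_elt)
  then show ?thesis
    using assms by (auto simp: c_star_subalgebra_def csubspace_def simp flip: unitization_embed_simps)
qed

lemma c_star_subalgebra_vimage:
  assumes "c_star_subalgebra D"
  shows "c_star_subalgebra (unitization_embed -` D)"
proof -
  have "closed (unitization_embed -` D)"
    using assms by (intro continuous_closed_vimage)
      (simp_all add: c_star_subalgebra_def linear_continuous_at bounded_linear_unitization_embed)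
  then show ?thesis
    using assms by (auto simp: c_star_subalgebra_def csubspace_def unitization_embed_simps)
qed

text \<open>If \<open>\<sigma> a\<^sub>n \<ge> 4\<^sup>n\<close> for positive \<open>a\<^sub>n\<close> in the unit ball of \<open>D\<close>, then \<open>a = \<Sum> 2\<^sup>-\<^sup>n a\<^sub>n\<close> dominates each
  \<open>2\<^sup>-\<^sup>n a\<^sub>n\<close>, so \<open>\<sigma> a \<ge> 2\<^sup>n\<close> for all \<open>n\<close>.\<close>

lemma positive_functional_bounded_on_cone:
  assumes lin: "linear_functional_on_Ped \<sigma>" and pos: "positive_on_Ped \<sigma>"
    and D: "c_star_subalgebra D" "D \<subseteq> Ped"
  obtains K where "K \<ge> 0" "\<And>x. x \<in> D \<Longrightarrow> pos (unitization_embed x) \<Longrightarrow> cmod (\<sigma> x) \<le> K * norm x"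
proof -
  note lin = linear_functional_onD[OF lin]
  have cs: "csubspace D" and clD: "closed D" using D by (auto simp: c_star_subalgebra_def)
  have pos_val: "\<sigma> x \<in> \<real>\<^sub>\<ge>\<^sub>0" if "x \<in> D" "pos (unitization_embed x)" for x
    using pos that D by (auto simp: positive_on_Ped_def positive_cone_iff)
  have "\<exists>K. \<forall>x\<in>D. pos (unitization_embed x) \<longrightarrow> norm x \<le> 1 \<longrightarrow> Re (\<sigma> x) \<le> K"
  proof (rule ccontr)
    assume "\<not> ?thesis"
    then have "\<forall>n. \<exists>x\<in>D. pos (unitization_embed x) \<and> norm x \<le> 1 \<and> Re (\<sigma> x) > 4 ^ n"
      by (meson not_le)
    then obtain a where a: "\<And>n. a n \<in> D" "\<And>n. pos (unitization_embed (a n))" "\<And>n. norm (a n) \<le> 1"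
      "\<And>n::nat. Re (\<sigma> (a n)) > 4 ^ n"
      by metis
    define b where "b n = (1/2) ^ n *\<^sub>R a n" for n
    have b: "b n \<in> D" "pos (unitization_embed (b n))" for n
      using csubspace_scaleR[OF cs] a by (auto simp: b_def unitization_embed_simps pos_scaleR)
    have "summable b"
    proof (rule summable_comparison_test'[where N = 0])
      show "summable (\<lambda>n. (1/2 :: real) ^ n)" by (rule summable_geometric) simp
      show "norm (b n) \<le> (1/2) ^ n" for n using a(3) by (simp add: b_def mult_left_le)
    qed
    then have lim: "(\<lambda>N. sum b {..<N}) \<longlonglongrightarrow> suminf b" by (rule summable_LIMSEQ)
    have sum_D: "sum b A \<in> D" if "finite A" for A
      using that cs b by induction (auto simp: csubspace_def)
    have sum_pos: "pos (unitization_embed (sum b A))" if "finite A" for A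
      using that b by induction (auto simp: unitization_embed_simps pos_add)
    have s_D: "suminf b \<in> D" by (rule closed_sequentially[OF clD _ lim]) (simp add: sum_D)
    have "2 ^ n \<le> Re (\<sigma> (suminf b))" for n
    proof -
      have "pos (unitization_embed (suminf b - b n))"
      proof (rule pos_limit)
        \<comment> \<open>The shift by \<open>Suc n\<close> ensures that every partial sum contains
          \<open>b n\<close>.\<close>
        show "(\<lambda>N. unitization_embed (sum b {..<N + Suc n} - b n)) \<longlonglongrightarrow> unitization_embed (suminf b - b n)"
          by (intro bounded_linear.tendsto[OF bounded_linear_unitization_embed] tendsto_diff
              LIMSEQ_ignore_initial_segment[OF lim] tendsto_const)
        have "sum b {..<N + Suc n} - b n = sum b ({..<N + Suc n} - {n})" for N
          by (subst sum_diff) auto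
        then show "pos (unitization_embed (sum b {..<N + Suc n} - b n))" for N
          by (simp add: sum_pos)
      qed
      then have "\<sigma> (suminf b - b n) \<in> \<real>\<^sub>\<ge>\<^sub>0" by (intro pos_val csubspace_diff[OF cs] s_D b)
      then have "Re (\<sigma> (b n)) \<le> Re (\<sigma> (suminf b))"
        using s_D b(1) D by (auto simp: lin subset_iff complex_nonneg_Reals_iff)
      moreover have "Re (\<sigma> (b n)) = (1/2) ^ n * Re (\<sigma> (a n))"
        using a(1) D unfolding b_def by (simp add: lin subset_iff del: of_real_power of_real_divide)
      moreover have "(1/2) ^ n * 4 ^ n \<le> (1/2) ^ n * Re (\<sigma> (a n))"
        using a(4)[of n] by (intro mult_left_mono) auto
      moreover have "(1/2::real) ^ n * 4 ^ n = 2 ^ n" by (simp flip: power_mult_distrib)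
      ultimately show ?thesis by linarith
    qed
    moreover obtain n :: nat where "Re (\<sigma> (suminf b)) < 2 ^ n"
      using real_arch_pow[of 2] by auto
    ultimately show False by (meson not_le)
  qed
  then obtain K where K: "\<And>x. x \<in> D \<Longrightarrow> pos (unitization_embed x) \<Longrightarrow> norm x \<le> 1 \<Longrightarrow> Re (\<sigma> x) \<le> K"
    by blast
  have "cmod (\<sigma> x) \<le> \<bar>K\<bar> * norm x" if x: "x \<in> D" "pos (unitization_embed x)" for x
  proof (cases "x = 0")
    case False
    define y where "y = (1 / norm x) *\<^sub>R x"
    have y: "y \<in> D" "pos (unitization_embed y)" "norm y \<le> 1"
      using x False csubspace_scaleR[OF cs] by (auto simp: y_def unitization_embed_simps pos_scaleR)
    have "x = norm x *\<^sub>R y" using False by (simp add: y_def)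
    then have "\<sigma> x = norm x * \<sigma> y" using y(1) D lin(3)[of y "norm x"] by auto
    moreover have "cmod (\<sigma> y) = Re (\<sigma> y)"
      using pos_val[OF y(1,2)] by (auto simp: complex_nonneg_Reals_iff cmod_eq_Re)
    then have "cmod (\<sigma> y) \<le> \<bar>K\<bar>" using K[OF y] by simp
    then have "cmod (\<sigma> y) * norm x \<le> \<bar>K\<bar> * norm x" by (rule mult_right_mono) simp
    ultimately show ?thesis by (simp add: norm_mult mult.commute)
  qed (simp add: lin)
  then show ?thesis using that[of "\<bar>K\<bar>"] by simp
qed

text \<open>Real and imaginary part, each split into positive and negative part, give four positive
  elements of \<open>D\<close> of no larger norm; hence the constant 4 K.\<close>

lemma positive_functional_bounded:
  assumes lin: "linear_functional_on_Ped \<sigma>" and pos: "positive_on_Ped \<sigma>"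
    and D: "c_star_subalgebra D" "D \<subseteq> Ped"
  shows "\<exists>M. \<forall>x\<in>D. cmod (\<sigma> x) \<le> M * norm x"
proof -
  obtain K where K: "K \<ge> 0" "\<And>x. x \<in> D \<Longrightarrow> pos (unitization_embed x) \<Longrightarrow> cmod (\<sigma> x) \<le> K * norm x"
    by (rule positive_functional_bounded_on_cone[OF assms]) blast
  note lin = linear_functional_onD[OF lin]
  have sa: "cmod (\<sigma> h) \<le> 2 * K * norm h" if h: "h \<in> D" "cstar h = h" for h
  proof -
    have "cstar (unitization_embed h) = unitization_embed h" "unitization_embed h \<in> unitization_embed ` D"
      using h by (simp_all flip: unitization_embed_simps)
    then obtain p' q' where *: "pos p'" "pos q'" "p' \<in> unitization_embed ` D" "q' \<in> unitization_embed ` D"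
      "unitization_embed h = p' - q'" "norm p' \<le> norm h" "norm q' \<le> norm h"
      using pos_neg_parts_in_subalgebra[OF c_star_subalgebra_embed[OF D(1)]] norm_unitization_embed by metis
    then obtain p q where pq: "p' = unitization_embed p" "q' = unitization_embed q" "p \<in> D" "q \<in> D" by blast
    have "h = p - q"
      using *(5) unfolding pq by (simp flip: unitization_embed_simps(2))
    then have "cmod (\<sigma> h) \<le> cmod (\<sigma> p) + cmod (\<sigma> q)"
      using pq D by (simp add: lin subset_iff norm_triangle_ineq4)
    also have "\<dots> \<le> K * norm p + K * norm q" using * by (intro add_mono K) (simp_all add: pq)
    also have "\<dots> \<le> K * norm h + K * norm h" using * K(1) by (intro add_mono mult_left_mono) (simp_all add: pq)
    finally show ?thesis by simp
  qed
  have "cmod (\<sigma> x) \<le> 4 * K * norm x" if x: "x \<in> D" for x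
  proof -
    have D': "re_part x \<in> D" "im_part x \<in> D"
      using csubspace_re_im[of D x] D(1) x by (auto simp: c_star_subalgebra_def)
    have "\<sigma> x = \<sigma> (re_part x + \<i> *\<^sub>C im_part x)" using re_im_decomp[of x] by simp
    also have "\<dots> = \<sigma> (re_part x) + \<i> * \<sigma> (im_part x)"
      using D' D by (simp add: lin subset_iff Ped_intros)
    finally have "cmod (\<sigma> x) \<le> cmod (\<sigma> (re_part x)) + cmod (\<sigma> (im_part x))"
      using norm_triangle_ineq[of "\<sigma> (re_part x)" "\<i> * \<sigma> (im_part x)"] by (simp add: norm_mult)
    also have "\<dots> \<le> 2 * K * norm (re_part x) + 2 * K * norm (im_part x)"
      by (intro add_mono sa D') simp_all
    also have "\<dots> \<le> 2 * K * norm x + 2 * K * norm x"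
      using K(1) by (intro add_mono mult_left_mono norm_re_part norm_im_part) simp_all
    finally show ?thesis by simp
  qed
  then show ?thesis by blast
qed


section \<open>Decomposition of bounded traces\<close>

lemma bounded_hermitian_trace_unitization:
  assumes lin: "linear_functional_on_Ped \<tau>" and tr: "tracial_on_Ped \<tau>"
    and bdd: "\<And>D. c_star_subalgebra D \<Longrightarrow> D \<subseteq> Ped \<Longrightarrow> \<exists>M. \<forall>x\<in>D. cmod (\<tau> x) \<le> M * norm x"
    and herm: "\<And>x. x \<in> Ped \<Longrightarrow> \<tau> (cstar x) = cnj (\<tau> x)"
  shows "bounded_hermitian_trace (range unitization_embed) (\<tau> \<circ> elt)"
proof
  show "clinear_on unitization_ped (\<tau> \<circ> elt)"
    using lin by (auto simp: clinear_on_def linear_functional_on_Ped_def unitization_ped_eq)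
  show "tracial_on unitization_ped (\<tau> \<circ> elt)"
    using tr by (auto simp: tracial_on_def tracial_on_Ped_def unitization_ped_eq)
  show "(\<tau> \<circ> elt) (cstar x) = cnj ((\<tau> \<circ> elt) x)" if "x \<in> unitization_ped" for x
    using that herm by (auto simp: unitization_ped_eq)
  fix D :: "'a unitization set" assume D: "c_star_subalgebra D" "D \<subseteq> unitization_ped"
  have "unitization_embed -` D \<subseteq> Ped" using D(2) by (auto simp: Ped_eq)
  then obtain M where M: "\<And>x. unitization_embed x \<in> D \<Longrightarrow> cmod (\<tau> x) \<le> M * norm x"
    using bdd[OF c_star_subalgebra_vimage[OF D(1)]] by auto
  have "cmod ((\<tau> \<circ> elt) z) \<le> M * norm z" if z: "z \<in> D" for z
  proof -
    obtain x where "z = unitization_embed x" using z D(2) by (auto simp: unitization_ped_eq)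
    then show ?thesis using M z by simp
  qed
  then show "\<exists>M. \<forall>x\<in>D. cmod ((\<tau> \<circ> elt) x) \<le> M * norm x" by blast
qed

lemma hermitian_trace_decomposition:
  assumes "linear_functional_on_Ped \<tau>" "tracial_on_Ped \<tau>"
    and "\<And>D. c_star_subalgebra D \<Longrightarrow> D \<subseteq> Ped \<Longrightarrow> \<exists>M. \<forall>x\<in>D. cmod (\<tau> x) \<le> M * norm x"
    and "\<And>x. x \<in> Ped \<Longrightarrow> \<tau> (cstar x) = cnj (\<tau> x)"
  obtains \<sigma>\<^sub>1 \<sigma>\<^sub>2 where "positive_trace_on_Ped \<sigma>\<^sub>1" "positive_trace_on_Ped \<sigma>\<^sub>2"
    "\<And>x. x \<in> Ped \<Longrightarrow> \<tau> x = \<sigma>\<^sub>1 x - \<sigma>\<^sub>2 x"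
proof -
  interpret h: bounded_hermitian_trace "range unitization_embed" "\<tau> \<circ> elt"
    by (rule bounded_hermitian_trace_unitization) (use assms in auto)
  obtain \<sigma>\<^sub>1 \<sigma>\<^sub>2 where \<sigma>: "positive_trace_on unitization_ped \<sigma>\<^sub>1" "positive_trace_on unitization_ped \<sigma>\<^sub>2"
    "\<And>x. x \<in> unitization_ped \<Longrightarrow> (\<tau> \<circ> elt) x = \<sigma>\<^sub>1 x - \<sigma>\<^sub>2 x"
    by (rule h.jordan_decomposition) blast
  have "\<tau> x = (\<sigma>\<^sub>1 \<circ> unitization_embed) x - (\<sigma>\<^sub>2 \<circ> unitization_embed) x" if "x \<in> Ped" for x
    using \<sigma>(3)[of "unitization_embed x"] that by (simp add: embed_in_ped_iff)
  then show ?thesis using that positive_trace_on_unitization \<sigma>(1,2) by blast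
qed

lemma bounded_trace_decomposition:
  assumes lin: "linear_functional_on_Ped \<tau>" and tr: "tracial_on_Ped \<tau>"
    and bdd: "\<And>D. c_star_subalgebra D \<Longrightarrow> D \<subseteq> Ped \<Longrightarrow> \<exists>M. \<forall>x\<in>D. cmod (\<tau> x) \<le> M * norm x"
  obtains \<sigma>\<^sub>1 \<sigma>\<^sub>2 \<sigma>\<^sub>3 \<sigma>\<^sub>4 where "positive_trace_on_Ped \<sigma>\<^sub>1" "positive_trace_on_Ped \<sigma>\<^sub>2"
    "positive_trace_on_Ped \<sigma>\<^sub>3" "positive_trace_on_Ped \<sigma>\<^sub>4"
    "\<And>x. x \<in> Ped \<Longrightarrow> \<tau> x = \<sigma>\<^sub>1 x - \<sigma>\<^sub>2 x + \<i> * (\<sigma>\<^sub>3 x - \<sigma>\<^sub>4 x)"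
proof -
  \<comment> \<open>Twice the hermitian part of c \<tau>. The values 1/2 and -i/2 of
    \<open>c\<close> give the real and the imaginary part of \<tau> with respect to the
    adjoint.\<close>
  define \<mu> where "\<mu> c x = c * \<tau> x + cnj (c * \<tau> (cstar x))" for c x
  have "\<exists>\<sigma>\<^sub>1 \<sigma>\<^sub>2. positive_trace_on_Ped \<sigma>\<^sub>1 \<and> positive_trace_on_Ped \<sigma>\<^sub>2 \<and> (\<forall>x\<in>Ped. \<mu> c x = \<sigma>\<^sub>1 x - \<sigma>\<^sub>2 x)" for c
  proof -
    have "linear_functional_on_Ped (\<mu> c)"
      unfolding linear_functional_on_Ped_def \<mu>_def
      by (auto simp: linear_functional_onD[OF lin] Ped_intros cstar_add cstar_scaleC algebra_simps)
    moreover have "tracial_on_Ped (\<mu> c)"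
      using tr unfolding tracial_on_Ped_def \<mu>_def by (auto simp: cstar_mult Ped_intros)
    moreover have "\<exists>M. \<forall>x\<in>D. cmod (\<mu> c x) \<le> M * norm x" if D: "c_star_subalgebra D" "D \<subseteq> Ped" for D
    proof -
      obtain M where M: "\<And>x. x \<in> D \<Longrightarrow> cmod (\<tau> x) \<le> M * norm x" using bdd[OF D] by blast
      have "cmod (\<mu> c x) \<le> (2 * cmod c * M) * norm x" if x: "x \<in> D" for x
      proof -
        have "cstar x \<in> D" using x D by (simp add: c_star_subalgebra_def)
        then have "cmod c * cmod (\<tau> x) \<le> cmod c * (M * norm x)"
          "cmod c * cmod (\<tau> (cstar x)) \<le> cmod c * (M * norm x)"
          using M[OF x] M[of "cstar x"] by (simp_all add: mult_left_mono)
        moreover have "cmod (\<mu> c x) \<le> cmod c * cmod (\<tau> x) + cmod c * cmod (\<tau> (cstar x))"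
          unfolding \<mu>_def by (rule order_trans[OF norm_triangle_ineq]) (simp add: norm_mult)
        ultimately show ?thesis by (simp add: algebra_simps)
      qed
      then show ?thesis by blast
    qed
    moreover have "\<mu> c (cstar x) = cnj (\<mu> c x)" for x by (simp add: \<mu>_def cstar_cstar)
    ultimately show ?thesis using hermitian_trace_decomposition[of "\<mu> c"] by metis
  qed
  then obtain \<sigma>\<^sub>1 \<sigma>\<^sub>2 \<sigma>\<^sub>3 \<sigma>\<^sub>4 where \<sigma>: "positive_trace_on_Ped \<sigma>\<^sub>1" "positive_trace_on_Ped \<sigma>\<^sub>2"
    "positive_trace_on_Ped \<sigma>\<^sub>3" "positive_trace_on_Ped \<sigma>\<^sub>4"
    "\<And>x. x \<in> Ped \<Longrightarrow> \<mu> (1/2) x = \<sigma>\<^sub>1 x - \<sigma>\<^sub>2 x" "\<And>x. x \<in> Ped \<Longrightarrow> \<mu> (- \<i>/2) x = \<sigma>\<^sub>3 x - \<sigma>\<^sub>4 x"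
    by metis
  have "\<tau> x = \<mu> (1/2) x + \<i> * \<mu> (- \<i>/2) x" for x
    by (simp add: \<mu>_def algebra_simps flip: mult.assoc)
  then show ?thesis using that[OF \<sigma>(1-4)] \<sigma>(5,6) by simp
qed

theorem corollary3p7:
  fixes \<tau> :: "'a::c_star_algebra \<Rightarrow> complex"
  assumes "linear_functional_on_Ped \<tau>" and "tracial_on_Ped \<tau>"
  shows "continuous_map Ped_topology euclidean \<tau> \<longleftrightarrow>
    (\<exists>(n::nat) (c :: nat \<Rightarrow> complex) (\<sigma> :: nat \<Rightarrow> 'a \<Rightarrow> complex).
       (\<forall>i<n. positive_trace_on_Ped (\<sigma> i)) \<and>
       (\<forall>x\<in>Ped. \<tau> x = (\<Sum>i<n. c i * \<sigma> i x)))"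
proof
  assume "continuous_map Ped_topology euclidean \<tau>"
  then obtain \<sigma>\<^sub>1 \<sigma>\<^sub>2 \<sigma>\<^sub>3 \<sigma>\<^sub>4 where \<sigma>: "positive_trace_on_Ped \<sigma>\<^sub>1" "positive_trace_on_Ped \<sigma>\<^sub>2"
    "positive_trace_on_Ped \<sigma>\<^sub>3" "positive_trace_on_Ped \<sigma>\<^sub>4"
    "\<And>x. x \<in> Ped \<Longrightarrow> \<tau> x = \<sigma>\<^sub>1 x - \<sigma>\<^sub>2 x + \<i> * (\<sigma>\<^sub>3 x - \<sigma>\<^sub>4 x)"
    using bounded_trace_decomposition[OF assms continuous_Ped_imp_bounded[OF assms(1)]] by metis
  define \<sigma> where "\<sigma> i = [\<sigma>\<^sub>1, \<sigma>\<^sub>2, \<sigma>\<^sub>3, \<sigma>\<^sub>4] ! i" for i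
  define c where "c i = [1, - 1, \<i>, - \<i>] ! i" for i
  have "\<forall>i<4. positive_trace_on_Ped (\<sigma> i)"
    using \<sigma>(1-4) by (auto simp: \<sigma>_def less_Suc_eq numeral_eq_Suc)
  moreover have "\<forall>x\<in>Ped. \<tau> x = (\<Sum>i<4. c i * \<sigma> i x)"
    using \<sigma>(5) by (simp add: \<sigma>_def c_def numeral_eq_Suc algebra_simps)
  ultimately show "\<exists>(n::nat) c \<sigma>. (\<forall>i<n. positive_trace_on_Ped (\<sigma> i)) \<and>
       (\<forall>x\<in>Ped. \<tau> x = (\<Sum>i<n. c i * \<sigma> i x))"
    by blast
next
  assume "\<exists>(n::nat) c \<sigma>. (\<forall>i<n. positive_trace_on_Ped (\<sigma> i)) \<and>
       (\<forall>x\<in>Ped. \<tau> x = (\<Sum>i<n. c i * \<sigma> i x))"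
  then obtain n :: nat and c \<sigma> where \<sigma>: "\<And>i. i < n \<Longrightarrow> positive_trace_on_Ped (\<sigma> i)"
    "\<And>x. x \<in> Ped \<Longrightarrow> \<tau> x = (\<Sum>i<n. c i * \<sigma> i x)"
    by blast
  show "continuous_map Ped_topology euclidean \<tau>"
  proof (rule bounded_imp_continuous_Ped[OF assms(1)])
    fix D :: "'a set" assume D: "c_star_subalgebra D" "D \<subseteq> Ped"
    have "\<exists>M. \<forall>x\<in>D. cmod (\<sigma> i x) \<le> M * norm x" if "i < n" for i
      using \<sigma>(1)[OF that] positive_functional_bounded[OF _ _ D] by (simp add: positive_trace_on_Ped_def)
    then obtain M where M: "\<And>i x. i < n \<Longrightarrow> x \<in> D \<Longrightarrow> cmod (\<sigma> i x) \<le> M i * norm x" by metis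
    have "cmod (\<tau> x) \<le> (\<Sum>i<n. cmod (c i) * M i) * norm x" if x: "x \<in> D" for x
    proof -
      have "cmod (\<tau> x) \<le> (\<Sum>i<n. cmod (c i * \<sigma> i x))"
        using \<sigma>(2) D x by (simp add: subset_iff norm_sum)
      also have "\<dots> \<le> (\<Sum>i<n. cmod (c i) * (M i * norm x))"
        by (intro sum_mono) (simp add: norm_mult mult_left_mono M x)
      finally show ?thesis by (simp add: sum_distrib_right mult.assoc)
    qed
    then show "\<exists>M. \<forall>x\<in>D. cmod (\<tau> x) \<le> M * norm x" by blast
  qed
qed

end
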